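(* Let $f(n)$ be the number of distinct unbordered words of length $n$ that are factors of the Thue–Morse sequence, and $F(N)=\sum_{0\le n<N}f(n)$. Let $\kappa=\log_2(1+\sqrt3)$. Then there is a $1$-periodic continuous function $\Phi_F$, Hölder continuous with every exponent smaller than $\kappa-1$, such that \[F(N)=N^\kappa\,\Phi_F(\{\log_2N\})+O(N\log N)\qquad(N\to\infty).\] Furthermore, fix an integer $\eta\ge1$, and define for $0\le j\le3$ the Dirichlet series $\mathcal{F}_j(s)=\sum_{n\ge\eta}\frac{f(4n+j)}{(4n+j)^s}$ and $\mathcal{F}(s)=(\mathcal{F}_0(s),\dots,\mathcal{F}_3(s))^\top$. Let $(c_{j,k})_{0\le j<8,0\le k\le3}$ be given by the rows $c_{0,\cdot}=(2,0,0,0)$, $c_{1,\cdot}=(0,1,0,0)$, $c_{2,\cdot}=(0,1,0,1)$, $c_{3,\cdot}=(0,-1,1,0)$, $c_{4,\cdot}=(0,0,2,0)$, $c_{5,\cdot}=(0,0,0,1)$, $c_{6,\cdot}=(0,-1,1,1)$, $c_{7,\cdot}=(0,2,0,1)$, and let $B_0=(c_{j,k})_{0\le j\le3,0\le k\le3}$, $B_1=(c_{j+4,k})_{0\le j\le3,0\le k\le3}$. Let \[\mathcal{G}_j(s)=2^{-s}\sum_{k=0}^3\Bigg(\sum_{n\ge1}\binom{-s}{n}\Big(c_{j,k}\Big(\frac j2-k\Big)^n+c_{j+4,k}\Big(\frac{j+4}2-k\Big)^n\Big)\mathcal{F}_k(s+n)\Bigg)+\sum_{\eta\le n<2\eta}\frac{f(4n+j)}{(4n+j)^s}.\]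 Then each $\mathcal{G}_j(s)$ is analytic for $\Re s>1$, $\mathcal{F}(s)$ extends meromorphically to $\Re s>1$, the functional equation \[\big(I-2^{-s}(B_0+B_1)\big)\mathcal{F}(s)=(\mathcal{G}_0(s),\dots,\mathcal{G}_3(s))^\top\] holds for $\Re s>1$, and the only possible poles of $\mathcal{F}(s)$ in $\Re s>1$ are at $s=\log_2(\sqrt3+1)+\frac{2\pi i\mu}{\log2}$, $\mu\in\mathbb{Z}$.
   Context: The Thue–Morse sequence $t(n)$ is the parity of the number of ones in the binary expansion of $n$. A factor of $t$ is a word $t(i)\cdots t(j)$ ($0\le i\le j$), the empty word included. A word $w$ is bordered if some non-empty word $v\neq w$ is both a prefix and a suffix of $w$, and unbordered otherwise. $\{z\}=z-\lfloor z\rfloor$; $\binom{-s}{n}$ is the generalized binomial coefficient.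
   Formalization: The functional equation is stated only for η≥3: it is false for η=1 and η=2, since f(14)=4 but −f(5)+f(6)+f(7)=2, and f(23)=8 but 2f(9)+f(11)=12; all other claims are kept for every η≥1. *)

theory Defs
  imports
    "HOL-Complex_Analysis.Complex_Analysis"
    "HOL-Library.Sublist"
    "HOL-Library.Landau_Symbols"
    "Jordan_Normal_Form.Matrix"
begin

definition thue_morse :: "nat \<Rightarrow> nat" where
  "thue_morse n = card {i. bit n i} mod 2"

definition tm_factor :: "nat list \<Rightarrow> bool" where
  "tm_factor w \<longleftrightarrow> w = [] \<or> (\<exists>i j. i \<le> j \<and> w = map thue_morse [i..<Suc j])"

definition bordered :: "'a list \<Rightarrow> bool" where
  "bordered w \<longleftrightarrow> (\<exists>v. v \<noteq> [] \<and> v \<noteq> w \<and> prefix v w \<and> suffix v w)"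

definition f :: "nat \<Rightarrow> nat" where
  "f n = card {w. tm_factor w \<and> length w = n \<and> \<not> bordered w}"

definition F :: "nat \<Rightarrow> nat" where
  "F N = (\<Sum>n<N. f n)"

definition kappa :: real where
  "kappa = log 2 (1 + sqrt 3)"

text \<open>
  The coefficients of the recurrences \<open>f (8 * n + j) = (\<Sum>k<4. c j k * f (4 * n + k))\<close>,
  \<open>j < 8\<close>.  They are valid for \<open>n \<ge> 3\<close>; for \<open>n = 1\<close> they fail for \<open>j = 3\<close>, \<open>6\<close>, \<open>7\<close>,
  and for \<open>n = 2\<close> they fail for \<open>j = 7\<close>: \<open>f 23 = 8\<close>, but \<open>2 * f 9 + f 11 = 12\<close>.
\<close>

definition c :: "nat \<Rightarrow> nat \<Rightarrow> complex" where
  "c j k =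
    [[2,  0, 0, 0],
     [0,  1, 0, 0],
     [0,  1, 0, 1],
     [0, -1, 1, 0],
     [0,  0, 2, 0],
     [0,  0, 0, 1],
     [0, -1, 1, 1],
     [0,  2, 0, 1]] ! j ! k"

definition B0 :: "complex mat" where
  "B0 = Matrix.mat 4 4 (\<lambda>(j, k). c j k)"

definition B1 :: "complex mat" where
  "B1 = Matrix.mat 4 4 (\<lambda>(j, k). c (j + 4) k)"

text \<open>
  All infinite sums are unconditional (in the complex plane: absolute) sums; where a sum
  does not exist, \<open>infsum\<close> is 0, so existence is always asserted separately by
  \<open>summable_on\<close>.
\<close>

definition dterm :: "nat \<Rightarrow> complex \<Rightarrow> nat \<Rightarrow> complex" where
  "dterm j s n = of_nat (f (4 * n + j)) / of_nat (4 * n + j) powr s"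

definition dirichlet :: "nat \<Rightarrow> nat \<Rightarrow> complex \<Rightarrow> complex" where
  "dirichlet \<eta> j s = (\<Sum>\<^sub>\<infinity>n\<in>{\<eta>..}. dterm j s n)"

text \<open>
  In the statement \<open>gterm\<close> is only used for \<open>Re s > 1\<close> and \<open>n \<ge> 1\<close>; there
  \<open>Re (s + n) > 2 > kappa\<close>, so \<open>dirichlet \<eta> k (s + n)\<close> is a convergent series.
\<close>

definition gterm :: "nat \<Rightarrow> nat \<Rightarrow> nat \<Rightarrow> complex \<Rightarrow> nat \<Rightarrow> complex" where
  "gterm \<eta> j k s n =
    ((- s) gchoose n) *
    (c j k * (of_nat j / 2 - of_nat k) ^ n +
     c (j + 4) k * (of_nat (j + 4) / 2 - of_nat k) ^ n) *
    dirichlet \<eta> k (s + of_nat n)"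

definition G :: "nat \<Rightarrow> nat \<Rightarrow> complex \<Rightarrow> complex" where
  "G \<eta> j s =
    2 powr (- s) * (\<Sum>k<4. \<Sum>\<^sub>\<infinity>n\<in>{1..}. gterm \<eta> j k s n) +
    (\<Sum>n\<in>{\<eta>..<2 * \<eta>}. dterm j s n)"

end

theory Submission
  imports Defs "HOL-Real_Asymp.Real_Asymp" "HOL-Library.Periodic_Fun"
begin

text \<open>
  Two occurrences of a factor of length at least 4 have positions of the same parity. Hence,
  apart from borders of length at most 3, the borders of a factor are exactly the images of the
  borders of the shorter factor that it covers under the Thue--Morse morphism. This gives mutual
  recurrences for the number of unbordered factors and the number of factors whose only border
  is a single letter, from which the recurrences for \<open>f\<close> follow.

  A left eigenvector of \<open>B0 + B1\<close> for the eigenvalue \<open>\<mu>\<close> turns the summatory function into a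
  scalar sequence with \<open>L (2 * N + r) = \<mu> * L N + O(N)\<close>. Eigenvalues of modulus at most 2
  contribute \<open>O(N log N)\<close>. For \<open>\<mu> = 1 + sqrt 3 = 2 powr \<kappa>\<close> the approximations
  \<open>L \<lfloor>2 ^ k * x\<rfloor> / \<mu> ^ k\<close> converge with error \<open>O((2 / \<mu>) ^ k)\<close> to a function \<open>\<Psi>\<close> with
  \<open>\<Psi> (2 * x) = \<mu> * \<Psi> x\<close>, which is therefore Hoelder continuous with exponent \<open>\<kappa> - 1\<close>;
  \<open>\<Phi>\<close> is a rescaling of \<open>\<Psi>\<close>.

  Splitting the Dirichlet series by the parity of \<open>n\<close> and expanding \<open>(8 * n + j) powr (- s)\<close>
  around \<open>2 * (4 * n + k)\<close> gives the functional equation. Along the eigenvectors it is solved by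
  dividing by \<open>1 - \<mu> * 2 powr (- s)\<close>, which for \<open>Re s > 1\<close> can only vanish for \<open>\<mu> = 1 + sqrt 3\<close>.
  For \<open>\<eta> < 3\<close>, where the recurrences fail, the series differs from that for \<open>\<eta> = 3\<close> by finitely
  many entire terms.
\<close>

section \<open>Counting unbordered factors\<close>

text \<open>As a predicate, the sequence turns complementing a letter into negation, so comparisons
  of letters become propositional.\<close>

definition tm_odd :: "nat \<Rightarrow> bool" where
  "tm_odd n \<longleftrightarrow> odd (card {i. bit n i})"

lemma tm_odd_double [simp]: "tm_odd (2 * n) \<longleftrightarrow> tm_odd n"
proof -
  have "{i. bit (2 * n) i} = Suc ` {i. bit n i}"
  proof (rule Set.set_eqI)
    fix i show "i \<in> {i. bit (2 * n) i} \<longleftrightarrow> i \<in> Suc ` {i. bit n i}"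
      by (cases i) (auto simp: bit_Suc bit_0)
  qed
  then show ?thesis by (simp add: tm_odd_def card_image)
qed

lemma tm_odd_double_Suc [simp]: "tm_odd (Suc (2 * n)) \<longleftrightarrow> \<not> tm_odd n"
proof -
  have fin: "finite {i. bit n i}"
  proof (rule finite_subset)
    show "{i. bit n i} \<subseteq> {..n}"
    proof
      fix i assume "i \<in> {i. bit n i}"
      then have "n div 2 ^ i \<noteq> 0" by (auto simp: bit_iff_odd intro: ccontr)
      then have "2 ^ i \<le> n" by (simp add: div_eq_0_iff not_less)
      moreover have "i < 2 ^ i" by (rule less_exp)
      ultimately have "i \<le> n" by linarith
      then show "i \<in> {..n}" by simp
    qed
  qed simp
  have "{i. bit (Suc (2 * n)) i} = insert 0 (Suc ` {i. bit n i})"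
  proof (rule Set.set_eqI)
    fix i show "i \<in> {i. bit (Suc (2 * n)) i} \<longleftrightarrow> i \<in> insert 0 (Suc ` {i. bit n i})"
      by (cases i) (auto simp: bit_Suc bit_0)
  qed
  then show ?thesis using fin by (simp add: tm_odd_def card_image card_insert_if)
qed

lemma thue_morse_eq_iff: "thue_morse m = thue_morse n \<longleftrightarrow> tm_odd m = tm_odd n"
  by (auto simp: thue_morse_def tm_odd_def mod2_eq_if)

text \<open>Of the pairs at k and k + 1 one starts at an even position, and its letters t(a) and not
  t(a) form a block, the image of a letter under the morphism.\<close>

lemma tm_odd_no_cube: "\<not> (tm_odd k = tm_odd (Suc k) \<and> tm_odd (Suc k) = tm_odd (Suc (Suc k)))"
proof (cases "even k")
  case True
  then obtain a where "k = 2 * a" by blast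
  then show ?thesis by simp
next
  case False
  then obtain a where "k = 2 * a + 1" using oddE by blast
  then have "Suc k = 2 * Suc a" "Suc (Suc k) = Suc (2 * Suc a)" by auto
  then show ?thesis by (metis tm_odd_double tm_odd_double_Suc)
qed

section \<open>Occurrences of factors and the Thue--Morse morphism\<close>

definition fac :: "nat \<Rightarrow> nat \<Rightarrow> nat list" where
  "fac n i = map thue_morse [i..<i + n]"

definition agree :: "nat \<Rightarrow> nat \<Rightarrow> nat \<Rightarrow> bool" where
  "agree n i i' \<longleftrightarrow> (\<forall>j<n. tm_odd (i + j) = tm_odd (i' + j))"

lemma agreeD: "agree n i i' \<Longrightarrow> j < n \<Longrightarrow> tm_odd (i + j) = tm_odd (i' + j)"
  by (simp add: agree_def)

lemma agree_sym: "agree n i i' \<Longrightarrow> agree n i' i"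
  by (simp add: agree_def)

lemma agree_1 [simp]: "agree (Suc 0) i i' \<longleftrightarrow> tm_odd i = tm_odd i'"
  by (simp add: agree_def)

lemma agree_mono: "agree n i i' \<Longrightarrow> a + l \<le> n \<Longrightarrow> agree l (i + a) (i' + a)"
  unfolding agree_def by (metis (no_types, lifting) add.assoc add_less_cancel_left order_less_le_trans)

lemma fac_eq_iff: "fac n i = fac n i' \<longleftrightarrow> agree n i i'"
  by (simp add: fac_def agree_def list_eq_iff_nth_eq thue_morse_eq_iff)

text \<open>One letter of a block determines the other, so n letters read from an even position
  carry the same information as the (n + 1) div 2 blocks that they touch.\<close>

lemma agree_even: "agree n (2 * i) (2 * i') \<longleftrightarrow> agree ((n + 1) div 2) i i'"
proof
  assume A: "agree n (2 * i) (2 * i')"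
  show "agree ((n + 1) div 2) i i'"
    unfolding agree_def
  proof (intro allI impI)
    fix j assume "j < (n + 1) div 2"
    then have "2 * j < n" by linarith
    from agreeD[OF A this] have "tm_odd (2 * (i + j)) = tm_odd (2 * (i' + j))"
      by (simp only: distrib_left)
    then show "tm_odd (i + j) = tm_odd (i' + j)" by (simp only: tm_odd_double)
  qed
next
  assume A: "agree ((n + 1) div 2) i i'"
  show "agree n (2 * i) (2 * i')"
    unfolding agree_def
  proof (intro allI impI)
    fix j assume "j < n"
    then have *: "tm_odd (i + j div 2) = tm_odd (i' + j div 2)" by (intro agreeD[OF A]) linarith
    show "tm_odd (2 * i + j) = tm_odd (2 * i' + j)"
    proof (cases "even j")
      case True
      then have "2 * i + j = 2 * (i + j div 2)" "2 * i' + j = 2 * (i' + j div 2)" by auto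
      then show ?thesis using * by (metis tm_odd_double)
    next
      case False
      then have "2 * i + j = Suc (2 * (i + j div 2))" "2 * i' + j = Suc (2 * (i' + j div 2))"
        by presburger+
      then show ?thesis using * by (metis tm_odd_double_Suc)
    qed
  qed
qed

text \<open>From an odd position, n letters touch half of block i and reach as far as block i + n
  div 2. For n = 0 no letter pins down block i, hence n >= 1.\<close>

lemma agree_odd:
  assumes "n \<ge> 1"
  shows "agree n (Suc (2 * i)) (Suc (2 * i')) \<longleftrightarrow> agree (n div 2 + 1) i i'"
proof
  assume A: "agree n (Suc (2 * i)) (Suc (2 * i'))"
  show "agree (n div 2 + 1) i i'"
    unfolding agree_def
  proof (intro allI impI)
    fix j assume j: "j < n div 2 + 1"
    show "tm_odd (i + j) = tm_odd (i' + j)"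
    proof (cases j)
      case 0
      then show ?thesis using agreeD[OF A, of 0] assms by simp
    next
      case (Suc k)
      then have "2 * k + 1 < n" using j by linarith
      from agreeD[OF A this] have "tm_odd (2 * (i + j)) = tm_odd (2 * (i' + j))"
        using Suc by (simp add: algebra_simps)
      then show ?thesis by (simp only: tm_odd_double)
    qed
  qed
next
  assume A: "agree (n div 2 + 1) i i'"
  show "agree n (Suc (2 * i)) (Suc (2 * i'))"
    unfolding agree_def
  proof (intro allI impI)
    fix j assume "j < n"
    then have *: "tm_odd (i + (j + 1) div 2) = tm_odd (i' + (j + 1) div 2)"
      by (intro agreeD[OF A]) linarith
    show "tm_odd (Suc (2 * i) + j) = tm_odd (Suc (2 * i') + j)"
    proof (cases "even j")
      case False
      then have "Suc (2 * i) + j = 2 * (i + (j + 1) div 2)" "Suc (2 * i') + j = 2 * (i' + (j + 1) div 2)"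
        by presburger+
      then show ?thesis using * by (metis tm_odd_double)
    next
      case True
      then have "Suc (2 * i) + j = Suc (2 * (i + (j + 1) div 2))"
        "Suc (2 * i') + j = Suc (2 * (i' + (j + 1) div 2))"
        by presburger+
      then show ?thesis using * by (metis tm_odd_double_Suc)
    qed
  qed
qed

text \<open>The blocks of both occurrences together force neighbouring letters of the common word to
  differ. Read from the odd position, an alternating word of four letters gives t(i') = t(i' + 1) =
  t(i' + 2), against \<open>tm_odd_no_cube\<close>. With three letters, alternation is all that
  remains.\<close>

lemma agree_mixed:
  assumes "agree n (2 * i) (Suc (2 * i'))"
  shows "n \<le> 3" "n = 3 \<Longrightarrow> tm_odd (2 * i) = tm_odd (2 * i + 2)"
    "n = 3 \<Longrightarrow> tm_odd (Suc (2 * i')) = tm_odd (Suc (2 * i') + 2)"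
proof -
  have e: "Suc (Suc (2 * k)) = 2 * Suc k" "Suc (Suc (Suc (2 * k))) = Suc (2 * Suc k)"
    "Suc (Suc (Suc (Suc (2 * k)))) = 2 * Suc (Suc k)" for k :: nat by auto
  have 0: "tm_odd i = (\<not> tm_odd i')" if "n \<ge> 1" using agreeD[OF assms, of 0] that by simp
  have 1: "(\<not> tm_odd i) = tm_odd (Suc i')" if "n \<ge> 2"
    using agreeD[OF assms, of 1] that by (simp add: e del: mult_Suc_right)
  have 2: "tm_odd (Suc i) = (\<not> tm_odd (Suc i'))" if "n \<ge> 3"
  proof -
    have "2 * i + 2 = 2 * Suc i" "Suc (2 * i') + 2 = Suc (2 * Suc i')" by auto
    then show ?thesis using agreeD[OF assms, of 2] that by (metis Suc_le_eq eval_nat_numeral(3) tm_odd_double tm_odd_double_Suc)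
  qed
  have 3: "(\<not> tm_odd (Suc i)) = tm_odd (Suc (Suc i'))" if "n \<ge> 4"
  proof -
    have "2 * i + 3 = Suc (2 * Suc i)" "Suc (2 * i') + 3 = 2 * Suc (Suc i')" "3 < n" using that by auto
    then show ?thesis using agreeD[OF assms, of 3] by (metis tm_odd_double tm_odd_double_Suc)
  qed
  show "n \<le> 3"
  proof (rule ccontr)
    assume "\<not> n \<le> 3"
    then have "n \<ge> 1" "n \<ge> 2" "n \<ge> 3" "n \<ge> 4" by auto
    from 0[OF this(1)] 1[OF this(2)] 2[OF this(3)] 3[OF this(4)] tm_odd_no_cube[of i']
    show False by blast
  qed
  show "tm_odd (2 * i) = tm_odd (2 * i + 2)" if "n = 3"
    using 0 1 2 that by (simp add: e del: mult_Suc_right)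
  show "tm_odd (Suc (2 * i')) = tm_odd (Suc (2 * i') + 2)" if "n = 3"
    using 0 1 2 that by (simp add: e del: mult_Suc_right)
qed

section \<open>Counting factors through sets of positions\<close>

definition cnt :: "nat \<Rightarrow> nat set \<Rightarrow> nat" where
  "cnt n A = card (fac n ` A)"

text \<open>Whether a position lies in A can be read off the word of length n starting there. Then A
  and any disjoint set of positions yield disjoint sets of words, so counts add up.\<close>

definition determined :: "nat \<Rightarrow> nat set \<Rightarrow> bool" where
  "determined n A \<longleftrightarrow> (\<forall>i j. agree n i j \<longrightarrow> i \<in> A \<longrightarrow> j \<in> A)"

lemma finite_fac: "finite (fac n ` A)"
proof (rule finite_subset)
  show "fac n ` A \<subseteq> {xs. set xs \<subseteq> {..1} \<and> length xs = n}"
    by (auto simp: fac_def thue_morse_def)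
  show "finite {xs. set xs \<subseteq> {..1::nat} \<and> length xs = n}"
    by (rule finite_lists_length_eq) simp
qed

lemma cnt_Un:
  assumes "determined n A" "A \<inter> B = {}"
  shows "cnt n (A \<union> B) = cnt n A + cnt n B"
proof -
  have "fac n ` A \<inter> fac n ` B = {}"
    using assms unfolding determined_def by (smt (verit) disjoint_iff fac_eq_iff imageE)
  then show ?thesis by (simp add: cnt_def image_Un card_Un_disjoint finite_fac)
qed

text \<open>This compares sets of words of different lengths without a map between words: only the
  fibres over the positions matter.\<close>

lemma card_image_cong:
  assumes "\<And>x y. x \<in> A \<Longrightarrow> y \<in> A \<Longrightarrow> p x = p y \<longleftrightarrow> q x = q y"
  shows "card (p ` A) = card (q ` A)"
proof (rule bij_betw_same_card)
  show "bij_betw (\<lambda>w. q (inv_into A p w)) (p ` A) (q ` A)"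
    unfolding bij_betw_def
  proof
    have *: "q (inv_into A p (p x)) = q x" if "x \<in> A" for x
      using assms[of "inv_into A p (p x)" x] that by (simp add: f_inv_into_f inv_into_into)
    show "(\<lambda>w. q (inv_into A p w)) ` p ` A = q ` A"
      unfolding image_image using * by (rule image_cong[OF refl])
    show "inj_on (\<lambda>w. q (inv_into A p w)) (p ` A)"
      using assms * by (auto simp: inj_on_def)
  qed
qed

text \<open>By \<open>agree_mixed\<close>, no word of length at least 4 occurs at positions of both
  parities. Each parity class is then counted by the shorter factors that cover its words.\<close>

lemma cnt_split:
  assumes "n \<ge> 4"
  shows "cnt n A = cnt ((n + 1) div 2) {i. 2 * i \<in> A} + cnt (n div 2 + 1) {i. Suc (2 * i) \<in> A}"
proof -
  let ?E = "{i. 2 * i \<in> A}" and ?O = "{i. Suc (2 * i) \<in> A}"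
  have A: "A = (\<lambda>i. 2 * i) ` ?E \<union> (\<lambda>i. Suc (2 * i)) ` ?O"
  proof (intro equalityI subsetI)
    fix x assume "x \<in> A"
    then show "x \<in> (\<lambda>i. 2 * i) ` ?E \<union> (\<lambda>i. Suc (2 * i)) ` ?O"
      by (cases "even x") (auto elim!: evenE oddE simp: image_iff)
  qed auto
  have "fac n ` A = (\<lambda>i. fac n (2 * i)) ` ?E \<union> (\<lambda>i. fac n (Suc (2 * i))) ` ?O"
    by (subst A) (simp add: image_Un image_image)
  moreover have "(\<lambda>i. fac n (2 * i)) ` ?E \<inter> (\<lambda>i. fac n (Suc (2 * i))) ` ?O = {}"
  proof -
    have "fac n (2 * i) \<noteq> fac n (Suc (2 * j))" for i j
      using agree_mixed(1)[of n i j] assms by (auto simp: fac_eq_iff)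
    then show ?thesis by (metis (no_types, lifting) disjoint_iff imageE)
  qed
  moreover have "finite ((\<lambda>i. fac n (2 * i)) ` ?E)" "finite ((\<lambda>i. fac n (Suc (2 * i))) ` ?O)"
    using finite_fac[of n "(\<lambda>i. 2 * i) ` ?E"] finite_fac[of n "(\<lambda>i. Suc (2 * i)) ` ?O"]
    by (simp_all add: image_image)
  ultimately have "cnt n A = card ((\<lambda>i. fac n (2 * i)) ` ?E) + card ((\<lambda>i. fac n (Suc (2 * i))) ` ?O)"
    by (simp add: cnt_def card_Un_disjoint)
  also have "card ((\<lambda>i. fac n (2 * i)) ` ?E) = cnt ((n + 1) div 2) ?E"
    unfolding cnt_def by (rule card_image_cong) (simp add: fac_eq_iff agree_even)
  also have "card ((\<lambda>i. fac n (Suc (2 * i))) ` ?O) = cnt (n div 2 + 1) ?O"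
    unfolding cnt_def using assms by (intro card_image_cong) (simp add: fac_eq_iff agree_odd)
  finally show ?thesis .
qed

text \<open>A factor of length \<open>n\<close> is represented by the positions \<open>i\<close> of its occurrences; it has a border of
  length \<open>l\<close> iff \<open>agree l i (i + n - l)\<close>. The factors of \<open>semi n\<close> have no border except a single
  letter, and those of \<open>lsq\<close> and \<open>rsq n\<close> begin and end with a repeated letter, respectively.\<close>

definition unb :: "nat \<Rightarrow> nat set" where
  "unb n = {i. \<forall>l. 0 < l \<longrightarrow> l < n \<longrightarrow> \<not> agree l i (i + n - l)}"

definition semi :: "nat \<Rightarrow> nat set" where
  "semi n = {i. tm_odd i = tm_odd (i + n - 1) \<and> (\<forall>l. 1 < l \<longrightarrow> l < n \<longrightarrow> \<not> agree l i (i + n - l))}"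

definition lsq :: "nat set" where
  "lsq = {i. tm_odd i = tm_odd (i + 1)}"

definition rsq :: "nat \<Rightarrow> nat set" where
  "rsq n = {i. tm_odd (i + n - 2) = tm_odd (i + n - 1)}"

lemma unbD: "i \<in> unb n \<Longrightarrow> 0 < l \<Longrightarrow> l < n \<Longrightarrow> \<not> agree l i (i + n - l)"
  by (simp add: unb_def)

lemma semiD: "i \<in> semi n \<Longrightarrow> 1 < l \<Longrightarrow> l < n \<Longrightarrow> \<not> agree l i (i + n - l)"
  by (simp add: semi_def)

lemma agree_trans: "agree n i j \<Longrightarrow> agree n j k \<Longrightarrow> agree n i k"
  by (simp add: agree_def)

lemma border_transfer:
  assumes "agree n i j" "l < n" "agree l i (i + n - l)"
  shows "agree l j (j + n - l)"
proof -
  have "agree l i j" using agree_mono[OF assms(1), of 0 l] assms(2) by simp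
  moreover have "agree l (i + (n - l)) (j + (n - l))"
    using agree_mono[OF assms(1), of "n - l" l] assms(2) by simp
  ultimately show ?thesis using assms(2,3)
    by (metis Nat.add_diff_assoc agree_sym agree_trans less_imp_le)
qed

lemma determined_unb: "determined n (unb n)"
  unfolding determined_def unb_def using border_transfer agree_sym by blast

lemma determined_semi: "n \<ge> 1 \<Longrightarrow> determined n (semi n)"
  unfolding determined_def
proof (intro allI impI)
  fix i j assume n: "n \<ge> 1" and a: "agree n i j" and i: "i \<in> semi n"
  have "tm_odd i = tm_odd j" "tm_odd (i + n - 1) = tm_odd (j + n - 1)"
    using agreeD[OF a, of 0] agreeD[OF a, of "n - 1"] n by auto
  with i show "j \<in> semi n"
    unfolding semi_def using border_transfer[OF agree_sym[OF a]] by blast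
qed

lemma determined_lsq: "n \<ge> 2 \<Longrightarrow> determined n lsq"
  unfolding determined_def lsq_def by (auto dest: agreeD[of n _ _ 0] agreeD[of n _ _ 1])

lemma determined_rsq: "n \<ge> 2 \<Longrightarrow> determined n (rsq n)"
  unfolding determined_def
proof (intro allI impI)
  fix i j assume n: "n \<ge> 2" and a: "agree n i j" and i: "i \<in> rsq n"
  have "tm_odd (i + n - 2) = tm_odd (j + n - 2)" "tm_odd (i + n - 1) = tm_odd (j + n - 1)"
    using agreeD[OF a, of "n - 2"] agreeD[OF a, of "n - 1"] n by auto
  with i show "j \<in> rsq n" by (simp add: rsq_def)
qed

lemma determined_Int: "determined n A \<Longrightarrow> determined n B \<Longrightarrow> determined n (A \<inter> B)"
  unfolding determined_def by blast

lemma determined_Compl: "determined n A \<Longrightarrow> determined n (- A)"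
  unfolding determined_def using agree_sym by blast

text \<open>By \<open>agree_mixed\<close>, a border whose two occurrences start at positions of different parity has
  length at most 3, and a border of length 3 is then of the form \<open>xyx\<close> with \<open>x \<noteq> y\<close>.\<close>

lemma tm_odd_double_add [simp]: "tm_odd (2 * i + 2 * j) = tm_odd (i + j)"
  "tm_odd (Suc (2 * i + 2 * j)) = (\<not> tm_odd (i + j))"
  by (metis distrib_left tm_odd_double, metis distrib_left tm_odd_double_Suc)

text \<open>The word consists of whole blocks. If its first and last letters differ, then its first
  and last blocks coincide and form a border of length 2.\<close>

lemma unb_even_even:
  assumes m: "m \<ge> 2"
  shows "2 * i \<notin> unb (2 * m)"
proof
  assume u: "2 * i \<in> unb (2 * m)"
  have "tm_odd (2 * i) \<noteq> tm_odd (2 * i + 2 * m - 1)"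
    using unbD[OF u, of 1] m by simp
  moreover have "2 * i + 2 * m - 1 = Suc (2 * (i + m - 1))" using m by auto
  ultimately have *: "tm_odd i = tm_odd (i + m - 1)" by simp
  have "2 * i + 2 * m - 2 = 2 * (i + m - 1)" using m by auto
  then have "agree 2 (2 * i) (2 * i + 2 * m - 2)" using * by (simp add: agree_even)
  then show False using unbD[OF u, of 2] m by auto
qed

text \<open>The word is the image of m + 1 letters without its two outer letters, so a border of l
  letters of the cover leaves one of length 2 * l - 2. For l = 1 nothing is left, which is why the
  cover may have a single-letter border; it even must, as the end letters of the word are not t(i)
  and t(i + m). An odd border has length 1 or 3, and as x or xyx it makes the end letters
  equal.\<close>

lemma unb_odd_even:
  assumes m: "m \<ge> 2"
  shows "Suc (2 * i) \<in> unb (2 * m) \<longleftrightarrow> i \<in> semi (m + 1)"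
proof
  assume u: "Suc (2 * i) \<in> unb (2 * m)"
  show "i \<in> semi (m + 1)"
    unfolding semi_def mem_Collect_eq
  proof (intro conjI allI impI notI)
    have "tm_odd (Suc (2 * i)) \<noteq> tm_odd (2 * (i + m))"
      using unbD[OF u, of 1] m by (simp add: distrib_left)
    then show "tm_odd i = tm_odd (i + (m + 1) - 1)" by simp
  next
    fix l assume l: "1 < l" "l < m + 1" and A: "agree l i (i + (m + 1) - l)"
    have "agree (2 * l - 2) (Suc (2 * i)) (Suc (2 * (i + (m + 1) - l)))"
    proof (subst agree_odd)
      have "(2 * l - 2) div 2 + 1 = l" using l by auto
      then show "agree ((2 * l - 2) div 2 + 1) i (i + (m + 1) - l)" using A by simp
    qed (use l in auto)
    moreover have "Suc (2 * (i + (m + 1) - l)) = Suc (2 * i) + 2 * m - (2 * l - 2)" using l by auto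
    ultimately show False using unbD[OF u, of "2 * l - 2"] l by auto
  qed
next
  assume v: "i \<in> semi (m + 1)"
  then have ne: "tm_odd (Suc (2 * i)) \<noteq> tm_odd (2 * (i + m))"
    by (simp add: semi_def)
  show "Suc (2 * i) \<in> unb (2 * m)"
    unfolding unb_def mem_Collect_eq
  proof (intro allI impI notI)
    fix l assume l: "0 < l" "l < 2 * m" and A: "agree l (Suc (2 * i)) (Suc (2 * i) + 2 * m - l)"
    show False
    proof (cases "even l")
      case True
      then obtain a where a: "l = 2 * a" by blast
      have "Suc (2 * i) + 2 * m - l = Suc (2 * (i + (m + 1) - (a + 1)))" using a l by auto
      then have "agree (a + 1) i (i + (m + 1) - (a + 1))"
        using A a l by (simp add: agree_odd)
      then show False using semiD[OF v, of "a + 1"] a l by auto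
    next
      case False
      then obtain a where a: "l = 2 * a + 1" using oddE by blast
      have e: "Suc (2 * i) + 2 * m - l = 2 * (i + m - a)" using a l by auto
      have x: "agree l (2 * (i + m - a)) (Suc (2 * i))" using A e agree_sym by simp
      then have "l = 1 \<or> l = 3" using agree_mixed(1)[OF x] a l by auto
      moreover have "tm_odd (Suc (2 * i)) = tm_odd (Suc (2 * i) + (l - 1))" if "l = 3"
        using agree_mixed(3)[OF x that] that by simp
      ultimately have "tm_odd (Suc (2 * i)) = tm_odd (Suc (2 * i) + (l - 1))" by auto
      also have "\<dots> = tm_odd (2 * (i + m - a) + (l - 1))"
        using agreeD[OF x, of "l - 1"] l by simp
      also have "2 * (i + m - a) + (l - 1) = 2 * (i + m)" using a l by auto
      finally show False using ne by simp
    qed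
  qed
qed

text \<open>Odd borders of length 2 * l - 1 correspond to borders of length l of the cover. An even
  border compares positions of different parity, so it has length 2. As t(i) and t(i + m) differ, it
  exists iff the cover ends in a repeated letter.\<close>

lemma unb_even_odd:
  assumes m: "m \<ge> 2"
  shows "2 * i \<in> unb (2 * m + 1) \<longleftrightarrow> i \<in> unb (m + 1) \<inter> - rsq (m + 1)"
proof
  assume u: "2 * i \<in> unb (2 * m + 1)"
  have 1: "i \<in> unb (m + 1)"
    unfolding unb_def mem_Collect_eq
  proof (intro allI impI notI)
    fix l assume l: "0 < l" "l < m + 1" and A: "agree l i (i + (m + 1) - l)"
    have "agree (2 * l - 1) (2 * i) (2 * (i + (m + 1) - l))"
    proof (subst agree_even)
      have "(2 * l - 1 + 1) div 2 = l" using l by auto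
      then show "agree ((2 * l - 1 + 1) div 2) i (i + (m + 1) - l)" using A by simp
    qed
    moreover have "2 * (i + (m + 1) - l) = 2 * i + (2 * m + 1) - (2 * l - 1)" using l by auto
    ultimately show False using unbD[OF u, of "2 * l - 1"] l by auto
  qed
  have "tm_odd i \<noteq> tm_odd (i + m)" using unbD[OF 1, of 1] m by simp
  moreover have "\<not> agree 2 (2 * i) (Suc (2 * (i + m - 1)))"
  proof -
    have "2 * i + (2 * m + 1) - 2 = Suc (2 * (i + m - 1))" using m by auto
    then show ?thesis using unbD[OF u, of 2] m by simp
  qed
  moreover have "Suc (Suc (2 * (i + m - 1))) = 2 * (i + m)" using m by auto
  ultimately have "tm_odd (i + m - 1) \<noteq> tm_odd (i + m)"
    by (auto simp: agree_def less_2_cases_iff)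
  with 1 show "i \<in> unb (m + 1) \<inter> - rsq (m + 1)" by (simp add: rsq_def)
next
  assume v: "i \<in> unb (m + 1) \<inter> - rsq (m + 1)"
  then have ne: "tm_odd i \<noteq> tm_odd (i + m)" using unbD[of i "m + 1" 1] m by simp
  have r: "tm_odd (i + m - 1) \<noteq> tm_odd (i + m)" using v by (simp add: rsq_def)
  show "2 * i \<in> unb (2 * m + 1)"
    unfolding unb_def mem_Collect_eq
  proof (intro allI impI notI)
    fix l assume l: "0 < l" "l < 2 * m + 1" and A: "agree l (2 * i) (2 * i + (2 * m + 1) - l)"
    show False
    proof (cases "even l")
      case False
      then obtain a where a: "l = 2 * a + 1" using oddE by blast
      have "2 * i + (2 * m + 1) - l = 2 * (i + (m + 1) - (a + 1))" using a l by auto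
      then have "agree (a + 1) i (i + (m + 1) - (a + 1))"
        using A a l by (simp add: agree_even)
      then show False using unbD[of i "m + 1" "a + 1"] v a l by auto
    next
      case True
      then obtain a where a: "l = 2 * a" by blast
      have e: "2 * i + (2 * m + 1) - l = Suc (2 * (i + m - a))" using a l by auto
      have x: "agree l (2 * i) (Suc (2 * (i + m - a)))" using A e by simp
      then have "l = 2" using agree_mixed(1)[OF x] a l by auto
      then have "tm_odd (2 * i) = tm_odd (Suc (2 * (i + m - 1)))"
        using agreeD[OF x, of 0] a by simp
      then show False using ne r by auto
    qed
  qed
qed

text \<open>The mirror image of \<open>unb_even_odd\<close>: the truncated block is now the first
  one, so a border of length 2 exists iff the cover begins with a repeated letter.\<close>

lemma unb_odd_odd:
  assumes m: "m \<ge> 2"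
  shows "Suc (2 * i) \<in> unb (2 * m + 1) \<longleftrightarrow> i \<in> unb (m + 1) \<inter> - lsq"
proof
  assume u: "Suc (2 * i) \<in> unb (2 * m + 1)"
  have 1: "i \<in> unb (m + 1)"
    unfolding unb_def mem_Collect_eq
  proof (intro allI impI notI)
    fix l assume l: "0 < l" "l < m + 1" and A: "agree l i (i + (m + 1) - l)"
    have "agree (2 * l - 1) (Suc (2 * i)) (Suc (2 * (i + (m + 1) - l)))"
    proof (subst agree_odd)
      have "(2 * l - 1) div 2 + 1 = l" using l by auto
      then show "agree ((2 * l - 1) div 2 + 1) i (i + (m + 1) - l)" using A by simp
    qed (use l in auto)
    moreover have "Suc (2 * (i + (m + 1) - l)) = Suc (2 * i) + (2 * m + 1) - (2 * l - 1)" using l by auto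
    ultimately show False using unbD[OF u, of "2 * l - 1"] l by auto
  qed
  have "tm_odd i \<noteq> tm_odd (i + m)" using unbD[OF 1, of 1] m by simp
  moreover have "\<not> agree 2 (Suc (2 * i)) (2 * (i + m))"
  proof -
    have "Suc (2 * i) + (2 * m + 1) - 2 = 2 * (i + m)" using m by auto
    then show ?thesis using unbD[OF u, of 2] m by simp
  qed
  moreover have "Suc (Suc (2 * i)) = 2 * Suc i" by auto
  ultimately have "tm_odd i \<noteq> tm_odd (Suc i)"
    by (auto simp: agree_def less_2_cases_iff simp del: mult_Suc_right)
  with 1 show "i \<in> unb (m + 1) \<inter> - lsq" by (simp add: lsq_def)
next
  assume v: "i \<in> unb (m + 1) \<inter> - lsq"
  then have ne: "tm_odd i \<noteq> tm_odd (i + m)" using unbD[of i "m + 1" 1] m by simp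
  have r: "tm_odd i \<noteq> tm_odd (Suc i)" using v by (simp add: lsq_def)
  show "Suc (2 * i) \<in> unb (2 * m + 1)"
    unfolding unb_def mem_Collect_eq
  proof (intro allI impI notI)
    fix l assume l: "0 < l" "l < 2 * m + 1"
      and A: "agree l (Suc (2 * i)) (Suc (2 * i) + (2 * m + 1) - l)"
    show False
    proof (cases "even l")
      case False
      then obtain a where a: "l = 2 * a + 1" using oddE by blast
      have "Suc (2 * i) + (2 * m + 1) - l = Suc (2 * (i + (m + 1) - (a + 1)))" using a l by auto
      then have "agree (a + 1) i (i + (m + 1) - (a + 1))"
        using A a l by (simp add: agree_odd)
      then show False using unbD[of i "m + 1" "a + 1"] v a l by auto
    next
      case True
      then obtain a where a: "l = 2 * a" by blast
      have e: "Suc (2 * i) + (2 * m + 1) - l = 2 * (i + m + 1 - a)" using a l by auto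
      have x: "agree l (2 * (i + m + 1 - a)) (Suc (2 * i))" using A e agree_sym by simp
      then have l2: "l = 2" using agree_mixed(1)[OF x] a l by auto
      then have "tm_odd (Suc (2 * (i + m))) = tm_odd (2 * Suc i)"
        using agreeD[OF x, of 1] a by simp
      then have "tm_odd (i + m) \<noteq> tm_odd (Suc i)" unfolding tm_odd_double tm_odd_double_Suc by auto
      then show False using ne r by auto
    qed
  qed
qed

text \<open>The end letters t(i) and not t(i + m - 1) are equal iff those of the cover differ. Even
  borders are images of borders of the cover. The only odd border longer than 1 has length 3;
  comparing its letters shows that it exists iff the cover repeats a letter at both ends.\<close>

lemma semi_even_even:
  assumes m: "m \<ge> 2"
  shows "2 * i \<in> semi (2 * m) \<longleftrightarrow> i \<in> unb m \<inter> - (lsq \<inter> rsq m)"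
proof
  assume u: "2 * i \<in> semi (2 * m)"
  have "2 * i + 2 * m - 1 = Suc (2 * (i + m - 1))" using m by auto
  then have ne: "tm_odd i \<noteq> tm_odd (i + m - 1)" using u by (auto simp: semi_def)
  have 1: "i \<in> unb m"
    unfolding unb_def mem_Collect_eq
  proof (intro allI impI notI)
    fix l assume l: "0 < l" "l < m" and A: "agree l i (i + m - l)"
    then have "agree (2 * l) (2 * i) (2 * (i + m - l))" by (simp add: agree_even)
    moreover have "2 * (i + m - l) = 2 * i + 2 * m - (2 * l)" using l by auto
    ultimately show False using semiD[OF u, of "2 * l"] l by auto
  qed
  have "\<not> (tm_odd i = tm_odd (i + 1) \<and> tm_odd (i + m - 2) = tm_odd (i + m - 1))"
  proof
    assume *: "tm_odd i = tm_odd (i + 1) \<and> tm_odd (i + m - 2) = tm_odd (i + m - 1)"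
    have e: "2 * i + 2 * m - 3 = Suc (2 * (i + m - 2))" "Suc (Suc (2 * (i + m - 2))) = 2 * (i + m - 1)"
       "Suc (Suc (Suc (2 * (i + m - 2)))) = Suc (2 * (i + m - 1))"
       "Suc (Suc (2 * i)) = 2 * (i + 1)" using m by auto
    have "tm_odd (2 * i) = tm_odd (Suc (2 * (i + m - 2)))"
      "tm_odd (Suc (2 * i)) = tm_odd (Suc (Suc (2 * (i + m - 2))))"
      "tm_odd (Suc (Suc (2 * i))) = tm_odd (Suc (Suc (Suc (2 * (i + m - 2)))))"
      using * ne unfolding e tm_odd_double tm_odd_double_Suc by auto
    then have "agree 3 (2 * i) (Suc (2 * (i + m - 2)))"
      by (auto simp: agree_def numeral_eq_Suc less_Suc_eq)
    then show False using semiD[OF u, of 3] m e by auto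
  qed
  with 1 show "i \<in> unb m \<inter> - (lsq \<inter> rsq m)" by (auto simp: lsq_def rsq_def)
next
  assume v: "i \<in> unb m \<inter> - (lsq \<inter> rsq m)"
  then have ne: "tm_odd i \<noteq> tm_odd (i + m - 1)" using unbD[of i "m" 1] m by simp
  have r: "\<not> (tm_odd i = tm_odd (i + 1) \<and> tm_odd (i + m - 2) = tm_odd (i + m - 1))"
    using v by (auto simp: lsq_def rsq_def)
  have E: "2 * i + 2 * m - 1 = Suc (2 * (i + m - 1))" using m by auto
  show "2 * i \<in> semi (2 * m)"
    unfolding semi_def mem_Collect_eq
  proof (intro conjI allI impI notI)
    show "tm_odd (2 * i) = tm_odd (2 * i + 2 * m - 1)" unfolding E using ne by auto
  next
    fix l assume l: "1 < l" "l < 2 * m" and A: "agree l (2 * i) (2 * i + 2 * m - l)"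
    show False
    proof (cases "even l")
      case True
      then obtain a where a: "l = 2 * a" by blast
      have "2 * i + 2 * m - l = 2 * (i + m - a)" using a l by auto
      then have "agree a i (i + m - a)" using A a l by (simp add: agree_even)
      then show False using unbD[of i m a] v a l by auto
    next
      case False
      then obtain a where a: "l = 2 * a + 1" using oddE by blast
      have e: "2 * i + 2 * m - l = Suc (2 * (i + m - 1 - a))" using a l by auto
      have x: "agree l (2 * i) (Suc (2 * (i + m - 1 - a)))" using A e by simp
      then have l3: "l = 3" "a = 1" using agree_mixed(1)[OF x] a l by auto
      have "tm_odd (2 * i) = tm_odd (2 * i + 2)" using agree_mixed(2)[OF x] l3 by simp
      moreover have "2 * i + 2 = 2 * (i + 1)" by simp
      ultimately have "tm_odd i = tm_odd (i + 1)" by (metis tm_odd_double)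
      moreover have "i + m - 1 - a = i + m - 2" using l3 by simp
      then have "tm_odd (2 * i) = tm_odd (Suc (2 * (i + m - 2)))"
        using agreeD[OF x, of 0] l3 by simp
      then have "tm_odd (i + m - 2) = tm_odd (i + m - 1)" using ne by auto
      ultimately show False using r by blast
    qed
  qed
qed

text \<open>The end letters are not t(i) and t(i + m), so their equality says that the cover has no
  border of length 1. The border of length 3 is treated as in \<open>semi_even_even\<close>.\<close>

lemma semi_odd_even:
  assumes m: "m \<ge> 2"
  shows "Suc (2 * i) \<in> semi (2 * m) \<longleftrightarrow> i \<in> unb (m + 1) \<inter> - (lsq \<inter> rsq (m + 1))"
proof
  assume u: "Suc (2 * i) \<in> semi (2 * m)"
  have ne: "tm_odd i \<noteq> tm_odd (i + m)" using u by (auto simp: semi_def)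
  have 1: "i \<in> unb (m + 1)"
    unfolding unb_def mem_Collect_eq
  proof (intro allI impI notI)
    fix l assume l: "0 < l" "l < m + 1" and A: "agree l i (i + (m + 1) - l)"
    show False
    proof (cases "l = 1")
      case True
      then show False using A ne by simp
    next
      case False
      have "agree (2 * l - 2) (Suc (2 * i)) (Suc (2 * (i + (m + 1) - l)))"
      proof (subst agree_odd)
        have "(2 * l - 2) div 2 + 1 = l" using l by auto
        then show "agree ((2 * l - 2) div 2 + 1) i (i + (m + 1) - l)" using A by simp
      qed (use l False in auto)
      moreover have "Suc (2 * (i + (m + 1) - l)) = Suc (2 * i) + 2 * m - (2 * l - 2)" using l by auto
      ultimately show False using semiD[OF u, of "2 * l - 2"] l False by auto
    qed
  qed
  have "\<not> (tm_odd i = tm_odd (i + 1) \<and> tm_odd (i + m - 1) = tm_odd (i + m))"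
  proof
    assume *: "tm_odd i = tm_odd (i + 1) \<and> tm_odd (i + m - 1) = tm_odd (i + m)"
    have e: "Suc (2 * i) + 2 * m - 3 = 2 * (i + m - 1)" "Suc (Suc (2 * (i + m - 1))) = 2 * (i + m)"
       "Suc (Suc (2 * i)) = 2 * (i + 1)" "Suc (Suc (Suc (2 * i))) = Suc (2 * (i + 1))" using m by auto
    have "tm_odd (Suc (2 * i)) = tm_odd (2 * (i + m - 1))"
      "tm_odd (Suc (Suc (2 * i))) = tm_odd (Suc (2 * (i + m - 1)))"
      "tm_odd (Suc (Suc (Suc (2 * i)))) = tm_odd (Suc (Suc (2 * (i + m - 1))))"
      using * ne unfolding e tm_odd_double tm_odd_double_Suc by auto
    then have "agree 3 (Suc (2 * i)) (2 * (i + m - 1))"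
      by (auto simp: agree_def numeral_eq_Suc less_Suc_eq)
    then show False using semiD[OF u, of 3] m e by auto
  qed
  with 1 show "i \<in> unb (m + 1) \<inter> - (lsq \<inter> rsq (m + 1))" by (auto simp: lsq_def rsq_def)
next
  assume v: "i \<in> unb (m + 1) \<inter> - (lsq \<inter> rsq (m + 1))"
  then have ne: "tm_odd i \<noteq> tm_odd (i + m)" using unbD[of i "m + 1" 1] m by simp
  have r: "\<not> (tm_odd i = tm_odd (i + 1) \<and> tm_odd (i + m - 1) = tm_odd (i + m))"
    using v by (auto simp: lsq_def rsq_def)
  show "Suc (2 * i) \<in> semi (2 * m)"
    unfolding semi_def mem_Collect_eq
  proof (intro conjI allI impI notI)
    show "tm_odd (Suc (2 * i)) = tm_odd (Suc (2 * i) + 2 * m - 1)" using ne by auto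
  next
    fix l assume l: "1 < l" "l < 2 * m" and A: "agree l (Suc (2 * i)) (Suc (2 * i) + 2 * m - l)"
    show False
    proof (cases "even l")
      case True
      then obtain a where a: "l = 2 * a" by blast
      have "Suc (2 * i) + 2 * m - l = Suc (2 * (i + (m + 1) - (a + 1)))" using a l by auto
      then have "agree (a + 1) i (i + (m + 1) - (a + 1))"
        using A a l by (simp add: agree_odd)
      then show False using unbD[of i "m + 1" "a + 1"] v a l by auto
    next
      case False
      then obtain a where a: "l = 2 * a + 1" using oddE by blast
      have e: "Suc (2 * i) + 2 * m - l = 2 * (i + m - a)" using a l by auto
      have x: "agree l (2 * (i + m - a)) (Suc (2 * i))" using A e agree_sym by simp
      then have l3: "l = 3" "a = 1" using agree_mixed(1)[OF x] a l by auto
      have "tm_odd (Suc (2 * i)) = tm_odd (Suc (2 * i) + 2)" using agree_mixed(3)[OF x] l3 by simp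
      moreover have "Suc (2 * i) + 2 = Suc (2 * (i + 1))" by simp
      ultimately have "tm_odd i = tm_odd (i + 1)" by (metis tm_odd_double_Suc)
      moreover have "tm_odd (Suc (2 * i)) = tm_odd (2 * (i + m - 1))"
        using agreeD[OF x, of 0] l3 by simp
      then have "tm_odd (i + m - 1) = tm_odd (i + m)" using ne by auto
      ultimately show False using r by blast
    qed
  qed
qed

text \<open>A border across parities would have length 2 and be a block at the even position, hence
  consist of different letters. But it begins with the first and ends with the last letter of the
  word, which are equal. So no condition on repeated letters appears, here and in
  \<open>semi_odd_odd\<close>.\<close>

lemma semi_even_odd:
  assumes m: "m \<ge> 2"
  shows "2 * i \<in> semi (2 * m + 1) \<longleftrightarrow> i \<in> semi (m + 1)"
proof
  assume u: "2 * i \<in> semi (2 * m + 1)"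
  show "i \<in> semi (m + 1)"
    unfolding semi_def mem_Collect_eq
  proof (intro conjI allI impI notI)
    show "tm_odd i = tm_odd (i + (m + 1) - 1)" using u by (auto simp: semi_def)
  next
    fix l assume l: "1 < l" "l < m + 1" and A: "agree l i (i + (m + 1) - l)"
    have "agree (2 * l - 1) (2 * i) (2 * (i + (m + 1) - l))"
    proof (subst agree_even)
      have "(2 * l - 1 + 1) div 2 = l" using l by auto
      then show "agree ((2 * l - 1 + 1) div 2) i (i + (m + 1) - l)" using A by simp
    qed
    moreover have "2 * (i + (m + 1) - l) = 2 * i + (2 * m + 1) - (2 * l - 1)" using l by auto
    ultimately show False using semiD[OF u, of "2 * l - 1"] l by auto
  qed
next
  assume v: "i \<in> semi (m + 1)"
  then have eq: "tm_odd i = tm_odd (i + m)" by (simp add: semi_def)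
  show "2 * i \<in> semi (2 * m + 1)"
    unfolding semi_def mem_Collect_eq
  proof (intro conjI allI impI notI)
    show "tm_odd (2 * i) = tm_odd (2 * i + (2 * m + 1) - 1)" using eq by simp
  next
    fix l assume l: "1 < l" "l < 2 * m + 1" and A: "agree l (2 * i) (2 * i + (2 * m + 1) - l)"
    show False
    proof (cases "even l")
      case False
      then obtain a where a: "l = 2 * a + 1" using oddE by blast
      have "2 * i + (2 * m + 1) - l = 2 * (i + (m + 1) - (a + 1))" using a l by auto
      then have "agree (a + 1) i (i + (m + 1) - (a + 1))"
        using A a l by (simp add: agree_even)
      then show False using semiD[OF v, of "a + 1"] a l by auto
    next
      case True
      then obtain a where a: "l = 2 * a" by blast
      have e: "2 * i + (2 * m + 1) - l = Suc (2 * (i + m - a))" using a l by auto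
      have x: "agree l (2 * i) (Suc (2 * (i + m - a)))" using A e by simp
      then have l2: "l = 2" using agree_mixed(1)[OF x] a l by auto
      then have "tm_odd (Suc (2 * i)) = tm_odd (Suc (Suc (2 * (i + m - 1))))"
        using agreeD[OF x, of 1] a by simp
      also have "Suc (Suc (2 * (i + m - 1))) = 2 * (i + m)" using m by auto
      finally show False using eq by auto
    qed
  qed
qed

lemma semi_odd_odd:
  assumes m: "m \<ge> 2"
  shows "Suc (2 * i) \<in> semi (2 * m + 1) \<longleftrightarrow> i \<in> semi (m + 1)"
proof
  assume u: "Suc (2 * i) \<in> semi (2 * m + 1)"
  show "i \<in> semi (m + 1)"
    unfolding semi_def mem_Collect_eq
  proof (intro conjI allI impI notI)
    show "tm_odd i = tm_odd (i + (m + 1) - 1)" using u by (auto simp: semi_def)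
  next
    fix l assume l: "1 < l" "l < m + 1" and A: "agree l i (i + (m + 1) - l)"
    have "agree (2 * l - 1) (Suc (2 * i)) (Suc (2 * (i + (m + 1) - l)))"
    proof (subst agree_odd)
      have "(2 * l - 1) div 2 + 1 = l" using l by auto
      then show "agree ((2 * l - 1) div 2 + 1) i (i + (m + 1) - l)" using A by simp
    qed (use l in auto)
    moreover have "Suc (2 * (i + (m + 1) - l)) = Suc (2 * i) + (2 * m + 1) - (2 * l - 1)" using l by auto
    ultimately show False using semiD[OF u, of "2 * l - 1"] l by auto
  qed
next
  assume v: "i \<in> semi (m + 1)"
  then have eq: "tm_odd i = tm_odd (i + m)" by (simp add: semi_def)
  show "Suc (2 * i) \<in> semi (2 * m + 1)"
    unfolding semi_def mem_Collect_eq
  proof (intro conjI allI impI notI)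
    show "tm_odd (Suc (2 * i)) = tm_odd (Suc (2 * i) + (2 * m + 1) - 1)" using eq by simp
  next
    fix l assume l: "1 < l" "l < 2 * m + 1"
      and A: "agree l (Suc (2 * i)) (Suc (2 * i) + (2 * m + 1) - l)"
    show False
    proof (cases "even l")
      case False
      then obtain a where a: "l = 2 * a + 1" using oddE by blast
      have "Suc (2 * i) + (2 * m + 1) - l = Suc (2 * (i + (m + 1) - (a + 1)))" using a l by auto
      then have "agree (a + 1) i (i + (m + 1) - (a + 1))"
        using A a l by (simp add: agree_odd)
      then show False using semiD[OF v, of "a + 1"] a l by auto
    next
      case True
      then obtain a where a: "l = 2 * a" by blast
      have e: "Suc (2 * i) + (2 * m + 1) - l = 2 * (i + m + 1 - a)" using a l by auto
      have x: "agree l (2 * (i + m + 1 - a)) (Suc (2 * i))" using A e agree_sym by simp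
      then have l2: "l = 2" using agree_mixed(1)[OF x] a l by auto
      then have "tm_odd (2 * (i + m)) = tm_odd (Suc (2 * i))"
        using agreeD[OF x, of 0] a by simp
      then show False using eq by auto
    qed
  qed
qed

lemma lsq_double [simp]: "2 * i \<notin> lsq" "Suc (2 * i) \<in> lsq \<longleftrightarrow> i \<notin> lsq"
proof -
  have "Suc (2 * i) + 1 = 2 * (i + 1)" by simp
  then have "tm_odd (Suc (2 * i) + 1) = tm_odd (i + 1)" by (metis tm_odd_double)
  then show "Suc (2 * i) \<in> lsq \<longleftrightarrow> i \<notin> lsq" by (auto simp: lsq_def)
  show "2 * i \<notin> lsq" by (simp add: lsq_def)
qed

lemma rsq_double:
  assumes "m \<ge> 2"
  shows "2 * i \<notin> rsq (2 * m)" "Suc (2 * i) \<in> rsq (2 * m) \<longleftrightarrow> i \<notin> rsq (m + 1)"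
    "2 * i \<in> rsq (2 * m + 1) \<longleftrightarrow> i \<notin> rsq (m + 1)" "Suc (2 * i) \<notin> rsq (2 * m + 1)"
proof -
  have e: "2 * i + 2 * m - 2 = 2 * (i + m - 1)" "2 * i + 2 * m - 1 = Suc (2 * (i + m - 1))"
    "Suc (2 * i) + 2 * m - 2 = Suc (2 * (i + m - 1))" "Suc (2 * i) + 2 * m - 1 = 2 * (i + m)"
    "2 * i + (2 * m + 1) - 2 = Suc (2 * (i + m - 1))" "2 * i + (2 * m + 1) - 1 = 2 * (i + m)"
    "Suc (2 * i) + (2 * m + 1) - 2 = 2 * (i + m)" "Suc (2 * i) + (2 * m + 1) - 1 = Suc (2 * (i + m))"
    "i + (m + 1) - 2 = i + m - 1" "i + (m + 1) - 1 = i + m"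
    using assms by auto
  show "2 * i \<notin> rsq (2 * m)" "Suc (2 * i) \<in> rsq (2 * m) \<longleftrightarrow> i \<notin> rsq (m + 1)"
    "2 * i \<in> rsq (2 * m + 1) \<longleftrightarrow> i \<notin> rsq (m + 1)" "Suc (2 * i) \<notin> rsq (2 * m + 1)"
    unfolding rsq_def mem_Collect_eq e tm_odd_double tm_odd_double_Suc by auto
qed

text \<open>If neither end repeats a letter, a word with different end letters x and y begins and
  ends with xy.\<close>

lemma unb_lsq_or_rsq:
  assumes "n \<ge> 3" "i \<in> unb n"
  shows "i \<in> lsq \<or> i \<in> rsq n"
proof (rule ccontr)
  assume *: "\<not> (i \<in> lsq \<or> i \<in> rsq n)"
  have "tm_odd i \<noteq> tm_odd (i + n - 1)" using unbD[OF assms(2), of 1] assms by simp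
  moreover have "Suc (i + n - 2) = i + n - 1" using assms by auto
  ultimately have "agree 2 i (i + n - 2)"
    using * by (auto simp: agree_def less_2_cases_iff lsq_def rsq_def)
  then show False using unbD[OF assms(2), of 2] assms by auto
qed

text \<open>Otherwise the word, whose end letters are both x, would begin and end with xx.\<close>

lemma semi_not_lsq_rsq:
  assumes "n \<ge> 3" "i \<in> semi n"
  shows "\<not> (i \<in> lsq \<and> i \<in> rsq n)"
proof
  assume *: "i \<in> lsq \<and> i \<in> rsq n"
  have "tm_odd i = tm_odd (i + n - 1)" using assms by (simp add: semi_def)
  moreover have "Suc (i + n - 2) = i + n - 1" using assms by auto
  ultimately have "agree 2 i (i + n - 2)"
    using * by (auto simp: agree_def less_2_cases_iff lsq_def rsq_def)
  then show False using semiD[OF assms(2), of 2] assms by auto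
qed

lemma bordered_fac_iff: "bordered (fac n i) \<longleftrightarrow> i \<notin> unb n"
proof
  assume "bordered (fac n i)"
  then obtain v where v: "v \<noteq> []" "v \<noteq> fac n i" "prefix v (fac n i)" "suffix v (fac n i)"
    by (auto simp: bordered_def)
  let ?l = "length v"
  have len: "length (fac n i) = n" by (simp add: fac_def)
  have l: "0 < ?l" "?l < n"
    using v len by (auto simp: prefix_def suffix_def)
  have "v = take ?l (fac n i)"
    using v(3) by (metis append_eq_conv_conj prefix_def)
  moreover have "take ?l (fac n i) = fac ?l i" using l by (simp add: fac_def take_map)
  moreover have "v = drop (n - ?l) (fac n i)"
  proof -
    obtain zs where "fac n i = zs @ v" using v(4) by (auto simp: suffix_def)
    moreover from this have "length zs = n - ?l" using len by (metis add_diff_cancel_right' length_append)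
    ultimately show ?thesis by simp
  qed
  moreover have "drop (n - ?l) (fac n i) = fac ?l (i + n - ?l)" using l by (simp add: fac_def drop_map)
  ultimately have "agree ?l i (i + n - ?l)" using fac_eq_iff by metis
  then show "i \<notin> unb n" using unbD l by blast
next
  assume "i \<notin> unb n"
  then obtain l where l: "0 < l" "l < n" "agree l i (i + n - l)" by (auto simp: unb_def)
  have "fac l i = take l (fac n i)" using l by (simp add: fac_def take_map)
  then have "prefix (fac l i) (fac n i)" by (metis take_is_prefix)
  moreover have "fac l (i + n - l) = drop (n - l) (fac n i)" using l by (simp add: fac_def drop_map)
  then have "suffix (fac l (i + n - l)) (fac n i)" by (metis suffix_drop)
  moreover have "fac l i = fac l (i + n - l)" using l by (simp add: fac_eq_iff)
  moreover have "fac l i \<noteq> []" "fac l i \<noteq> fac n i" using l by (auto simp: fac_def dest: arg_cong[of _ _ length])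
  ultimately show "bordered (fac n i)" unfolding bordered_def by metis
qed

section \<open>Halving relations between the counts\<close>

lemma f_eq_cnt:
  assumes "n \<ge> 1"
  shows "f n = cnt n (unb n)"
proof -
  have *: "tm_factor w \<and> length w = n \<longleftrightarrow> (\<exists>i. w = fac n i)" for w
  proof
    assume "tm_factor w \<and> length w = n"
    then obtain i j where ij: "i \<le> j" "w = map thue_morse [i..<Suc j]" "length w = n"
      using assms unfolding tm_factor_def by (metis Suc_eq_plus1 list.size(3) not_one_le_zero)
    then have "i + n = Suc j" by auto
    then have "w = fac n i" using ij by (simp only: fac_def)
    then show "\<exists>i. w = fac n i" ..
  next
    assume "\<exists>i. w = fac n i"
    then obtain i where i: "w = fac n i" ..
    then have "w = map thue_morse [i..<Suc (i + n - 1)]" "i \<le> i + n - 1" using assms by (auto simp: fac_def)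
    then have "tm_factor w" unfolding tm_factor_def by blast
    then show "tm_factor w \<and> length w = n" using i by (simp add: fac_def)
  qed
  have "{w. tm_factor w \<and> length w = n \<and> \<not> bordered w} = fac n ` unb n"
  proof (rule Set.set_eqI)
    fix w
    show "w \<in> {w. tm_factor w \<and> length w = n \<and> \<not> bordered w} \<longleftrightarrow> w \<in> fac n ` unb n"
      unfolding mem_Collect_eq image_iff using *[of w] bordered_fac_iff[of n] by metis
  qed
  then show ?thesis by (simp add: f_def cnt_def)
qed

text \<open>Together with \<open>f\<close>, these three counts form a system that is closed under
  halving the length. Repeated letters at the ends have to be tracked because they decide about the
  borders of length 2 and 3 that compare positions of different parity.\<close>

definition nunb_sq :: "nat \<Rightarrow> nat" where
  "nunb_sq n = cnt n (unb n \<inter> (lsq \<inter> rsq n))"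

definition nsemi :: "nat \<Rightarrow> nat" where
  "nsemi n = cnt n (semi n)"

definition nsemi_nsq :: "nat \<Rightarrow> nat" where
  "nsemi_nsq n = cnt n (semi n \<inter> (- lsq \<inter> - rsq n))"

lemmas determined_intros = determined_unb determined_semi determined_lsq determined_rsq
  determined_Int determined_Compl

lemma cnt_empty [simp]: "cnt n {} = 0"
  by (simp add: cnt_def)

lemma cnt_cond:
  assumes "determined n A" "determined n B"
  shows "cnt n A = cnt n (A \<inter> B) + cnt n (A \<inter> - B)"
  using cnt_Un[OF determined_Int[OF assms], of "A \<inter> - B"]
  by (metis Diff_disjoint Diff_eq Int_Diff_Un Int_assoc inf_commute inf_left_commute inf_compl_bot_right)

lemma f_double:
  assumes "m \<ge> 2"
  shows "f (2 * m) = nsemi (m + 1)"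
proof -
  have "f (2 * m) = cnt (2 * m) (unb (2 * m))" using assms by (intro f_eq_cnt) simp
  also have "\<dots> = nsemi (m + 1)"
    using assms by (subst cnt_split) (auto simp: unb_even_even unb_odd_even nsemi_def)
  finally show ?thesis .
qed

lemma nunb_sq_double:
  assumes "m \<ge> 2"
  shows "nunb_sq (2 * m) = nsemi_nsq (m + 1)"
proof -
  have "{i. Suc (2 * i) \<in> unb (2 * m) \<inter> (lsq \<inter> rsq (2 * m))} = semi (m + 1) \<inter> (- lsq \<inter> - rsq (m + 1))"
    using assms by (auto simp: unb_odd_even rsq_double simp del: One_nat_def add_Suc_right)
  then show ?thesis
    unfolding nunb_sq_def using assms by (subst cnt_split) (auto simp: nsemi_nsq_def)
qed

text \<open>A word of odd length has a whole block at one of its ends, and there no letter is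
  repeated.\<close>

lemma nunb_sq_double_Suc:
  assumes "m \<ge> 2"
  shows "nunb_sq (2 * m + 1) = 0"
  unfolding nunb_sq_def using assms
  by (subst cnt_split) (auto simp: rsq_double simp del: One_nat_def add_Suc_right)

lemma nunb_sq_compl:
  assumes "n \<ge> 3"
  shows "f n = nunb_sq n + cnt n (unb n \<inter> - (lsq \<inter> rsq n))"
proof -
  have "f n = cnt n (unb n)" using assms by (intro f_eq_cnt) simp
  also have "\<dots> = nunb_sq n + cnt n (unb n \<inter> - (lsq \<inter> rsq n))"
    unfolding nunb_sq_def using assms
    by (intro cnt_cond determined_unb determined_Int determined_lsq determined_rsq) simp_all
  finally show ?thesis .
qed

text \<open>Even positions contribute the unbordered covers that do not end in a repeated letter,
  odd positions those that do not begin with one. By \<open>unb_lsq_or_rsq\<close> the two classes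
  are disjoint, and together they miss exactly the words counted by \<open>nunb_sq\<close>.\<close>

lemma f_double_Suc:
  assumes "m \<ge> 2"
  shows "f (2 * m + 1) + nunb_sq (m + 1) = f (m + 1)"
proof -
  let ?U = "unb (m + 1)" and ?R = "rsq (m + 1)"
  have 1: "(2 * m + 1 + 1) div 2 = m + 1" "(2 * m + 1) div 2 + 1 = m + 1" by auto
  have "f (2 * m + 1) = cnt (2 * m + 1) (unb (2 * m + 1))" using assms by (intro f_eq_cnt) simp
  also have "\<dots> = cnt (m + 1) (?U \<inter> - ?R) + cnt (m + 1) (?U \<inter> - lsq)"
    using assms unfolding cnt_split[of "2 * m + 1", simplified 1]
    by (subst cnt_split) (simp_all only: 1 unb_even_odd unb_odd_odd Collect_mem_eq)
  also have "\<dots> = cnt (m + 1) ((?U \<inter> - ?R) \<union> (?U \<inter> - lsq))"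
    using assms unb_lsq_or_rsq[of "m + 1"]
    by (subst cnt_Un) (auto intro!: determined_intros)
  also have "(?U \<inter> - ?R) \<union> (?U \<inter> - lsq) = ?U \<inter> - (lsq \<inter> ?R)" by auto
  finally show ?thesis using nunb_sq_compl[of "m + 1"] assms by simp
qed

lemma nsemi_double:
  assumes "m \<ge> 3"
  shows "nsemi (2 * m) = f (2 * m - 1) + f (2 * m + 1)"
proof -
  have 1: "(2 * m + 1) div 2 = m" "2 * m div 2 + 1 = m + 1" by auto
  have "nsemi (2 * m) = cnt m (unb m \<inter> - (lsq \<inter> rsq m)) + cnt (m + 1) (unb (m + 1) \<inter> - (lsq \<inter> rsq (m + 1)))"
    unfolding nsemi_def using assms
    by (subst cnt_split) (simp_all only: 1 semi_even_even semi_odd_even Collect_mem_eq)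
  moreover have "2 * m - 1 = 2 * (m - 1) + 1" "m - 1 + 1 = m" using assms by auto
  ultimately show ?thesis
    using f_double_Suc[of m] f_double_Suc[of "m - 1"] nunb_sq_compl[of m] nunb_sq_compl[of "m + 1"] assms
    by simp
qed

text \<open>At an even position both ends are whole blocks, so every word of \<open>semi\<close>
  counts. At an odd position, no repetition at the ends means that the cover repeats at both ends,
  which \<open>semi_odd_even\<close> excludes.\<close>

lemma nsemi_nsq_double:
  assumes "m \<ge> 3"
  shows "nsemi_nsq (2 * m) = f (2 * m - 1)"
proof -
  have 1: "(2 * m + 1) div 2 = m" "2 * m div 2 + 1 = m + 1" by auto
  have 2: "{i. 2 * i \<in> semi (2 * m) \<inter> (- lsq \<inter> - rsq (2 * m))} = unb m \<inter> - (lsq \<inter> rsq m)"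
    using assms by (auto simp: semi_even_even rsq_double)
  have 3: "{i. Suc (2 * i) \<in> semi (2 * m) \<inter> (- lsq \<inter> - rsq (2 * m))} = {}"
    using assms by (auto simp: semi_odd_even rsq_double simp del: One_nat_def add_Suc_right)
  have "nsemi_nsq (2 * m) = cnt m (unb m \<inter> - (lsq \<inter> rsq m))"
    unfolding nsemi_nsq_def using assms by (subst cnt_split) (simp_all only: 1 2 3 cnt_empty)
  moreover have "2 * m - 1 = 2 * (m - 1) + 1" "m - 1 + 1 = m" using assms by auto
  ultimately show ?thesis
    using f_double_Suc[of "m - 1"] nunb_sq_compl[of m] assms by simp
qed

lemma nsemi_double_Suc:
  assumes "m \<ge> 2"
  shows "nsemi (2 * m + 1) = 2 * nsemi (m + 1)"
proof -
  have 1: "(2 * m + 1 + 1) div 2 = m + 1" "(2 * m + 1) div 2 + 1 = m + 1" by auto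
  have "nsemi (2 * m + 1) = nsemi (m + 1) + nsemi (m + 1)"
    unfolding nsemi_def using assms
    by (subst cnt_split) (simp_all only: 1 semi_even_odd semi_odd_odd Collect_mem_eq)
  then show ?thesis by simp
qed

lemma nsemi_nsq_double_Suc:
  assumes "m \<ge> 2"
  shows "nsemi_nsq (2 * m + 1) + nsemi_nsq (m + 1) = nsemi (m + 1)"
proof -
  let ?V = "semi (m + 1)" and ?R = "rsq (m + 1)"
  have 1: "(2 * m + 1 + 1) div 2 = m + 1" "(2 * m + 1) div 2 + 1 = m + 1" by auto
  have 2: "{i. 2 * i \<in> semi (2 * m + 1) \<inter> (- lsq \<inter> - rsq (2 * m + 1))} = ?V \<inter> ?R"
    using assms by (auto simp: semi_even_odd rsq_double simp del: One_nat_def add_Suc_right Suc_eq_plus1[symmetric])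
  have 3: "{i. Suc (2 * i) \<in> semi (2 * m + 1) \<inter> (- lsq \<inter> - rsq (2 * m + 1))} = ?V \<inter> lsq"
    using assms by (auto simp: semi_odd_odd rsq_double simp del: One_nat_def add_Suc_right Suc_eq_plus1[symmetric])
  have "nsemi_nsq (2 * m + 1) = cnt (m + 1) (?V \<inter> ?R) + cnt (m + 1) (?V \<inter> lsq)"
    unfolding nsemi_nsq_def using assms
    by (subst cnt_split) (simp_all only: 1 2 3)
  also have "\<dots> = cnt (m + 1) ((?V \<inter> ?R) \<union> (?V \<inter> lsq))"
    using assms semi_not_lsq_rsq[of "m + 1"]
    by (subst cnt_Un) (auto intro!: determined_intros)
  also have "(?V \<inter> ?R) \<union> (?V \<inter> lsq) = ?V \<inter> - (- lsq \<inter> - ?R)" by auto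
  finally show ?thesis
    unfolding nsemi_nsq_def nsemi_def using assms
    by (subst (3) cnt_cond[where B = "- lsq \<inter> - ?R"]) (auto intro!: determined_intros)
qed

text \<open>This identity eliminates the auxiliary counts: for either parity of n, the halving
  relations reduce both sides to the same expression.\<close>

lemma nsemi_nsq_eq:
  assumes "n \<ge> 5"
  shows "nsemi_nsq n = f (2 * n - 3)"
proof -
  have "2 * n - 3 = 2 * (n - 2) + 1" "n - 2 + 1 = n - 1" using assms by auto
  then have *: "f (2 * n - 3) + nunb_sq (n - 1) = f (n - 1)" using f_double_Suc[of "n - 2"] assms by simp
  show ?thesis
  proof (cases "even n")
    case True
    then obtain m where m: "n = 2 * m" by blast
    have "n - 1 = 2 * (m - 1) + 1" using m assms by auto
    then have "nunb_sq (n - 1) = 0" using nunb_sq_double_Suc[of "m - 1"] assms m by simp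
    then show ?thesis using * nsemi_nsq_double[of m] m assms by simp
  next
    case False
    then obtain m where m: "n = 2 * m + 1" using oddE by blast
    then show ?thesis
      using * nsemi_nsq_double_Suc[of m] assms f_double[of m] nunb_sq_double[of m] by simp
  qed
qed

text \<open>\<open>f_double\<close> and \<open>nsemi_nsq_eq\<close> express \<open>nsemi\<close> and
  \<open>nsemi_nsq\<close> by \<open>f\<close>; applying the latter at n + 2 >= 5 is what asks for n
  >= 3. Terms with coefficient -1 stand on the left since \<open>f\<close> has values in
  nat.\<close>

lemma f_rec:
  assumes n: "n \<ge> 3"
  shows "f (8 * n) = 2 * f (4 * n)"
    "f (8 * n + 1) = f (4 * n + 1)"
    "f (8 * n + 2) = f (4 * n + 1) + f (4 * n + 3)"
    "f (8 * n + 3) + f (4 * n + 1) = f (4 * n + 2)"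
    "f (8 * n + 4) = 2 * f (4 * n + 2)"
    "f (8 * n + 5) = f (4 * n + 3)"
    "f (8 * n + 6) + f (4 * n + 1) = f (4 * n + 2) + f (4 * n + 3)"
    "f (8 * n + 7) = 2 * f (4 * n + 1) + f (4 * n + 3)"
proof -
  have ev: "f (4 * k) = nsemi (2 * k + 1)" if "k \<ge> 1" for k
    using f_double[of "2 * k"] that by simp
  have odd1: "f (4 * k + 1) = f (2 * k + 1)" if "k \<ge> 2" for k
    using f_double_Suc[of "2 * k"] nunb_sq_double_Suc[of k] that by simp
  have odd3: "f (4 * k + 3) + nsemi_nsq (k + 2) = nsemi (k + 2)" if "k \<ge> 1" for k
    using f_double_Suc[of "2 * k + 1"] nunb_sq_double[of "k + 1"] f_double[of "k + 1"] that
    by (simp add: numeral_eq_Suc add.assoc)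
  have ev2: "f (4 * k + 2) = f (2 * k + 1) + f (2 * k + 3)" if "k \<ge> 2" for k
    using f_double[of "2 * k + 1"] nsemi_double[of "k + 1"] that
    by (simp add: numeral_eq_Suc add.assoc)
  have k1: "nsemi_nsq (2 * n + 2) = f (4 * n + 1)" using nsemi_nsq_eq[of "2 * n + 2"] n by simp
  have k2: "nsemi_nsq (n + 2) = f (4 * n + 1)" using nsemi_nsq_eq[of "n + 2"] odd1[of n] n by simp
  have g1: "nsemi (2 * n + 2) = f (4 * n + 2)" using f_double[of "2 * n + 1"] n by simp
  have g2: "nsemi (2 * n + 3) = 2 * nsemi (n + 2)"
    using nsemi_double_Suc[of "n + 1"] n by (simp add: numeral_eq_Suc add.assoc)
  have g3: "nsemi (4 * n + 3) = 2 * nsemi (2 * n + 2)"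
    using nsemi_double_Suc[of "2 * n + 1"] n by (simp add: numeral_eq_Suc add.assoc)
  have g4: "nsemi (4 * n + 1) = 2 * nsemi (2 * n + 1)"
    using nsemi_double_Suc[of "2 * n"] n by simp
  have f5: "f (4 * n + 5) + f (4 * n + 1) = f (4 * n + 2)"
    using odd1[of "n + 1"] ev2[of n] odd1[of n] n by (simp add: numeral_eq_Suc add.assoc)
  have k3: "nsemi_nsq (2 * n + 1 + 2) + nsemi_nsq (n + 2) = nsemi (n + 2)"
    using nsemi_nsq_double_Suc[of "n + 1"] n by (simp add: numeral_eq_Suc add.assoc)
  show 0: "f (8 * n) = 2 * f (4 * n)" using ev[of "2 * n"] ev[of n] g4 n by simp
  show "f (8 * n + 1) = f (4 * n + 1)" using odd1[of "2 * n"] n by simp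
  show "f (8 * n + 2) = f (4 * n + 1) + f (4 * n + 3)" using ev2[of "2 * n"] n by simp
  show "f (8 * n + 3) + f (4 * n + 1) = f (4 * n + 2)" using odd3[of "2 * n"] k1 g1 n by simp
  show "f (8 * n + 4) = 2 * f (4 * n + 2)" using ev[of "2 * n + 1"] g3 g1 n by (simp add: numeral_eq_Suc add.assoc)
  show "f (8 * n + 5) = f (4 * n + 3)" using odd1[of "2 * n + 1"] n by (simp add: numeral_eq_Suc add.assoc)
  show "f (8 * n + 6) + f (4 * n + 1) = f (4 * n + 2) + f (4 * n + 3)"
    using ev2[of "2 * n + 1"] f5 n by (simp add: numeral_eq_Suc add.assoc)
  show "f (8 * n + 7) = 2 * f (4 * n + 1) + f (4 * n + 3)"
    using odd3[of "2 * n + 1"] k3 k2 g2 odd3[of n] n by (simp add: numeral_eq_Suc add.assoc)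
qed

section \<open>Asymptotics of the summatory function\<close>

lemma f_linear: "\<exists>A. \<forall>n. real (f n) \<le> A * (real n + 1)"
proof -
  \<comment> \<open>The base range 48 = 8 * 6 ensures n >= 6 in the induction, so that
    \<open>f_rec\<close> is available at n div 2 as well as at n.\<close>
  define A where "A = (\<Sum>n<48. real (f n))"
  have A0: "A \<ge> 0" unfolding A_def by (intro sum_nonneg) simp
  have base: "real (f n) \<le> A" if "n < 48" for n
    unfolding A_def using that by (intro member_le_sum) auto
  \<comment> \<open>The shift by 2 is dictated by f (8 * n + 2) = f (4 * n + 1) + f (4 * n + 3): the
    arguments on the right add up to 8 * n + 4, which exceeds 8 * n + 2 by 2, and the shift is
    subtracted twice on the right.\<close>
  have main: "real (f N) \<le> A * (real N - 2)" if "N \<ge> 3" for N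
    using that
  proof (induction N rule: less_induct)
    case (less N)
    show ?case
    proof (cases "N < 48")
      case True
      have "A * 1 \<le> A * (real N - 2)" using A0 less.prems by (intro mult_left_mono) auto
      then show ?thesis using base[OF True] by simp
    next
      case False
      define n where "n = N div 8"
      have n: "n \<ge> 6" using False unfolding n_def by linarith
      have IH: "real (f (4 * n + k)) \<le> A * (real (4 * n + k) - 2)" if "k < 4" for k
        using less.IH[of "4 * n + k"] False that n unfolding n_def by linarith
      note IHs = IH[of 0, simplified] IH[of 1, simplified] IH[of 2, simplified] IH[of 3, simplified]
      note r = f_rec[of n]
      \<comment> \<open>Going down one more level halves this term; otherwise f (8 * n + 7) = 2 * f
        (4 * n + 1) + f (4 * n + 3) would break the bound.\<close>
      have one: "real (f (4 * n + 1)) \<le> A * (2 * real n - 1)"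
      proof -
        have "f (4 * n + 1) = f (2 * n + 1)"
        proof (cases "even n")
          case True
          then obtain k where "n = 2 * k" by blast
          then show ?thesis using f_rec(2)[of k] n by simp
        next
          case False
          then obtain k where "n = 2 * k + 1" using oddE by blast
          then show ?thesis using f_rec(6)[of k] n by (simp add: numeral_eq_Suc add.assoc)
        qed
        moreover have "real (f (2 * n + 1)) \<le> A * (real (2 * n + 1) - 2)"
          using less.IH[of "2 * n + 1"] n False unfolding n_def by linarith
        ultimately show ?thesis by simp
      qed
      have "N mod 8 < 8" by simp
      moreover have N: "N = 8 * n + N mod 8" unfolding n_def by simp
      ultimately consider "N = 8 * n" | "N = 8 * n + 1" | "N = 8 * n + 2" | "N = 8 * n + 3"
        | "N = 8 * n + 4" | "N = 8 * n + 5" | "N = 8 * n + 6" | "N = 8 * n + 7" by linarith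
      then show ?thesis
      proof cases
        case 1 then show ?thesis using r(1) n IHs A0 by (simp add: algebra_simps)
      next
        case 2 then show ?thesis using r(2) n one A0 mult_right_mono[of 0 A "real n"] by (simp add: algebra_simps)
      next
        case 3 then show ?thesis using r(3) n IHs A0 by (simp add: algebra_simps)
      next
        case 4 then show ?thesis using r(4) n IHs A0 mult_right_mono[of 0 A "real n"] by (simp add: algebra_simps)
      next
        case 5 then show ?thesis using r(5) n IHs A0 by (simp add: algebra_simps)
      next
        case 6 then show ?thesis using r(6) n IHs A0 mult_right_mono[of 0 A "real n"] by (simp add: algebra_simps)
      next
        case 7 then show ?thesis using r(7) n IHs A0 by (simp add: algebra_simps)
      next
        case 8 then show ?thesis using r(8) n IHs one A0 by (simp add: algebra_simps)
      qed
    qed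
  qed
  have "real (f n) \<le> A * (real n + 1)" for n
  proof (cases "n \<ge> 3")
    case True
    have "A * (real n - 2) \<le> A * (real n + 1)" using A0 by (intro mult_left_mono) auto
    then show ?thesis using main[OF True] by linarith
  next
    case False
    have "A * 1 \<le> A * (real n + 1)" using A0 by (intro mult_left_mono) auto
    then show ?thesis using base[of n] False by simp
  qed
  then show ?thesis by blast
qed

section \<open>Summatory functions under doubling\<close>

locale dilation_sum =
  fixes w :: "nat \<Rightarrow> real" and \<mu> A :: real
  assumes w_rec: "n \<ge> 3 \<Longrightarrow> w (2 * n) + w (2 * n + 1) = \<mu> * w n"
    and w_bound: "\<bar>w n\<bar> \<le> A * (real n + 1)"
begin

definition L :: "nat \<Rightarrow> real" where
  "L N = (\<Sum>n<N. w n)"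

lemma A_nonneg: "A \<ge> 0"
  using w_bound[of 0] by simp

text \<open>From N = 3 on, L (2 * N) and \<mu> * L N have the same increments, so their difference
  is constant.\<close>

lemma L_double: "\<exists>C\<ge>0. \<forall>N. \<bar>L (2 * N) - \<mu> * L N\<bar> \<le> C"
proof -
  define d where "d N = L (2 * N) - \<mu> * L N" for N
  have "d (3 + n) = d 3" for n
  proof (induction n)
    case (Suc n)
    have "2 * (3 + Suc n) = Suc (Suc (2 * (3 + n)))" by simp
    then have "L (2 * (3 + Suc n)) = L (Suc (Suc (2 * (3 + n))))" by (simp only:)
    then have "L (2 * (3 + Suc n)) = L (2 * (3 + n)) + w (2 * (3 + n)) + w (2 * (3 + n) + 1)"
      by (simp only: L_def sum.lessThan_Suc Suc_eq_plus1[symmetric])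
    moreover have "L (3 + Suc n) = L (3 + n) + w (3 + n)"
      by (simp only: L_def add_Suc_right sum.lessThan_Suc)
    ultimately show ?case using Suc w_rec[of "3 + n"] unfolding d_def by (simp add: algebra_simps)
  qed simp
  then have d: "N \<ge> 3 \<Longrightarrow> d N = d 3" for N by (metis le_add_diff_inverse)
  have "\<bar>d N\<bar> \<le> (\<Sum>n\<le>3. \<bar>d n\<bar>)" for N
  proof -
    have "\<bar>d (min N 3)\<bar> \<le> (\<Sum>n\<le>3. \<bar>d n\<bar>)" by (intro member_le_sum) auto
    moreover have "d (min N 3) = d N" using d[of N] by (auto simp: min_def)
    ultimately show ?thesis by simp
  qed
  moreover have "0 \<le> (\<Sum>n\<le>3. \<bar>d n\<bar>)" by (intro sum_nonneg) simp
  ultimately show ?thesis unfolding d_def by blast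
qed

lemma L_step: "\<exists>C\<ge>0. \<forall>N. \<bar>L N - \<mu> * L (N div 2)\<bar> \<le> C * (real N + 1)"
proof -
  obtain C where C: "C \<ge> 0" "\<And>N. \<bar>L (2 * N) - \<mu> * L N\<bar> \<le> C" using L_double by blast
  have "\<bar>L N - \<mu> * L (N div 2)\<bar> \<le> (C + A) * (real N + 1)" for N
  proof -
    have 1: "C * 1 \<le> C * (real N + 1)" using C by (intro mult_left_mono) auto
    have 2: "0 \<le> A * (real N + 1)" using A_nonneg by simp
    show ?thesis
    proof (cases "even N")
      case True
      then have "2 * (N div 2) = N" by simp
      then show ?thesis using C(2)[of "N div 2"] 1 2 by (simp add: distrib_right)
    next
      case False
      then have e: "N = Suc (2 * (N div 2))" by presburger
      have "L N = L (2 * (N div 2)) + w (2 * (N div 2))"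
        by (subst e) (simp add: L_def)
      moreover have "\<bar>w (2 * (N div 2))\<bar> \<le> A * (real N + 1)"
      proof -
        have "A * (real (2 * (N div 2)) + 1) \<le> A * (real N + 1)"
          using A_nonneg e by (intro mult_left_mono) linarith+
        then show ?thesis using w_bound[of "2 * (N div 2)"] by linarith
      qed
      ultimately show ?thesis using C(2)[of "N div 2"] 1 unfolding distrib_right by linarith
    qed
  qed
  then show ?thesis using C A_nonneg by (intro exI[of _ "C + A"]) auto
qed

lemma L_diff:
  assumes "m \<le> m'"
  shows "\<bar>L m' - L m\<bar> \<le> real (m' - m) * (A * (real m' + 1))"
proof -
  have "L m' - L m = (\<Sum>n\<in>{m..<m'}. w n)"
    unfolding L_def lessThan_atLeast0 using assms by (intro sum_diff_nat_ivl) auto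
  also have "\<bar>\<dots>\<bar> \<le> (\<Sum>n\<in>{m..<m'}. A * (real m' + 1))"
  proof (intro order.trans[OF sum_abs] sum_mono)
    fix n assume "n \<in> {m..<m'}"
    then have "A * (real n + 1) \<le> A * (real m' + 1)" using A_nonneg by (intro mult_left_mono) auto
    then show "\<bar>w n\<bar> \<le> A * (real m' + 1)" using w_bound[of n] by linarith
  qed
  finally show ?thesis by simp
qed

text \<open>Each halving costs an error of order N, and log 2 N drops by at least 1. The factor
  \<mu> is compensated by the halved argument as long as its modulus is at most 2.\<close>

lemma L_le_N_log_N:
  assumes "\<bar>\<mu>\<bar> \<le> 2"
  shows "\<exists>K\<ge>0. \<forall>N\<ge>1. \<bar>L N\<bar> \<le> K * (real N * (log 2 (real N) + 1))"
proof -
  obtain C where C: "C \<ge> 0" "\<And>N. \<bar>L N - \<mu> * L (N div 2)\<bar> \<le> C * (real N + 1)"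
    using L_step by blast
  \<comment> \<open>2 * C absorbs C * (N + 1) <= 2 * C * N in the step, and A covers N = 1.\<close>
  define K where "K = 2 * C + A"
  have K: "K \<ge> 2 * C" "K \<ge> A" "K \<ge> 0" using C A_nonneg by (auto simp: K_def)
  have "\<bar>L N\<bar> \<le> K * (real N * (log 2 (real N) + 1))" if "N \<ge> 1" for N
    using that
  proof (induction N rule: less_induct)
    case (less N)
    show ?case
    proof (cases "N = 1")
      case True
      then show ?thesis using w_bound[of 0] K by (simp add: L_def)
    next
      case False
      define M where "M = N div 2"
      have M: "M \<ge> 1" "M < N" "2 * M \<le> N" "real N \<ge> 2 * real M" using False less.prems by (auto simp: M_def)
      have IH: "\<bar>L M\<bar> \<le> K * (real M * (log 2 (real M) + 1))" using less.IH M by simp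
      have lg: "log 2 (real N) \<ge> log 2 (real M) + 1"
      proof -
        have "log 2 (2 * real M) \<le> log 2 (real N)" using M by simp
        then show ?thesis using M by (simp add: log_mult)
      qed
      have lg0: "log 2 (real M) \<ge> 0" using M by simp
      have "\<bar>L N\<bar> \<le> \<bar>\<mu>\<bar> * \<bar>L M\<bar> + C * (real N + 1)"
        using C(2)[of N] unfolding M_def[symmetric] abs_mult[symmetric] by linarith
      also have "\<bar>\<mu>\<bar> * \<bar>L M\<bar> \<le> 2 * (K * (real M * (log 2 (real M) + 1)))"
        using IH assms by (intro mult_mono) auto
      also have "\<dots> = K * ((2 * real M) * (log 2 (real M) + 1))" by simp
      also have "\<dots> \<le> K * (real N * (log 2 (real N)))"
        using K M lg lg0 by (intro mult_left_mono mult_mono) auto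
      also have "C * (real N + 1) \<le> K * real N"
      proof -
        have "C * (real N + 1) \<le> C * (2 * real N)" using C less.prems by (intro mult_left_mono) auto
        also have "\<dots> = (2 * C) * real N" by simp
        also have "\<dots> \<le> K * real N" using K by (intro mult_right_mono) auto
        finally show ?thesis .
      qed
      finally show ?thesis by (simp add: algebra_simps)
    qed
  qed
  then show ?thesis using K by blast
qed

end

locale dilation_sum_big = dilation_sum w "2 powr \<kappa>" A for w \<kappa> A +
  assumes \<kappa>: "\<kappa> > 1"
begin

definition approx :: "nat \<Rightarrow> real \<Rightarrow> real" where
  "approx k x = L (nat \<lfloor>2 ^ k * x\<rfloor>) / (2 powr \<kappa>) ^ k"

definition Psi :: "real \<Rightarrow> real" where
  "Psi x = lim (\<lambda>k. approx k x)"

text \<open>The error of one doubling grows like 2 ^ k, the normalisation like (2 powr \<kappa>) ^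
  k; q is the ratio.\<close>

definition q :: real where
  "q = 2 / 2 powr \<kappa>"

lemma q: "0 < q" "q < 1"
proof -
  have "2 powr 1 < 2 powr \<kappa>" using \<kappa> by (subst powr_less_cancel_iff) auto
  then show "0 < q" "q < 1" by (auto simp: q_def)
qed

text \<open>The index at level k is half of the index at level k + 1, rounded down, so
  \<open>L_step\<close> compares the two levels.\<close>

lemma approx_Suc: "\<exists>C\<ge>0. \<forall>k. \<forall>x\<ge>0. \<bar>approx (Suc k) x - approx k x\<bar> \<le> C * (x + 1) * q ^ k"
proof -
  let ?l = "2 powr \<kappa> :: real"
  obtain C where C: "C \<ge> 0" "\<And>N. \<bar>L N - ?l * L (N div 2)\<bar> \<le> C * (real N + 1)"
    using L_step by blast
  have l: "?l > 0" by simp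
  have "\<bar>approx (Suc k) x - approx k x\<bar> \<le> C * (x + 1) * q ^ k" if x: "x \<ge> 0" for k x
  proof -
    define N where "N = nat \<lfloor>2 ^ Suc k * x\<rfloor>"
    have pos: "2 ^ k * x \<ge> 0" using x by simp
    have N: "nat \<lfloor>2 ^ k * x\<rfloor> = N div 2"
    proof -
      have "\<lfloor>2 ^ k * x\<rfloor> = \<lfloor>2 ^ Suc k * x\<rfloor> div 2"
        using floor_divide_real_eq_div[of 2 "2 ^ Suc k * x"] by (simp add: mult.assoc)
      then show ?thesis unfolding N_def by (simp add: nat_div_distrib)
    qed
    have N2: "real N \<le> 2 ^ Suc k * x" using x unfolding N_def by simp
    have "approx k x = ?l * L (N div 2) / ?l ^ Suc k"
      using l unfolding approx_def N by simp
    then have "approx (Suc k) x - approx k x = (L N - ?l * L (N div 2)) / ?l ^ Suc k"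
      unfolding approx_def[of "Suc k"] N_def[symmetric] by (simp only: diff_divide_distrib)
    then have "\<bar>approx (Suc k) x - approx k x\<bar> = \<bar>L N - ?l * L (N div 2)\<bar> / ?l ^ Suc k"
      using l by (simp only: abs_divide) (simp del: power_Suc)
    also have "\<dots> \<le> C * (real N + 1) / ?l ^ Suc k"
      using C(2)[of N] l by (intro divide_right_mono) auto
    also have "\<dots> \<le> C * (2 ^ Suc k * (x + 1)) / ?l ^ Suc k"
    proof -
      have "(1::real) \<le> 2 ^ Suc k" by (rule one_le_power) simp
      then have "real N + 1 \<le> 2 ^ Suc k * (x + 1)" using N2 by (simp add: distrib_left)
      then show ?thesis using C l by (intro divide_right_mono mult_left_mono) auto
    qed
    also have "\<dots> = C * (x + 1) * q ^ Suc k"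
      unfolding q_def by (simp add: power_divide)
    also have "\<dots> \<le> C * (x + 1) * q ^ k"
      using q C x by (intro mult_left_mono power_decreasing) auto
    finally show ?thesis .
  qed
  then show ?thesis using C(1) by blast
qed

lemma approx_Psi:
  "\<exists>C\<ge>0. \<forall>x\<ge>0. (\<lambda>k. approx k x) \<longlonglongrightarrow> Psi x \<and> (\<forall>k. \<bar>Psi x - approx k x\<bar> \<le> C * (x + 1) * q ^ k)"
proof -
  obtain C where C: "C \<ge> 0" "\<And>k x. x \<ge> 0 \<Longrightarrow> \<bar>approx (Suc k) x - approx k x\<bar> \<le> C * (x + 1) * q ^ k"
    using approx_Suc by blast
  have "(\<lambda>k. approx k x) \<longlonglongrightarrow> Psi x \<and> (\<forall>k. \<bar>Psi x - approx k x\<bar> \<le> C / (1 - q) * (x + 1) * q ^ k)"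
    if x: "x \<ge> 0" for x
  proof -
    let ?d = "\<lambda>k. approx (Suc k) x - approx k x"
    have sg: "summable (\<lambda>k. C * (x + 1) * q ^ (k + n))" for n
      unfolding power_add using q by (intro summable_mult summable_mult2 summable_geometric) auto
    have sd: "summable ?d"
      by (rule summable_comparison_test[OF _ sg[of 0]]) (use C(2)[OF x] in auto)
    have conv: "(\<lambda>n. approx n x) \<longlonglongrightarrow> approx 0 x + suminf ?d"
    proof -
      have "(\<lambda>n. \<Sum>k<n. ?d k) \<longlonglongrightarrow> suminf ?d" using sd by (rule summable_LIMSEQ)
      then have "(\<lambda>n. approx n x - approx 0 x) \<longlonglongrightarrow> suminf ?d"
        by (simp only: sum_lessThan_telescope[of "\<lambda>k. approx k x"])
      then show ?thesis
        by (auto dest: tendsto_add[OF tendsto_const[of "approx 0 x"]])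
    qed
    then have P: "(\<lambda>k. approx k x) \<longlonglongrightarrow> Psi x" and Peq: "Psi x = approx 0 x + suminf ?d"
      by (auto simp: Psi_def limI)
    have "\<bar>Psi x - approx n x\<bar> \<le> C / (1 - q) * (x + 1) * q ^ n" for n
    proof -
      have "suminf ?d = (\<Sum>k. ?d (k + n)) + (\<Sum>k<n. ?d k)" by (rule suminf_split_initial_segment[OF sd])
      then have "Psi x - approx n x = (\<Sum>k. ?d (k + n))"
        using Peq by (simp only: sum_lessThan_telescope[of "\<lambda>k. approx k x"])
      also have "\<bar>\<dots>\<bar> \<le> (\<Sum>k. C * (x + 1) * q ^ (k + n))"
      proof -
        have "norm (\<Sum>k. ?d (k + n)) \<le> (\<Sum>k. C * (x + 1) * q ^ (k + n))"
          by (rule norm_suminf_le[OF _ sg]) (use C(2)[OF x] in auto)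
        then show ?thesis by simp
      qed
      also have "\<dots> = C * (x + 1) * q ^ n * (\<Sum>k. q ^ k)"
        using q by (subst suminf_mult[symmetric]) (auto simp: power_add mult_ac)
      also have "\<dots> = C / (1 - q) * (x + 1) * q ^ n" using q by (simp add: suminf_geometric)
      finally show ?thesis .
    qed
    with P show ?thesis by blast
  qed
  then show ?thesis using C(1) q by (intro exI[of _ "C / (1 - q)"]) auto
qed

lemma Psi_double:
  assumes "x \<ge> 0"
  shows "Psi (2 * x) = 2 powr \<kappa> * Psi x"
proof -
  have lim: "(\<lambda>k. approx k y) \<longlonglongrightarrow> Psi y" if "y \<ge> 0" for y using approx_Psi that by blast
  have "approx k (2 * x) = 2 powr \<kappa> * approx (Suc k) x" for k
    by (simp add: approx_def mult_ac)
  moreover have "(\<lambda>k. 2 powr \<kappa> * approx (Suc k) x) \<longlonglongrightarrow> 2 powr \<kappa> * Psi x"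
    using lim[OF assms] by (intro tendsto_mult tendsto_const) (rule LIMSEQ_Suc)
  ultimately have "(\<lambda>k. approx k (2 * x)) \<longlonglongrightarrow> 2 powr \<kappa> * Psi x" by simp
  then show ?thesis using lim[of "2 * x"] assms by (intro LIMSEQ_unique) auto
qed

lemma Psi_approx_L: "\<exists>C\<ge>0. \<forall>x\<ge>0. \<bar>Psi x - L (nat \<lfloor>x\<rfloor>)\<bar> \<le> C * (x + 1)"
proof -
  obtain C where C: "C \<ge> 0" "\<And>k x. x \<ge> 0 \<Longrightarrow> \<bar>Psi x - approx k x\<bar> \<le> C * (x + 1) * q ^ k"
    using approx_Psi by blast
  show ?thesis using C(1) C(2)[of _ 0] by (intro exI[of _ C]) (auto simp: approx_def)
qed

text \<open>The scale \<open>k\<close> is chosen with \<open>2 ^ k * \<bar>x - y\<bar>\<close> between 1/2 and 1.\<close>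

lemma Psi_holder:
  "\<exists>C\<ge>0. \<forall>x y. 0 \<le> x \<and> x \<le> y \<and> y \<le> 1 \<longrightarrow> \<bar>Psi x - Psi y\<bar> \<le> C * (y - x) powr (\<kappa> - 1)"
proof -
  obtain C where C: "C \<ge> 0" "\<And>k x. x \<ge> 0 \<Longrightarrow> \<bar>Psi x - approx k x\<bar> \<le> C * (x + 1) * q ^ k"
    using approx_Psi by blast
  \<comment> \<open>4 * C accounts for replacing \<open>Psi\<close> by \<open>approx k\<close> at
    both points, where x + 1 <= 2; 2 * A accounts for the change of \<open>approx k\<close> between
    them.\<close>
  define D where "D = 4 * C + 2 * A"
  have D: "D \<ge> 0" using C A_nonneg by (simp add: D_def)
  have "\<bar>Psi x - Psi y\<bar> \<le> D * 2 powr (\<kappa> - 1) * (y - x) powr (\<kappa> - 1)" if xy: "0 \<le> x" "x < y" "y \<le> 1" for x y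
  proof -
    define d where "d = y - x"
    have d: "0 < d" "d \<le> 1" using xy by (auto simp: d_def)
    define k where "k = nat \<lfloor>- log 2 d\<rfloor>"
    have "log 2 d \<le> 0" using d by simp
    then have k: "real k \<le> - log 2 d" "- log 2 d < real k + 1" by (auto simp: k_def)
    have d1: "2 ^ k * d \<le> 1"
    proof -
      have "2 powr real k \<le> 2 powr (- log 2 d)" using k by simp
      then show ?thesis using d by (simp add: powr_realpow powr_minus field_simps)
    qed
    have d2: "1 \<le> 2 ^ k * (2 * d)"
    proof -
      have "2 powr (- log 2 d) \<le> 2 powr (real k + 1)" using k by simp
      then show ?thesis using d by (simp add: powr_realpow powr_add powr_minus field_simps)
    qed
    define m m' where "m = nat \<lfloor>2 ^ k * x\<rfloor>" and "m' = nat \<lfloor>2 ^ k * y\<rfloor>"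
    have mm: "m \<le> m'" unfolding m_def m'_def using xy by (intro nat_mono floor_mono mult_left_mono) auto
    have y2: "2 ^ k * y \<le> 2 ^ k" using xy by simp
    have m'2: "real m' \<le> 2 ^ k * y" using xy unfolding m'_def by simp
    have p1: "(1::real) \<le> 2 ^ k" by simp
    \<comment> \<open>At this scale the two sums differ by at most one summand, which is of order 2
      ^ k.\<close>
    have m1: "m' - m \<le> 1"
    proof -
      have "2 ^ k * y \<le> 2 ^ k * x + 1" using d1 unfolding d_def by (simp add: algebra_simps)
      then have "\<lfloor>2 ^ k * y\<rfloor> \<le> \<lfloor>2 ^ k * x\<rfloor> + 1"
        using floor_mono[of "2 ^ k * y" "2 ^ k * x + 1"] by simp
      then show ?thesis unfolding m_def m'_def by linarith
    qed
    have "\<bar>approx k y - approx k x\<bar> = \<bar>L m' - L m\<bar> / (2 powr \<kappa>) ^ k"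
      unfolding approx_def m_def m'_def by (simp only: diff_divide_distrib[symmetric] abs_divide) simp
    also have "\<dots> \<le> (2 * A * 2 ^ k) / (2 powr \<kappa>) ^ k"
    proof (intro divide_right_mono)
      have "\<bar>L m' - L m\<bar> \<le> real (m' - m) * (A * (real m' + 1))" by (rule L_diff[OF mm])
      also have "\<dots> \<le> 1 * (A * (2 * 2 ^ k))"
      proof (intro mult_mono)
        show "real m' + 1 \<le> 2 * 2 ^ k" using m'2 y2 p1 by linarith
      qed (use m1 A_nonneg in auto)
      finally show "\<bar>L m' - L m\<bar> \<le> 2 * A * 2 ^ k" by simp
    qed auto
    also have "\<dots> = 2 * A * q ^ k" by (simp add: q_def power_divide)
    finally have 1: "\<bar>approx k y - approx k x\<bar> \<le> 2 * A * q ^ k" .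
    have 2: "\<bar>Psi z - approx k z\<bar> \<le> 2 * C * q ^ k" if "0 \<le> z" "z \<le> 1" for z
    proof -
      have "C * (z + 1) * q ^ k \<le> C * 2 * q ^ k"
        using that C q by (intro mult_right_mono mult_left_mono) auto
      then show ?thesis using C(2)[of z k] that by (simp add: mult_ac)
    qed
    have 3: "\<bar>Psi x - Psi y\<bar> \<le> D * q ^ k"
    proof -
      have "D * q ^ k = 2 * C * q ^ k + 2 * A * q ^ k + 2 * C * q ^ k"
        by (simp add: D_def distrib_right)
      then show ?thesis using 1 2[of x] 2[of y] xy by linarith
    qed
    \<comment> \<open>q = 2 powr (1 - \<kappa>), so q ^ k is the power \<kappa> - 1 of 2 powr (-k),
      and 2 powr (-k) <= 2 * d by the choice of k.\<close>
    have "q ^ k \<le> (2 * d) powr (\<kappa> - 1)"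
    proof -
      have "q = 2 powr (1 - \<kappa>)" by (simp add: q_def powr_diff)
      moreover have "q ^ k = q powr real k" using q by (simp add: powr_realpow)
      ultimately have "q ^ k = 2 powr ((1 - \<kappa>) * real k)" by (simp add: powr_powr)
      moreover have "(1 - \<kappa>) * real k = (- real k) * (\<kappa> - 1)" by (simp add: algebra_simps)
      ultimately have "q ^ k = (2 powr (- real k)) powr (\<kappa> - 1)" by (simp add: powr_powr)
      moreover have "2 powr (- real k) = 1 / 2 ^ k" by (simp add: powr_minus_divide powr_realpow)
      moreover have "(1 / 2 ^ k) powr (\<kappa> - 1) \<le> (2 * d) powr (\<kappa> - 1)"
      proof (rule powr_mono2)
        show "1 / 2 ^ k \<le> 2 * d" using d2 by (simp add: divide_le_eq mult.commute)
      qed (use \<kappa> in auto)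
      ultimately show ?thesis by simp
    qed
    also have "(2 * d) powr (\<kappa> - 1) = 2 powr (\<kappa> - 1) * d powr (\<kappa> - 1)"
      using d by (simp add: powr_mult)
    finally have "D * q ^ k \<le> D * (2 powr (\<kappa> - 1) * d powr (\<kappa> - 1))"
      using D by (rule mult_left_mono)
    then show ?thesis using 3 by (simp add: d_def mult.assoc)
  qed
  then have "\<bar>Psi x - Psi y\<bar> \<le> D * 2 powr (\<kappa> - 1) * (y - x) powr (\<kappa> - 1)"
    if "0 \<le> x" "x \<le> y" "y \<le> 1" for x y
    using that by (cases "x = y") auto
  then show ?thesis using D by (intro exI[of _ "D * 2 powr (\<kappa> - 1)"]) auto
qed

end

section \<open>The exponent \<open>kappa\<close> and the eigenvector sums\<close>

lemma two_powr_kappa: "2 powr kappa = 1 + sqrt 3"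
  by (simp add: kappa_def add_pos_nonneg)

lemma sqrt_3_bounds: "1 < sqrt 3" "sqrt 3 < 2"
proof -
  show "1 < sqrt 3" by simp
  show "sqrt 3 < 2" by (rule real_less_lsqrt) auto
qed

lemma kappa_gt_1: "kappa > 1"
proof -
  have "2 powr 1 < 2 powr kappa" using sqrt_3_bounds unfolding two_powr_kappa by auto
  then show ?thesis by (rule powr_less_cancel) simp
qed

lemma kappa_lt_2: "kappa < 2"
proof -
  have "2 powr kappa < 2 powr 2" using sqrt_3_bounds unfolding two_powr_kappa by auto
  then show ?thesis by (rule powr_less_cancel) simp
qed

definition eigf :: "real \<Rightarrow> nat \<Rightarrow> real" where
  "eigf r n = real (f (4 * n + 1)) + real (f (4 * n + 2)) + r * real (f (4 * n + 3))"

text \<open>The four sums below belong to left eigenvectors of \<open>B0 + B1\<close>, for the eigenvalues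
  \<open>1 + r\<close> with \<open>r\<^sup>2 = 3\<close>, then \<open>1\<close> and \<open>2\<close>.\<close>

lemma eigen_dilation_sums:
  "\<exists>A. (\<forall>r. r\<^sup>2 = 3 \<longrightarrow> dilation_sum (eigf r) (1 + r) A) \<and>
    dilation_sum (\<lambda>n. real (f (4 * n + 2)) - 2 * real (f (4 * n + 1))) 1 A \<and>
    dilation_sum (\<lambda>n. real (f (4 * n)) - 2 * real (f (4 * n + 1)) - 2 * real (f (4 * n + 3))) 2 A"
proof -
  obtain A where A: "\<And>n. real (f n) \<le> A * (real n + 1)" using f_linear by blast
  have A0: "A \<ge> 0" using A[of 0] by (simp add: order.trans[OF of_nat_0_le_iff])
  have b: "real (f (4 * n + j)) \<le> 4 * A * (real n + 1)" if "j < 4" for n j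
  proof -
    have "A * (real (4 * n + j) + 1) \<le> A * (4 * (real n + 1))"
      using A0 that by (intro mult_left_mono) auto
    then show ?thesis using A[of "4 * n + j"] by (simp add: mult_ac)
  qed
  note bs = b[of 0] b[of 1] b[of 2] b[of 3]
  have e: "4 * (2 * n) = 8 * n" "4 * (2 * n + 1) = 8 * n + 4" "8 * n + 4 + 1 = 8 * n + 5"
    "8 * n + 4 + 2 = 8 * n + 6" "8 * n + 4 + 3 = 8 * n + 7" for n :: nat by auto
  have rec: "real (f (8 * n)) = 2 * real (f (4 * n))"
    "real (f (8 * n + 1)) = real (f (4 * n + 1))"
    "real (f (8 * n + 2)) = real (f (4 * n + 1)) + real (f (4 * n + 3))"
    "real (f (8 * n + 3)) = real (f (4 * n + 2)) - real (f (4 * n + 1))"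
    "real (f (8 * n + 4)) = 2 * real (f (4 * n + 2))"
    "real (f (8 * n + 5)) = real (f (4 * n + 3))"
    "real (f (8 * n + 6)) = real (f (4 * n + 2)) + real (f (4 * n + 3)) - real (f (4 * n + 1))"
    "real (f (8 * n + 7)) = 2 * real (f (4 * n + 1)) + real (f (4 * n + 3))" if "n \<ge> 3" for n
    using f_rec[OF that] by linarith+
  have "dilation_sum (eigf r) (1 + r) (20 * A)" if r: "r\<^sup>2 = 3" for r :: real
  proof
    show "eigf r (2 * n) + eigf r (2 * n + 1) = (1 + r) * eigf r n" if "n \<ge> 3" for n
    proof -
      have "r * r = 3" using r by (simp add: power2_eq_square)
      then have r3: "r * (r * x) = 3 * x" for x by (metis mult.assoc)
      show ?thesis
        unfolding eigf_def e rec[OF that] by (simp add: algebra_simps r3)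
    qed
    fix n
    have "r\<^sup>2 \<le> 2\<^sup>2" using r by simp
    then have "\<bar>r\<bar> \<le> 2" unfolding abs_le_square_iff[symmetric] by simp
    then have "\<bar>r * real (f (4 * n + 3))\<bar> \<le> 2 * (4 * A * (real n + 1))"
      unfolding abs_mult using b[of 3 n] by (intro mult_mono) auto
    then show "\<bar>eigf r n\<bar> \<le> 20 * A * (real n + 1)"
      using bs[of n] A0 unfolding eigf_def by (simp add: algebra_simps abs_le_iff)
  qed
  moreover have "dilation_sum (\<lambda>n. real (f (4 * n + 2)) - 2 * real (f (4 * n + 1))) 1 (20 * A)"
  proof
    show "real (f (4 * (2 * n) + 2)) - 2 * real (f (4 * (2 * n) + 1)) +
      (real (f (4 * (2 * n + 1) + 2)) - 2 * real (f (4 * (2 * n + 1) + 1))) =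
      1 * (real (f (4 * n + 2)) - 2 * real (f (4 * n + 1)))" if "n \<ge> 3" for n
      unfolding e rec[OF that] by simp
    show "\<bar>real (f (4 * n + 2)) - 2 * real (f (4 * n + 1))\<bar> \<le> 20 * A * (real n + 1)" for n
      using bs[of n] A0 by (simp add: algebra_simps abs_le_iff)
  qed
  moreover have "dilation_sum (\<lambda>n. real (f (4 * n)) - 2 * real (f (4 * n + 1)) - 2 * real (f (4 * n + 3))) 2 (20 * A)"
  proof
    show "real (f (4 * (2 * n))) - 2 * real (f (4 * (2 * n) + 1)) - 2 * real (f (4 * (2 * n) + 3)) +
      (real (f (4 * (2 * n + 1))) - 2 * real (f (4 * (2 * n + 1) + 1)) - 2 * real (f (4 * (2 * n + 1) + 3))) =
      2 * (real (f (4 * n)) - 2 * real (f (4 * n + 1)) - 2 * real (f (4 * n + 3)))" if "n \<ge> 3" for n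
      unfolding e rec[OF that] by simp
    show "\<bar>real (f (4 * n)) - 2 * real (f (4 * n + 1)) - 2 * real (f (4 * n + 3))\<bar> \<le> 20 * A * (real n + 1)" for n
      using bs[of n] A0 by (simp add: algebra_simps abs_le_iff)
  qed
  ultimately show ?thesis by blast
qed

lemma F_multiple_4: "real (F (4 * M)) =
  (\<Sum>n<M. real (f (4 * n)) + real (f (4 * n + 1)) + real (f (4 * n + 2)) + real (f (4 * n + 3)))"
proof (induction M)
  case (Suc M)
  have "4 * Suc M = Suc (Suc (Suc (Suc (4 * M))))" by simp
  then have "F (4 * Suc M) = F (Suc (Suc (Suc (Suc (4 * M)))))" by (simp only:)
  also have "\<dots> = F (4 * M) + f (4 * M) + f (4 * M + 1) + f (4 * M + 2) + f (4 * M + 3)"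
    unfolding F_def by (simp add: numeral_eq_Suc)
  finally show ?case using Suc by simp
qed (simp add: F_def)

lemma F_near_multiple_4: "\<exists>C\<ge>0. \<forall>N. \<bar>real (F N) - real (F (4 * (N div 4)))\<bar> \<le> C * (real N + 1)"
proof -
  obtain A where A: "\<And>n. real (f n) \<le> A * (real n + 1)" using f_linear by blast
  have A0: "A \<ge> 0" using A[of 0] by (simp add: order.trans[OF of_nat_0_le_iff])
  have "\<bar>real (F N) - real (F (4 * (N div 4)))\<bar> \<le> (4 * A) * (real N + 1)" for N
  proof -
    have "real (F N) - real (F (4 * (N div 4))) = (\<Sum>n\<in>{4 * (N div 4)..<N}. real (f n))"
      unfolding F_def of_nat_sum lessThan_atLeast0 by (intro sum_diff_nat_ivl) auto
    also have "\<bar>\<dots>\<bar> \<le> (\<Sum>n\<in>{4 * (N div 4)..<N}. A * (real N + 1))"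
    proof (intro order.trans[OF sum_abs] sum_mono)
      fix n assume "n \<in> {4 * (N div 4)..<N}"
      then have "A * (real n + 1) \<le> A * (real N + 1)" using A0 by (intro mult_left_mono) auto
      then show "\<bar>real (f n)\<bar> \<le> A * (real N + 1)" using A[of n] by simp
    qed
    also have "\<dots> = real (N mod 4) * (A * (real N + 1))"
      by (simp add: minus_mult_div_eq_mod)
    also have "\<dots> \<le> 4 * (A * (real N + 1))"
      using A0 by (intro mult_right_mono) (auto intro: less_imp_le)
    finally show ?thesis by (simp add: mult.assoc)
  qed
  then show ?thesis using A0 by (intro exI[of _ "4 * A"]) auto
qed

lemma abs_exp_diff_le:
  fixes u v B :: real
  assumes "u \<le> B" "v \<le> B"
  shows "\<bar>exp u - exp v\<bar> \<le> exp B * \<bar>u - v\<bar>"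
proof -
  have "exp u - exp v \<le> exp B * (u - v)" if "v \<le> u" "u \<le> B" for u v
  proof -
    have "exp v = exp u * exp (v - u)" by (simp flip: exp_add)
    then have "exp u - exp v = exp u * (1 - exp (v - u))" by (simp add: right_diff_distrib)
    also have "\<dots> \<le> exp u * (u - v)"
    proof (rule mult_left_mono)
      show "1 - exp (v - u) \<le> u - v" using exp_ge_add_one_self[of "v - u"] by linarith
    qed simp
    also have "\<dots> \<le> exp B * (u - v)" using that by (intro mult_right_mono) auto
    finally show ?thesis .
  qed
  from this[of u v] this[of v u] assms show ?thesis
    by (cases "v \<le> u") (auto simp: abs_if algebra_simps)
qed

lemma F_asymptotics:
  "\<exists>\<Phi> :: real \<Rightarrow> real.
        (\<forall>x. \<Phi> (x + 1) = \<Phi> x) \<and>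
        continuous_on UNIV \<Phi> \<and>
        (\<forall>\<alpha>. 0 < \<alpha> \<and> \<alpha> < kappa - 1 \<longrightarrow>
           (\<exists>C. \<forall>x y. \<bar>\<Phi> x - \<Phi> y\<bar> \<le> C * \<bar>x - y\<bar> powr \<alpha>)) \<and>
        (\<lambda>N :: nat. real (F N) - real N powr kappa * \<Phi> (frac (log 2 (real N))))
          \<in> O[at_top](\<lambda>N. real N * ln (real N))"
proof -
  obtain A where A: "\<And>r. r\<^sup>2 = 3 \<Longrightarrow> dilation_sum (eigf r) (1 + r) A"
    "dilation_sum (\<lambda>n. real (f (4 * n + 2)) - 2 * real (f (4 * n + 1))) 1 A"
    "dilation_sum (\<lambda>n. real (f (4 * n)) - 2 * real (f (4 * n + 1)) - 2 * real (f (4 * n + 3))) 2 A"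
    using eigen_dilation_sums by blast
  interpret p: dilation_sum_big "eigf (sqrt 3)" kappa A
    using A(1)[of "sqrt 3"] kappa_gt_1
    by (simp add: dilation_sum_big_def dilation_sum_big_axioms_def two_powr_kappa)
  interpret m: dilation_sum "eigf (- sqrt 3)" "1 + - sqrt 3" A using A(1)[of "- sqrt 3"] by simp
  interpret one: dilation_sum "\<lambda>n. real (f (4 * n + 2)) - 2 * real (f (4 * n + 1))" 1 A by (rule A)
  interpret two: dilation_sum "\<lambda>n. real (f (4 * n)) - 2 * real (f (4 * n + 1)) - 2 * real (f (4 * n + 3))" 2 A
    by (rule A)
  \<comment> \<open>The row (1, 1, 1, 1), which sums \<open>f\<close> over residues mod 4, is
    expanded in left eigenvectors: (1, -2, 0, -2) + a (0, 1, 1, sqrt 3) + b (0, 1, 1, - sqrt 3) -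
    2/3 (0, -2, 1, 0). This requires a + b = 5/3 and a - b = sqrt 3.\<close>
  define a where "a = (5 / 3 + sqrt 3) / 2"
  define b where "b = (5 / 3 - sqrt 3) / 2"
  have F4: "real (F (4 * M)) = two.L M + a * p.L M + b * m.L M - 2 / 3 * one.L M" for M
  proof -
    have s: "sqrt 3 * (sqrt 3 * x) = 3 * x" for x :: real by (simp flip: mult.assoc)
    show ?thesis
      unfolding F_multiple_4 p.L_def m.L_def one.L_def two.L_def sum_distrib_left
        sum.distrib[symmetric] sum_subtractf[symmetric]
      by (intro sum.cong refl) (simp add: a_def b_def eigf_def s field_simps)
  qed
  obtain C1 where C1: "C1 \<ge> 0" "\<And>N. \<bar>real (F N) - real (F (4 * (N div 4)))\<bar> \<le> C1 * (real N + 1)"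
    using F_near_multiple_4 by blast
  have s2: "\<bar>1 + - sqrt 3\<bar> \<le> 2"
    using sqrt_3_bounds by auto
  obtain Km where Km: "Km \<ge> 0" "\<And>N. N \<ge> 1 \<Longrightarrow> \<bar>m.L N\<bar> \<le> Km * (real N * (log 2 (real N) + 1))"
    using m.L_le_N_log_N[OF s2] by blast
  obtain K1 where K1: "K1 \<ge> 0" "\<And>N. N \<ge> 1 \<Longrightarrow> \<bar>one.L N\<bar> \<le> K1 * (real N * (log 2 (real N) + 1))"
    using one.L_le_N_log_N by auto
  obtain K2 where K2: "K2 \<ge> 0" "\<And>N. N \<ge> 1 \<Longrightarrow> \<bar>two.L N\<bar> \<le> K2 * (real N * (log 2 (real N) + 1))"
    using two.L_le_N_log_N by auto
  obtain CP where CP: "CP \<ge> 0" "\<And>x. x \<ge> 0 \<Longrightarrow> \<bar>p.Psi x - p.L (nat \<lfloor>x\<rfloor>)\<bar> \<le> CP * (x + 1)"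
    using p.Psi_approx_L by blast
  obtain CH where CH: "CH \<ge> 0"
    "\<And>x y. 0 \<le> x \<Longrightarrow> x \<le> y \<Longrightarrow> y \<le> 1 \<Longrightarrow> \<bar>p.Psi x - p.Psi y\<bar> \<le> CH * (y - x) powr (kappa - 1)"
    using p.Psi_holder by blast

  \<comment> \<open>The argument is divided by 4 because F N is compared with a * p.L (N div
    4).\<close>
  define \<Phi> where "\<Phi> t = a * (2 powr (- kappa * t) * p.Psi (2 powr t / 4))" for t :: real
  have per: "\<Phi> (t + 1) = \<Phi> t" for t
  proof -
    have "p.Psi (2 powr (t + 1) / 4) = 2 powr kappa * p.Psi (2 powr t / 4)"
      using p.Psi_double[of "2 powr t / 4"] by (simp add: powr_add mult.commute)
    moreover have "2 powr (- kappa * (t + 1)) * 2 powr kappa = 2 powr (- kappa * t)"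
      by (simp add: powr_add[symmetric] algebra_simps)
    ultimately show ?thesis unfolding \<Phi>_def by (simp add: mult.assoc[symmetric])
  qed
  interpret per: periodic_fun_simple' \<Phi> by standard (rule per)

  \<comment> \<open>After shifting x into [0, 1), a point y at distance at most 1 lies in [-1, 2].
    There 2 powr t / 4 <= 1, so the estimate for \<open>Psi\<close> on [0, 1] applies.\<close>
  obtain D where D: "D \<ge> 0"
    "\<And>x y. x \<in> {-1..2} \<Longrightarrow> y \<in> {-1..2} \<Longrightarrow> \<bar>x - y\<bar> \<le> 1 \<Longrightarrow> \<bar>\<Phi> x - \<Phi> y\<bar> \<le> D * \<bar>x - y\<bar> powr (kappa - 1)"
  proof -
    define P where "P = \<bar>p.Psi 0\<bar> + CH"
    have P: "\<bar>p.Psi z\<bar> \<le> P" if "0 \<le> z" "z \<le> 1" for z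
    proof -
      have "CH * z powr (kappa - 1) \<le> CH * 1"
        using that CH(1) kappa_gt_1 by (intro mult_left_mono powr_le1) auto
      then show ?thesis using CH(2)[of 0 z] that unfolding P_def by simp
    qed
    have P0: "P \<ge> 0" using CH by (simp add: P_def)
    define E where "E = exp (ln 2 * kappa) * (ln 2 * kappa)"
    have E: "\<bar>2 powr (- kappa * x) - 2 powr (- kappa * y)\<bar> \<le> E * \<bar>x - y\<bar>" if "x \<ge> -1" "y \<ge> -1" for x y
    proof -
      have "- kappa * z * ln 2 \<le> ln 2 * kappa" if "z \<ge> -1" for z
      proof -
        have "(ln 2 * kappa) * (- z) \<le> (ln 2 * kappa) * 1"
          using that kappa_gt_1 by (intro mult_left_mono) auto
        then show ?thesis by (simp add: mult_ac)
      qed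
      from abs_exp_diff_le[OF this[of x] this[of y]] that
      have "\<bar>2 powr (- kappa * x) - 2 powr (- kappa * y)\<bar> \<le> exp (ln 2 * kappa) * \<bar>- kappa * x * ln 2 - - kappa * y * ln 2\<bar>"
        by (simp add: powr_def)
      also have "- kappa * x * ln 2 - - kappa * y * ln 2 = (ln 2 * kappa) * (y - x)" by (simp add: algebra_simps)
      also have "\<bar>(ln 2 * kappa) * (y - x)\<bar> = (ln 2 * kappa) * \<bar>x - y\<bar>"
        using kappa_gt_1 by (simp add: abs_mult abs_minus_commute)
      finally show ?thesis by (simp add: E_def mult.assoc)
    qed
    have E0: "E \<ge> 0" using kappa_gt_1 by (simp add: E_def)
    have lip: "\<bar>2 powr x / 4 - 2 powr y / 4\<bar> \<le> \<bar>x - y\<bar>" if "x \<le> 2" "y \<le> 2" for x y :: real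
    proof -
      have "\<bar>exp (x * ln 2) - exp (y * ln 2)\<bar> \<le> exp (2 * ln 2) * \<bar>x * ln 2 - y * ln 2\<bar>"
        using that by (intro abs_exp_diff_le mult_right_mono) auto
      also have "exp (2 * ln 2) = (4::real)" by (simp add: exp_double)
      also have "\<bar>x * ln 2 - y * ln 2\<bar> = ln 2 * \<bar>x - y\<bar>"
        by (simp add: left_diff_distrib[symmetric] abs_mult mult.commute)
      also have "4 * (ln 2 * \<bar>x - y\<bar>) \<le> 4 * (1 * \<bar>x - y\<bar>)"
        using ln_le_minus_one[of 2] by (intro mult_left_mono mult_right_mono) auto
      finally have "\<bar>2 powr x - 2 powr y\<bar> \<le> 4 * \<bar>x - y\<bar>" by (simp add: powr_def)
      then show ?thesis by (simp add: abs_le_iff)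
    qed
    have Psi: "\<bar>p.Psi (2 powr x / 4) - p.Psi (2 powr y / 4)\<bar> \<le> CH * \<bar>x - y\<bar> powr (kappa - 1)"
      if "x \<le> y" "y \<le> 2" for x y :: real
    proof -
      have "2 powr y \<le> 2 powr (2::real)" using that by (subst powr_le_cancel_iff) auto
      then have "\<bar>p.Psi (2 powr x / 4) - p.Psi (2 powr y / 4)\<bar> \<le> CH * (2 powr y / 4 - 2 powr x / 4) powr (kappa - 1)"
        using that by (intro CH(2)) auto
      also have "\<dots> \<le> CH * \<bar>x - y\<bar> powr (kappa - 1)"
        using lip[of x y] that kappa_gt_1 CH(1) by (intro mult_left_mono powr_mono2) auto
      finally show ?thesis .
    qed
    define D where "D = \<bar>a\<bar> * (exp (ln 2 * kappa) * CH + E * P)"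
    have main: "\<bar>\<Phi> x - \<Phi> y\<bar> \<le> D * \<bar>x - y\<bar> powr (kappa - 1)"
      if xy: "x \<in> {-1..2}" "y \<in> {-1..2}" "\<bar>x - y\<bar> \<le> 1" "x \<le> y" for x y
    proof -
      let ?e = "\<lambda>t. 2 powr (- kappa * t)" and ?P = "\<lambda>t. p.Psi (2 powr t / 4)"
      \<comment> \<open>As \<open>kappa\<close> - 1 < 1, the Lipschitz factor 2 powr (- kappa * t)
        satisfies the weaker estimate too.\<close>
      have le1: "\<bar>x - y\<bar> \<le> \<bar>x - y\<bar> powr (kappa - 1)"
        using xy kappa_lt_2 powr_mono'[of "kappa - 1" 1 "\<bar>x - y\<bar>"] by simp
      have "?e x \<le> exp (ln 2 * kappa)"
      proof -
        have "(ln 2 * kappa) * (- x) \<le> (ln 2 * kappa) * 1"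
          using xy kappa_gt_1 by (intro mult_left_mono) auto
        then show ?thesis by (simp add: powr_def mult_ac)
      qed
      then have "\<bar>?e x * (?P x - ?P y)\<bar> \<le> exp (ln 2 * kappa) * (CH * \<bar>x - y\<bar> powr (kappa - 1))"
        unfolding abs_mult using Psi[of x y] xy by (intro mult_mono) auto
      moreover have "\<bar>(?e x - ?e y) * ?P y\<bar> \<le> (E * \<bar>x - y\<bar> powr (kappa - 1)) * P"
        unfolding abs_mult
      proof (intro mult_mono)
        show "\<bar>?e x - ?e y\<bar> \<le> E * \<bar>x - y\<bar> powr (kappa - 1)"
          using E[of x y] xy mult_left_mono[OF le1 E0] by auto
        have "2 powr y \<le> 2 powr (2::real)" using xy by (subst powr_le_cancel_iff) auto
        then show "\<bar>?P y\<bar> \<le> P" by (intro P) auto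
      qed (use E0 in auto)
      ultimately have "\<bar>?e x * (?P x - ?P y)\<bar> + \<bar>(?e x - ?e y) * ?P y\<bar> \<le>
          (exp (ln 2 * kappa) * CH + E * P) * \<bar>x - y\<bar> powr (kappa - 1)"
        by (simp add: algebra_simps)
      moreover have "\<bar>?e x * ?P x - ?e y * ?P y\<bar> \<le> \<bar>?e x * (?P x - ?P y)\<bar> + \<bar>(?e x - ?e y) * ?P y\<bar>"
        by (rule order.trans[OF _ abs_triangle_ineq]) (simp add: algebra_simps)
      ultimately have "\<bar>?e x * ?P x - ?e y * ?P y\<bar> \<le> (exp (ln 2 * kappa) * CH + E * P) * \<bar>x - y\<bar> powr (kappa - 1)"
        by linarith
      then have "\<bar>a\<bar> * \<bar>?e x * ?P x - ?e y * ?P y\<bar> \<le> D * \<bar>x - y\<bar> powr (kappa - 1)"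
        unfolding D_def mult.assoc by (rule mult_left_mono) simp
      moreover have "\<Phi> x - \<Phi> y = a * (?e x * ?P x - ?e y * ?P y)" by (simp add: \<Phi>_def right_diff_distrib)
      ultimately show ?thesis by (simp only: abs_mult)
    qed
    show ?thesis
    proof (rule that)
      show "D \<ge> 0" using CH E0 P0 by (simp add: D_def)
      fix x y :: real assume "x \<in> {-1..2}" "y \<in> {-1..2}" "\<bar>x - y\<bar> \<le> 1"
      then show "\<bar>\<Phi> x - \<Phi> y\<bar> \<le> D * \<bar>x - y\<bar> powr (kappa - 1)"
        using main[of x y] main[of y x] by (cases "x \<le> y") (auto simp: abs_minus_commute)
    qed
  qed

  have shift: "\<Phi> (frac x + (y - x)) = \<Phi> y" for x y
    using per.minus_of_int[of y "\<lfloor>x\<rfloor>"] by (simp add: frac_def algebra_simps)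
  have frac_eq: "\<Phi> (frac x) = \<Phi> x" for x using shift[of x x] by simp
  have near: "\<bar>\<Phi> x - \<Phi> y\<bar> \<le> D * \<bar>x - y\<bar> powr (kappa - 1)" if "\<bar>x - y\<bar> \<le> 1" for x y
  proof -
    have "\<bar>\<Phi> (frac x) - \<Phi> (frac x + (y - x))\<bar> \<le> D * \<bar>frac x - (frac x + (y - x))\<bar> powr (kappa - 1)"
    proof (rule D(2))
      have "0 \<le> frac x" "frac x < 1" by (auto simp: frac_lt_1)
      then show "frac x \<in> {-1..2}" "frac x + (y - x) \<in> {-1..2}" "\<bar>frac x - (frac x + (y - x))\<bar> \<le> 1"
        unfolding atLeastAtMost_iff using that by linarith+
    qed
    then show ?thesis unfolding shift frac_eq by (simp add: abs_minus_commute)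
  qed
  have bounded: "\<bar>\<Phi> x - \<Phi> y\<bar> \<le> D" for x y
  proof -
    have "\<bar>frac x - frac y\<bar> \<le> 1"
      using frac_lt_1[of x] frac_ge_0[of x] frac_lt_1[of y] frac_ge_0[of y] by linarith
    then have "\<bar>\<Phi> (frac x) - \<Phi> (frac y)\<bar> \<le> D * \<bar>frac x - frac y\<bar> powr (kappa - 1)"
      by (rule near)
    also have "\<dots> \<le> D * 1"
      using D(1) \<open>\<bar>frac x - frac y\<bar> \<le> 1\<close> kappa_gt_1 by (intro mult_left_mono powr_le1) auto
    finally show ?thesis by (simp add: frac_eq)
  qed
  have holder: "\<bar>\<Phi> x - \<Phi> y\<bar> \<le> D * \<bar>x - y\<bar> powr \<alpha>" if \<alpha>: "0 < \<alpha>" "\<alpha> < kappa - 1" for \<alpha> x y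
  proof (cases "\<bar>x - y\<bar> \<le> 1")
    case True
    have "\<bar>x - y\<bar> powr (kappa - 1) \<le> \<bar>x - y\<bar> powr \<alpha>"
      using \<alpha> True by (intro powr_mono') auto
    then show ?thesis using near[OF True] mult_left_mono[OF _ D(1)] by (meson order.trans)
  next
    case False
    then have "1 \<le> \<bar>x - y\<bar> powr \<alpha>" using \<alpha> by (intro ge_one_powr_ge_zero) auto
    then have "D * 1 \<le> D * \<bar>x - y\<bar> powr \<alpha>" using D(1) by (rule mult_left_mono)
    then show ?thesis using bounded[of x y] by simp
  qed
  have cont: "continuous_on UNIV \<Phi>"
  proof (rule continuous_at_imp_continuous_on, rule ballI)
    fix x
    have "((\<lambda>y. \<bar>\<Phi> y - \<Phi> x\<bar>) \<longlongrightarrow> 0) (at x)"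
    proof (rule tendsto_sandwich[OF _ _ tendsto_const])
      have "((\<lambda>y. D * \<bar>y - x\<bar> powr (kappa - 1)) \<longlongrightarrow> D * \<bar>x - x\<bar> powr (kappa - 1)) (at x)"
        using kappa_gt_1 by (intro tendsto_intros tendsto_powr' ) auto
      then show "((\<lambda>y. D * \<bar>y - x\<bar> powr (kappa - 1)) \<longlongrightarrow> 0) (at x)" by simp
      have "eventually (\<lambda>y. dist y x < 1) (at x)" by (auto simp: eventually_at intro!: exI[of _ 1])
      then show "eventually (\<lambda>y. \<bar>\<Phi> y - \<Phi> x\<bar> \<le> D * \<bar>y - x\<bar> powr (kappa - 1)) (at x)"
        by eventually_elim (auto intro!: near simp: dist_real_def)
    qed auto
    then have "((\<lambda>y. \<Phi> y - \<Phi> x) \<longlongrightarrow> 0) (at x)" by (simp add: tendsto_rabs_zero_iff)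
    then show "isCont \<Phi> x" unfolding isCont_def by (simp add: LIM_zero_iff)
  qed

  define K where "K = 2 * C1 + K2 + \<bar>b\<bar> * Km + K1 + 2 * \<bar>a\<bar> * CP"
  have K0: "K \<ge> 0" using C1 K2 Km K1 CP by (simp add: K_def)
  have asym: "\<bar>real (F N) - real N powr kappa * \<Phi> (frac (log 2 (real N)))\<bar> \<le> K * (real N * (log 2 (real N) + 1))"
    if N: "N \<ge> 4" for N
  proof -
    define M where "M = N div 4"
    have M: "M \<ge> 1" "M \<le> N" using N by (auto simp: M_def)
    define T where "T = real N * (log 2 (real N) + 1)"
    have lN: "log 2 (real N) \<ge> 0" using N by simp
    have T1: "real N + 1 \<le> 2 * T"
    proof -
      have "real N * 1 \<le> T" unfolding T_def using lN by (intro mult_left_mono) auto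
      then show ?thesis using N by simp
    qed
    have TM: "real M * (log 2 (real M) + 1) \<le> T"
      unfolding T_def using M lN by (intro mult_mono) auto
    have "real N powr kappa * \<Phi> (frac (log 2 (real N))) = a * p.Psi (real N / 4)"
    proof -
      have "2 powr (- kappa * log 2 (real N)) = (2 powr (log 2 (real N))) powr (- kappa)"
        by (simp add: powr_powr mult.commute)
      then have e: "2 powr (- kappa * log 2 (real N)) = real N powr (- kappa)" using N by simp
      have i: "real N powr kappa * real N powr (- kappa) = 1" using N by (simp add: powr_minus)
      have "2 powr log 2 (real N) = real N" using N by simp
      then have "\<Phi> (log 2 (real N)) = a * (real N powr (- kappa) * p.Psi (real N / 4))"
        unfolding \<Phi>_def e by (simp only:)
      then have "real N powr kappa * \<Phi> (log 2 (real N)) =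
          (real N powr kappa * real N powr (- kappa)) * (a * p.Psi (real N / 4))"
        by (simp only: mult_ac)
      then show ?thesis unfolding frac_eq i by (simp only: mult_1_left)
    qed
    moreover have "\<bar>a * p.Psi (real N / 4) - a * p.L M\<bar> \<le> \<bar>a\<bar> * (CP * (2 * T))"
    proof -
      have "nat \<lfloor>real N / 4\<rfloor> = M" unfolding M_def
        using floor_divide_of_nat_eq[where ?'a = real, of N 4] by simp
      then have "\<bar>p.Psi (real N / 4) - p.L M\<bar> \<le> CP * (real N / 4 + 1)" using CP(2)[of "real N / 4"] by simp
      also have "\<dots> \<le> CP * (2 * T)" using T1 CP(1) by (intro mult_left_mono) auto
      finally have "\<bar>a\<bar> * \<bar>p.Psi (real N / 4) - p.L M\<bar> \<le> \<bar>a\<bar> * (CP * (2 * T))"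
        by (rule mult_left_mono) simp
      then show ?thesis by (simp only: abs_mult[of a] right_diff_distrib[of a, symmetric])
    qed
    moreover have "\<bar>real (F N) - real (F (4 * M))\<bar> \<le> C1 * (2 * T)"
      using C1(2)[of N] mult_left_mono[OF T1 C1(1)] unfolding M_def by linarith
    moreover have "\<bar>b * m.L M\<bar> \<le> \<bar>b\<bar> * (Km * T)"
      unfolding abs_mult using Km(2)[OF M(1)] mult_left_mono[OF TM Km(1)] by (intro mult_left_mono) auto
    moreover have "\<bar>one.L M\<bar> \<le> K1 * T" "\<bar>two.L M\<bar> \<le> K2 * T"
      using K1(2)[OF M(1)] mult_left_mono[OF TM K1(1)] K2(2)[OF M(1)] mult_left_mono[OF TM K2(1)] by auto
    moreover have "K * T = C1 * (2 * T) + K2 * T + \<bar>b\<bar> * (Km * T) + K1 * T + \<bar>a\<bar> * (CP * (2 * T))"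
      unfolding K_def by (simp add: algebra_simps)
    ultimately have "\<bar>real (F N) - real N powr kappa * \<Phi> (frac (log 2 (real N)))\<bar> \<le> K * T"
      using F4[of M] by linarith
    then show ?thesis by (simp add: T_def)
  qed
  have "(\<lambda>N :: nat. real (F N) - real N powr kappa * \<Phi> (frac (log 2 (real N))))
          \<in> O[at_top](\<lambda>N. real N * ln (real N))"
  proof (rule bigoI)
    show "eventually (\<lambda>N. norm (real (F N) - real N powr kappa * \<Phi> (frac (log 2 (real N)))) \<le>
        (2 * K / ln 2) * norm (real N * ln (real N))) at_top"
      using eventually_ge_at_top[of 4]
    proof eventually_elim
      case (elim N)
      have l1: "1 \<le> log 2 (real N)" using elim by (simp add: le_log_iff)
      have "K * (real N * (log 2 (real N) + 1)) \<le> K * (real N * (2 * log 2 (real N)))"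
        using K0 l1 by (intro mult_left_mono) auto
      also have "\<dots> = (2 * K / ln 2) * norm (real N * ln (real N))"
        using elim by (simp add: log_def)
      finally show ?case using asym[OF elim] by simp
    qed
  qed
  then show ?thesis using per cont holder by (intro exI[of _ \<Phi>]) blast
qed

lemma F_bigo: "(\<lambda>N. real (F N)) \<in> O(\<lambda>N. real N powr kappa)"
proof -
  obtain \<Phi> :: "real \<Rightarrow> real" where per: "\<And>x. \<Phi> (x + 1) = \<Phi> x" and cont: "continuous_on UNIV \<Phi>" and
    asym: "(\<lambda>N :: nat. real (F N) - real N powr kappa * \<Phi> (frac (log 2 (real N))))
          \<in> O[at_top](\<lambda>N. real N * ln (real N))"
    using F_asymptotics by blast
  have "compact (\<Phi> ` {0..1})"
    by (rule compact_continuous_image) (auto intro: continuous_on_subset[OF cont])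
  then obtain B where B: "\<And>x. x \<in> {0..1} \<Longrightarrow> norm (\<Phi> x) \<le> B"
    using compact_imp_bounded by (force simp: bounded_iff)
  have "(\<lambda>N. real N powr kappa * \<Phi> (frac (log 2 (real N)))) \<in> O(\<lambda>N. real N powr kappa)"
  proof (rule bigoI[of _ B], rule always_eventually, rule allI)
    fix N :: nat
    have "norm (\<Phi> (frac (log 2 (real N)))) \<le> B"
      by (rule B) (auto simp: frac_lt_1 less_imp_le)
    then have "real N powr kappa * norm (\<Phi> (frac (log 2 (real N)))) \<le> real N powr kappa * B"
      by (rule mult_left_mono) simp
    then show "norm (real N powr kappa * \<Phi> (frac (log 2 (real N)))) \<le> B * norm (real N powr kappa)"
      by (simp add: abs_mult mult.commute)
  qed
  moreover have "(\<lambda>N. real N * ln (real N)) \<in> O(\<lambda>N. real N powr kappa)"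
    using kappa_gt_1 by real_asymp
  then have "(\<lambda>N :: nat. real (F N) - real N powr kappa * \<Phi> (frac (log 2 (real N)))) \<in> O(\<lambda>N. real N powr kappa)"
    using asym landau_o.big.trans by blast
  ultimately show ?thesis
    using sum_in_bigo(1) by fastforce
qed

section \<open>The Dirichlet series\<close>

lemma F_le_powr_kappa: "\<exists>C\<ge>0. \<forall>N\<ge>1. real (F N) \<le> C * real N powr kappa"
proof -
  obtain C where C: "C > 0" "eventually (\<lambda>N. norm (real (F N)) \<le> C * norm (real N powr kappa)) at_top"
    using F_bigo by (rule landau_o.bigE)
  then obtain N0 where N0: "\<And>N. N \<ge> N0 \<Longrightarrow> real (F N) \<le> C * real N powr kappa"
    by (auto simp: eventually_at_top_linorder)
  have "real (F N) \<le> (C + real (F N0)) * real N powr kappa" if "N \<ge> 1" for N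
  proof (cases "N \<ge> N0")
    case True
    have "0 \<le> real (F N0) * real N powr kappa" by simp
    then show ?thesis using N0[OF True] unfolding distrib_right by linarith
  next
    case False
    then have "F N \<le> F N0" unfolding F_def by (intro sum_mono2) auto
    then have "real (F N) \<le> real (F N0)" by simp
    also have "\<dots> \<le> real (F N0) * real N powr kappa"
      using that kappa_gt_1 ge_one_powr_ge_zero[of "real N" kappa] by (simp add: mult_le_cancel_left1)
    also have "\<dots> \<le> (C + real (F N0)) * real N powr kappa"
      using C by (intro mult_right_mono) auto
    finally show ?thesis .
  qed
  then show ?thesis using C(1) by (intro exI[of _ "C + real (F N0)"]) auto
qed

text \<open>On the dyadic block from 2 ^ k to 2 ^ (k + 1) the sum is at most F (2 ^ (k + 1)) / 2
  powr (k * \<sigma>), which is geometric in k with ratio 2 powr (kappa - \<sigma>).\<close>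

lemma summable_f_powr:
  assumes "\<sigma> > kappa"
  shows "summable (\<lambda>n. real (f n) / real n powr \<sigma>)"
proof -
  obtain C where C: "C \<ge> 0" "\<And>N. N \<ge> 1 \<Longrightarrow> real (F N) \<le> C * real N powr kappa"
    using F_le_powr_kappa by blast
  define a where "a n = real (f n) / real n powr \<sigma>" for n
  have a0: "a n \<ge> 0" for n by (simp add: a_def)
  define q where "q = 2 powr (kappa - \<sigma>)"
  have "2 powr (kappa - \<sigma>) < 2 powr (0::real)" using assms by (subst powr_less_cancel_iff) auto
  then have q: "0 < q" "q < 1" by (auto simp: q_def)
  have block: "(\<Sum>n\<in>{2^k..<2^Suc k}. a n) \<le> C * 2 powr kappa * q ^ k" for k :: nat
  proof -
    have "(\<Sum>n\<in>{2^k..<2^Suc k}. a n) \<le> (\<Sum>n\<in>{2^k..<2^Suc k}. real (f n) / real (2 ^ k) powr \<sigma>)"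
    proof (intro sum_mono)
      fix n :: nat assume "n \<in> {2^k..<2^Suc k}"
      then have n: "2 ^ k \<le> n" by simp
      then have "0 < n" by (rule order.strict_trans2[rotated]) simp
      from n have "real (2 ^ k) \<le> real n" by (simp only: of_nat_le_iff)
      then have "real (2 ^ k) powr \<sigma> \<le> real n powr \<sigma>"
        using assms kappa_gt_1 by (intro powr_mono2) auto
      then show "a n \<le> real (f n) / real (2 ^ k) powr \<sigma>"
        unfolding a_def using \<open>0 < n\<close> by (intro divide_left_mono) auto
    qed
    also have "\<dots> = (\<Sum>n\<in>{2^k..<2^Suc k}. real (f n)) / real (2 ^ k) powr \<sigma>"
      by (simp only: sum_divide_distrib)
    also have "\<dots> \<le> real (F (2 ^ Suc k)) / real (2 ^ k) powr \<sigma>"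
      unfolding F_def of_nat_sum by (intro divide_right_mono sum_mono2) auto
    also have "\<dots> \<le> (C * real (2 ^ Suc k) powr kappa) / real (2 ^ k) powr \<sigma>"
      by (intro divide_right_mono C(2)) auto
    also have "\<dots> = C * 2 powr kappa * q ^ k"
    proof -
      have "real (2 ^ Suc k) powr kappa = 2 powr kappa * (2 powr kappa) ^ k"
        by (simp add: powr_mult powr_power powr_realpow[symmetric] powr_powr mult.commute)
      moreover have "real (2 ^ k) powr \<sigma> = (2 powr \<sigma>) ^ k"
        by (simp add: powr_power powr_realpow[symmetric] powr_powr mult.commute)
      ultimately show ?thesis by (simp add: q_def powr_diff power_divide)
    qed
    finally show ?thesis .
  qed
  have "(\<Sum>n\<in>{1..<2^K}. a n) \<le> (\<Sum>k<K. C * 2 powr kappa * q ^ k)" for K :: nat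
  proof (induction K)
    case (Suc K)
    have "{1..<2^Suc K} = {1..<2^K} \<union> {2^K..<2^Suc K :: nat}"
      by (intro ivl_disj_un_two(3)[symmetric]) auto
    then have "(\<Sum>n\<in>{1..<2^Suc K}. a n) = (\<Sum>n\<in>{1..<2^K}. a n) + (\<Sum>n\<in>{2^K..<2^Suc K}. a n)"
      by (simp only:) (subst sum.union_disjoint; auto)
    then show ?case using Suc block[of K] by simp
  qed simp
  moreover have "(\<Sum>k<K. C * 2 powr kappa * q ^ k) \<le> C * 2 powr kappa / (1 - q)" for K
  proof -
    have "(\<Sum>k<K. q ^ k) \<le> (\<Sum>k. q ^ k)" using q by (intro sum_le_suminf summable_geometric) auto
    then have "(\<Sum>k<K. q ^ k) \<le> 1 / (1 - q)" using q by (simp add: suminf_geometric)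
    then show ?thesis
      unfolding sum_distrib_left[symmetric] using C(1) mult_left_mono[of _ "1 / (1 - q)" "C * 2 powr kappa"] by simp
  qed
  ultimately have dy: "(\<Sum>n\<in>{1..<2^K}. a n) \<le> C * 2 powr kappa / (1 - q)" for K :: nat
    by (rule order.trans)
  have "summable a"
  proof (rule summableI_nonneg_bounded)
    fix N :: nat
    have "N < 2 ^ N" by (rule less_exp)
    \<comment> \<open>The term at 0 vanishes: 0 powr \<sigma> = 0, and division by 0 gives
      0.\<close>
    have "sum a {..<N} = sum a ({..<N} - {0})"
      by (intro sum.mono_neutral_right) (auto simp: a_def)
    also have "\<dots> \<le> sum a {1..<2^N}"
      using a0 by (intro sum_mono2) (auto intro: order.strict_trans[OF _ \<open>N < 2 ^ N\<close>])
    also have "\<dots> \<le> C * 2 powr kappa / (1 - q)" by (rule dy)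
    finally show "sum a {..<N} \<le> C * 2 powr kappa / (1 - q)" .
  qed (rule a0)
  then show ?thesis unfolding a_def[abs_def] .
qed

section \<open>Absolute convergence and holomorphy\<close>

definition rterm :: "nat \<Rightarrow> real \<Rightarrow> nat \<Rightarrow> real" where
  "rterm k \<sigma> n = real (f (4 * n + k)) / real (4 * n + k) powr \<sigma>"

lemma rterm_nonneg: "rterm k \<sigma> n \<ge> 0"
  by (simp add: rterm_def)

lemma rterm_summable:
  assumes "\<sigma> > kappa"
  shows "rterm k \<sigma> summable_on A"
proof -
  have "(\<lambda>n. real (f n) / real n powr \<sigma>) summable_on UNIV"
    using summable_f_powr[OF assms] by (subst summable_on_UNIV_nonneg_real_iff) auto
  then have "(\<lambda>n. real (f n) / real n powr \<sigma>) summable_on range (\<lambda>n. 4 * n + k)"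
    by (rule summable_on_subset_banach) auto
  then have "((\<lambda>n. real (f n) / real n powr \<sigma>) \<circ> (\<lambda>n. 4 * n + k)) summable_on UNIV"
    by (subst summable_on_reindex[symmetric]) (auto simp: inj_on_def)
  then have "rterm k \<sigma> summable_on UNIV" by (simp add: o_def rterm_def[abs_def])
  then show ?thesis by (rule summable_on_subset_banach) auto
qed

lemma norm_dterm:
  assumes "n \<ge> 1"
  shows "norm (dterm k s n) = rterm k (Re s) n"
proof -
  have "norm (of_nat (4 * n + k) powr s) = real (4 * n + k) powr Re s"
    by (subst norm_powr_real_powr) auto
  then show ?thesis by (simp only: dterm_def rterm_def norm_divide norm_of_nat)
qed

lemma dterm_abs_summable:
  assumes "Re s > kappa" "A \<subseteq> {1..}"
  shows "(\<lambda>n. norm (dterm k s n)) summable_on A"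
proof -
  have "(\<lambda>n. norm (dterm k s n)) summable_on A \<longleftrightarrow> rterm k (Re s) summable_on A"
    using assms(2) by (intro summable_on_cong) (auto simp: norm_dterm)
  then show ?thesis using rterm_summable[OF assms(1)] by blast
qed

lemma dterm_holomorphic:
  "n \<ge> 1 \<Longrightarrow> (\<lambda>s. dterm k s n) holomorphic_on A"
  unfolding dterm_def by (intro holomorphic_intros) (auto simp del: of_nat_add)

text \<open>The Weierstrass M-test makes the net of finite partial sums converge uniformly on a
  closed disc around each point, and holomorphy passes to uniform limits.\<close>

lemma holomorphic_on_infsum:
  fixes g :: "'a \<Rightarrow> complex \<Rightarrow> complex"
  assumes hol: "\<And>n. n \<in> I \<Longrightarrow> g n holomorphic_on A" and A: "open A"
    and bound: "\<And>z. z \<in> A \<Longrightarrow> \<exists>r>0. \<exists>M. cball z r \<subseteq> A \<and> M summable_on I \<and> (\<forall>n\<in>I. \<forall>w\<in>cball z r. norm (g n w) \<le> M n)"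
  shows "(\<lambda>z. \<Sum>\<^sub>\<infinity>n\<in>I. g n z) holomorphic_on A"
proof (rule holomorphic_on_subset[of _ A])
  have "(\<lambda>z. \<Sum>\<^sub>\<infinity>n\<in>I. g n z) analytic_on A"
    unfolding analytic_on_def
  proof
    fix z assume z: "z \<in> A"
    obtain r M where r: "r > 0" "cball z r \<subseteq> A" "M summable_on I"
      "\<And>n w. n \<in> I \<Longrightarrow> w \<in> cball z r \<Longrightarrow> norm (g n w) \<le> M n"
      using bound[OF z] by blast
    have ul: "uniform_limit (cball z r) (\<lambda>X y. \<Sum>n\<in>X. g n y) (\<lambda>y. \<Sum>\<^sub>\<infinity>n\<in>I. g n y) (finite_subsets_at_top I)"
      by (rule Weierstrass_m_test_general[OF r(4) r(3)])
    have ev: "eventually (\<lambda>X. continuous_on (cball z r) (\<lambda>y. \<Sum>n\<in>X. g n y) \<and>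
        (\<lambda>y. \<Sum>n\<in>X. g n y) holomorphic_on ball z r) (finite_subsets_at_top I)"
    proof (rule eventually_finite_subsets_at_top_weakI)
      fix X assume X: "finite X" "X \<subseteq> I"
      have "(\<lambda>y. \<Sum>n\<in>X. g n y) holomorphic_on A"
        using X hol by (intro holomorphic_on_sum) auto
      then show "continuous_on (cball z r) (\<lambda>y. \<Sum>n\<in>X. g n y) \<and> (\<lambda>y. \<Sum>n\<in>X. g n y) holomorphic_on ball z r"
        using r(2) ball_subset_cball[of z r]
        by (meson continuous_on_subset holomorphic_on_imp_continuous_on holomorphic_on_subset order.trans)
    qed
    have "(\<lambda>z. \<Sum>\<^sub>\<infinity>n\<in>I. g n z) holomorphic_on ball z r"
      by (rule holomorphic_uniform_limit[OF ev ul]) auto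
    then show "\<exists>e>0. (\<lambda>z. \<Sum>\<^sub>\<infinity>n\<in>I. g n z) holomorphic_on ball z e" using r(1) by blast
  qed
  then show "(\<lambda>z. \<Sum>\<^sub>\<infinity>n\<in>I. g n z) holomorphic_on A" by (rule analytic_imp_holomorphic)
qed simp

lemma dirichlet_holomorphic:
  assumes "\<eta> \<ge> 1"
  shows "dirichlet \<eta> k holomorphic_on {s. Re s > kappa}"
  unfolding dirichlet_def[abs_def]
proof (rule holomorphic_on_infsum)
  show "(\<lambda>s. dterm k s n) holomorphic_on {s. kappa < Re s}" if "n \<in> {\<eta>..}" for n
    using that assms by (intro dterm_holomorphic) auto
  show "open {s. kappa < Re s}" by (rule open_halfspace_Re_gt)
  fix z assume "z \<in> {s. kappa < Re s}"
  then have z: "Re z > kappa" by simp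
  define r where "r = (Re z - kappa) / 2"
  have r: "r > 0" "Re z - r > kappa" using z by (auto simp: r_def field_simps)
  have w: "Re w \<ge> Re z - r" if "w \<in> cball z r" for w
    using that abs_Re_le_cmod[of "z - w"] by (auto simp: dist_norm)
  show "\<exists>r>0. \<exists>M. cball z r \<subseteq> {s. kappa < Re s} \<and> M summable_on {\<eta>..} \<and>
      (\<forall>n\<in>{\<eta>..}. \<forall>w\<in>cball z r. norm (dterm k w n) \<le> M n)"
  proof (intro exI conjI ballI)
    show "r > 0" by (rule r)
    show "cball z r \<subseteq> {s. kappa < Re s}" using w r by force
    show "rterm k (Re z - r) summable_on {\<eta>..}" using r by (intro rterm_summable)
    fix n w' assume n: "n \<in> {\<eta>..}" "w' \<in> cball z r"
    have "real (4 * n + k) powr (Re z - r) \<le> real (4 * n + k) powr Re w'"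
      using w[OF n(2)] n(1) assms by (intro powr_mono) auto
    then have "rterm k (Re w') n \<le> rterm k (Re z - r) n"
      unfolding rterm_def using n assms by (intro divide_left_mono) auto
    then show "norm (dterm k w' n) \<le> rterm k (Re z - r) n"
      using n assms by (subst norm_dterm) auto
  qed
qed

text \<open>All bases 4 * m + k are at least 4, so each unit in the exponent beyond 2 gains a factor
  1/4. The reference exponent is 2 > \<open>kappa\<close>; it uses up one of the n units, and the
  factor 4 in S compensates for that.\<close>

lemma dirichlet_shift_bound:
  assumes "\<eta> \<ge> 1"
  shows "\<exists>S\<ge>0. \<forall>s n. Re s \<ge> 1 \<longrightarrow> n \<ge> 1 \<longrightarrow> norm (dirichlet \<eta> k (s + of_nat n)) \<le> S * (1 / 4) ^ n"
proof -
  define S where "S = 4 * infsum (rterm k 2) {\<eta>..}"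
  have sum2: "rterm k 2 summable_on {\<eta>..}" by (rule rterm_summable[OF kappa_lt_2])
  have S0: "S \<ge> 0" unfolding S_def by (intro mult_nonneg_nonneg infsum_nonneg rterm_nonneg) auto
  have "norm (dirichlet \<eta> k (s + of_nat n)) \<le> S * (1 / 4) ^ n" if s: "Re s \<ge> 1" and n: "n \<ge> 1" for s n
  proof -
    obtain n' where n': "n = Suc n'" using n by (cases n) auto
    have R: "Re (s + of_nat n) > kappa" using s n kappa_lt_2 by simp
    have abs: "(\<lambda>m. norm (dterm k (s + of_nat n) m)) summable_on {\<eta>..}"
      using assms by (intro dterm_abs_summable[OF R]) auto
    have "norm (dirichlet \<eta> k (s + of_nat n)) \<le> (\<Sum>\<^sub>\<infinity>m\<in>{\<eta>..}. norm (dterm k (s + of_nat n) m))"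
      unfolding dirichlet_def by (rule norm_infsum_bound[OF abs])
    also have "\<dots> \<le> (\<Sum>\<^sub>\<infinity>m\<in>{\<eta>..}. (1 / 4) ^ n' * rterm k 2 m)"
    proof (rule infsum_mono[OF abs summable_on_cmult_right[OF sum2]])
      fix m assume m: "m \<in> {\<eta>..}"
      have x: "real (4 * m + k) \<ge> 4" using m assms by simp
      have "4 ^ n' * real (4 * m + k) powr 2 \<le> real (4 * m + k) ^ n' * real (4 * m + k) powr 2"
        using x by (intro mult_right_mono power_mono) auto
      also have "\<dots> = real (4 * m + k) powr (2 + real n')"
        using x by (simp add: powr_add powr_realpow mult.commute)
      also have "\<dots> \<le> real (4 * m + k) powr Re (s + of_nat n)"
        using x s by (intro powr_mono) (auto simp: n')
      finally have "real (f (4 * m + k)) / real (4 * m + k) powr Re (s + of_nat n) \<le>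
          real (f (4 * m + k)) / (4 ^ n' * real (4 * m + k) powr 2)"
        using x by (intro divide_left_mono) auto
      then have "rterm k (Re (s + of_nat n)) m \<le> (1 / 4) ^ n' * rterm k 2 m"
        unfolding rterm_def by (simp add: power_divide)
      then show "norm (dterm k (s + of_nat n) m) \<le> (1 / 4) ^ n' * rterm k 2 m"
        using m assms by (subst norm_dterm) auto
    qed
    also have "\<dots> = S * (1 / 4) ^ n" by (simp add: S_def infsum_cmult_right' n')
    finally show ?thesis .
  qed
  then show ?thesis using S0 by blast
qed

text \<open>Each factor satisfies |a - i| <= R + i = |- R - i|. This gives a majorant uniform in a
  disc of parameters.\<close>

lemma norm_gbinomial_le:
  fixes a :: complex
  assumes "norm a \<le> R"
  shows "norm (a gchoose n) \<le> \<bar>(- R) gchoose n\<bar>"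
proof -
  have "norm (\<Prod>i = 0..<n. a - of_nat i) \<le> (\<Prod>i = 0..<n. R + real i)"
    unfolding prod_norm[symmetric]
  proof (intro prod_mono conjI)
    fix i
    show "norm (a - of_nat i) \<le> R + real i"
      using norm_triangle_ineq4[of a "of_nat i"] assms by simp
  qed auto
  also have "\<dots> = \<bar>\<Prod>i = 0..<n. - R - real i\<bar>"
  proof -
    have "\<bar>\<Prod>i = 0..<n. - R - real i\<bar> = (\<Prod>i = 0..<n. \<bar>- R - real i\<bar>)" by (rule abs_prod)
    also have "\<dots> = (\<Prod>i = 0..<n. R + real i)"
      using order.trans[OF norm_ge_zero assms] by (intro prod.cong) auto
    finally show ?thesis by simp
  qed
  finally show ?thesis
    by (simp add: gbinomial_prod_rev norm_divide divide_right_mono del: prod_norm)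
qed

text \<open>7/8 is the product of the bound 7/2 from \<open>shift_bound\<close> and the decay 1/4
  from \<open>dirichlet_shift_bound\<close>; it lies inside the unit disc, where the binomial series
  converges.\<close>

lemma summable_gbinomial_powers:
  fixes R :: real
  shows "summable (\<lambda>n. \<bar>(- R) gchoose n\<bar> * (7 / 8) ^ n)"
proof -
  have "ereal (norm (7 / 8 :: real)) < conv_radius (\<lambda>n. (- R) gchoose n)"
    by (simp add: conv_radius_gchoose)
  from abs_summable_in_conv_radius[OF this] show ?thesis by (simp add: abs_mult power_abs)
qed

lemma shift_bound:
  assumes "j < 8" "k < 4"
  shows "norm (of_nat j / 2 - of_nat k :: complex) \<le> 7 / 2"
proof -
  have "of_nat j / 2 - of_nat k = complex_of_real (real j / 2 - real k)" by simp
  then have "norm (of_nat j / 2 - of_nat k :: complex) = \<bar>real j / 2 - real k\<bar>"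
    by (simp only: norm_of_real)
  also have "\<dots> \<le> 7 / 2"
  proof -
    have "real j \<le> 7" "real k \<le> 3" using assms by auto
    then show ?thesis unfolding abs_le_iff by auto
  qed
  finally show ?thesis .
qed

section \<open>The correction series in \<open>G\<close>\<close>

definition gpart :: "nat \<Rightarrow> nat \<Rightarrow> nat \<Rightarrow> complex \<Rightarrow> nat \<Rightarrow> complex" where
  "gpart \<eta> j k s n = ((- s) gchoose n) * (of_nat j / 2 - of_nat k) ^ n * dirichlet \<eta> k (s + of_nat n)"

lemma gterm_eq: "gterm \<eta> j k s n = c j k * gpart \<eta> j k s n + c (j + 4) k * gpart \<eta> (j + 4) k s n"
  by (simp add: gterm_def gpart_def algebra_simps)

text \<open>M is uniform over bounded s with Re s >= 1, so it yields both summability and the local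
  majorant needed for holomorphy.\<close>

lemma gpart_bound:
  assumes "\<eta> \<ge> 1" "j < 8" "k < 4"
  shows "\<exists>M. M summable_on {1..} \<and> (\<forall>n\<in>{1..}. \<forall>s. Re s \<ge> 1 \<longrightarrow> norm s \<le> R \<longrightarrow> norm (gpart \<eta> j k s n) \<le> M n)"
proof -
  obtain S where S: "S \<ge> 0"
    "\<And>s n. Re s \<ge> 1 \<Longrightarrow> n \<ge> 1 \<Longrightarrow> norm (dirichlet \<eta> k (s + of_nat n)) \<le> S * (1 / 4) ^ n"
    using dirichlet_shift_bound[OF assms(1)] by blast
  define M where "M n = S * (\<bar>(- R) gchoose n\<bar> * (7 / 8) ^ n)" for n
  have "summable M" unfolding M_def by (intro summable_mult summable_gbinomial_powers)
  then have "M summable_on UNIV"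
    using S(1) by (subst summable_on_UNIV_nonneg_real_iff) (auto simp: M_def)
  then have "M summable_on {1..}" by (rule summable_on_subset_banach) auto
  moreover have "norm (gpart \<eta> j k s n) \<le> M n" if "n \<in> {1..}" "Re s \<ge> 1" "norm s \<le> R" for s n
  proof -
    have "norm (gpart \<eta> j k s n) =
        norm ((- s) gchoose n) * norm (of_nat j / 2 - of_nat k :: complex) ^ n * norm (dirichlet \<eta> k (s + of_nat n))"
      by (simp add: gpart_def norm_mult norm_power)
    also have "\<dots> \<le> \<bar>(- R) gchoose n\<bar> * (7 / 2) ^ n * (S * (1 / 4) ^ n)"
      using that S assms shift_bound[of j k]
      by (intro mult_mono norm_gbinomial_le power_mono) auto
    also have "\<dots> = M n" by (simp add: M_def power_divide power_mult_distrib[symmetric])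
    finally show ?thesis .
  qed
  ultimately show ?thesis by blast
qed

lemma gpart_summable:
  assumes "\<eta> \<ge> 1" "j < 8" "k < 4" "Re s \<ge> 1"
  shows "gpart \<eta> j k s summable_on {1..}"
proof -
  obtain M where M: "M summable_on {1..}" "\<And>n. n \<in> {1..} \<Longrightarrow> norm (gpart \<eta> j k s n) \<le> M n"
    using gpart_bound[OF assms(1-3), of "norm s"] assms(4) by blast
  show ?thesis
    by (rule abs_summable_summable, rule Infinite_Sum.abs_summable_on_comparison_test'[OF M])
qed

lemma gpart_infsum_holomorphic:
  assumes "\<eta> \<ge> 1" "j < 8" "k < 4"
  shows "(\<lambda>s. \<Sum>\<^sub>\<infinity>n\<in>{1..}. gpart \<eta> j k s n) holomorphic_on {s. Re s > 1}"
proof (rule holomorphic_on_infsum)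
  show "(\<lambda>s. gpart \<eta> j k s n) holomorphic_on {s. 1 < Re s}" if "n \<in> {1..}" for n
  proof -
    have "(dirichlet \<eta> k \<circ> (\<lambda>s. s + of_nat n)) holomorphic_on {s. 1 < Re s}"
      using that kappa_lt_2
      by (intro holomorphic_on_compose_gen[OF _ dirichlet_holomorphic[OF assms(1)]] holomorphic_intros) auto
    then show ?thesis
      unfolding gpart_def gbinomial_prod_rev o_def by (intro holomorphic_intros) auto
  qed
  show "open {s. 1 < Re s}" by (rule open_halfspace_Re_gt)
  fix z assume "z \<in> {s. 1 < Re s}"
  then have z: "Re z > 1" by simp
  define r where "r = (Re z - 1) / 2"
  have r: "r > 0" "Re z - r > 1" using z by (auto simp: r_def field_simps)
  have w: "Re w > 1" "norm w \<le> norm z + r" if "w \<in> cball z r" for w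
  proof -
    show "Re w > 1" using that abs_Re_le_cmod[of "z - w"] r by (auto simp: dist_norm)
    show "norm w \<le> norm z + r" using that norm_triangle_ineq2[of w z] by (auto simp: dist_norm norm_minus_commute)
  qed
  obtain M where M: "M summable_on {1..}"
    "\<And>n s. n \<in> {1..} \<Longrightarrow> Re s \<ge> 1 \<Longrightarrow> norm s \<le> norm z + r \<Longrightarrow> norm (gpart \<eta> j k s n) \<le> M n"
    using gpart_bound[OF assms, of "norm z + r"] by blast
  show "\<exists>r>0. \<exists>M. cball z r \<subseteq> {s. 1 < Re s} \<and> M summable_on {1..} \<and>
      (\<forall>n\<in>{1..}. \<forall>w\<in>cball z r. norm (gpart \<eta> j k w n) \<le> M n)"
  proof (intro exI[of _ r] exI[of _ M] conjI ballI)
    show "cball z r \<subseteq> {s. 1 < Re s}" using w(1) by blast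
    show "norm (gpart \<eta> j k w n) \<le> M n" if "n \<in> {1..}" "w \<in> cball z r" for n w
      using M(2)[OF that(1)] w[OF that(2)] by simp
  qed (use r M in auto)
qed

lemma gterm_summable:
  assumes "\<eta> \<ge> 1" "j < 4" "k < 4" "Re s \<ge> 1"
  shows "gterm \<eta> j k s summable_on {1..}"
  unfolding gterm_eq[abs_def] using assms by (intro summable_on_add summable_on_cmult_right gpart_summable) auto

lemma infsum_gterm:
  assumes "\<eta> \<ge> 1" "j < 4" "k < 4" "Re s \<ge> 1"
  shows "(\<Sum>\<^sub>\<infinity>n\<in>{1..}. gterm \<eta> j k s n) = c j k * (\<Sum>\<^sub>\<infinity>n\<in>{1..}. gpart \<eta> j k s n) +
    c (j + 4) k * (\<Sum>\<^sub>\<infinity>n\<in>{1..}. gpart \<eta> (j + 4) k s n)"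
  unfolding gterm_eq using assms
  by (subst infsum_add) (auto intro!: summable_on_cmult_right gpart_summable simp: infsum_cmult_right' simp del: One_nat_def)

lemma G_analytic:
  assumes "\<eta> \<ge> 1" "j < 4"
  shows "G \<eta> j analytic_on {s. Re s > 1}"
proof -
  have "(\<lambda>s. 2 powr (- s) * (\<Sum>k<4. c j k * (\<Sum>\<^sub>\<infinity>n\<in>{1..}. gpart \<eta> j k s n) +
    c (j + 4) k * (\<Sum>\<^sub>\<infinity>n\<in>{1..}. gpart \<eta> (j + 4) k s n)) +
    (\<Sum>n\<in>{\<eta>..<2 * \<eta>}. dterm j s n)) holomorphic_on {s. Re s > 1}"
    using assms by (intro holomorphic_intros gpart_infsum_holomorphic dterm_holomorphic) auto
  then have "G \<eta> j holomorphic_on {s. Re s > 1}"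
    by (rule holomorphic_transform) (use assms in \<open>simp add: G_def infsum_gterm del: One_nat_def\<close>)
  then show ?thesis by (simp add: analytic_on_open open_halfspace_Re_gt)
qed

section \<open>The functional equation\<close>

lemma f_rec_c:
  assumes "n \<ge> 3" "j < 8"
  shows "of_nat (f (8 * n + j)) = (\<Sum>k<4. c j k * of_nat (f (4 * n + k)))"
proof -
  have i: "of_nat (a + b) = (of_nat d :: complex)" if "a + b = d" for a b d :: nat
    using that by simp
  note r = f_rec[OF assms(1)]
  have r3: "of_nat (f (8 * n + 3)) = (of_nat (f (4 * n + 2)) - of_nat (f (4 * n + 1)) :: complex)"
    using i[OF r(4)] by (simp add: algebra_simps)
  have r6: "of_nat (f (8 * n + 6)) = (of_nat (f (4 * n + 2)) + of_nat (f (4 * n + 3)) - of_nat (f (4 * n + 1)) :: complex)"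
    using i[OF r(7)] by (simp add: algebra_simps)
  have s: "(\<Sum>k<4. g k) = g 0 + g 1 + g 2 + g 3" for g :: "nat \<Rightarrow> complex"
    by (simp add: eval_nat_numeral)
  from assms(2) consider "j = 0" | "j = 1" | "j = 2" | "j = 3" | "j = 4" | "j = 5" | "j = 6" | "j = 7"
    by linarith
  then show ?thesis
    by cases (simp_all only: s, simp_all only: r r3 r6, simp_all add: c_def r r3 r6 del: One_nat_def)
qed

definition bterm :: "nat \<Rightarrow> nat \<Rightarrow> complex \<Rightarrow> nat \<Rightarrow> nat \<Rightarrow> complex" where
  "bterm j k s n m = ((- s) gchoose m) * (of_nat j / 2 - of_nat k) ^ m * dterm k (s + of_nat m) n"

text \<open>The binomial expansion of \<open>(8 * n + j) powr (- s)\<close> around \<open>8 * n + 2 * k = 2 * (4 * n + k)\<close>.\<close>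

lemma bterm_sums:
  assumes "n \<ge> 1" "j < 8" "k < 4"
  shows "bterm j k s n sums (2 powr s * (of_nat (f (4 * n + k)) / of_nat (8 * n + j) powr s))"
proof -
  define x where "x = real (4 * n + k)"
  define a where "a = real j / 2 - real k"
  have ca: "complex_of_real a = of_nat j / 2 - of_nat k" by (simp add: a_def)
  have cx: "complex_of_real x = of_nat (4 * n + k)" by (simp add: x_def)
  have "norm (complex_of_real a) \<le> 7 / 2" unfolding ca by (rule shift_bound[OF assms(2,3)])
  then have a: "\<bar>a\<bar> \<le> 7 / 2" by simp
  have x: "x \<ge> 4" using assms(1) by (simp add: x_def)
  have "(\<lambda>m. ((- s) gchoose m) * complex_of_real x powr (- s - of_nat m) * complex_of_real a ^ m) sums
    complex_of_real (x + a) powr (- s)"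
    using a x by (intro gen_binomial_complex'') auto
  then have "(\<lambda>m. of_nat (f (4 * n + k)) * (((- s) gchoose m) * complex_of_real x powr (- s - of_nat m) * complex_of_real a ^ m)) sums
    (of_nat (f (4 * n + k)) * complex_of_real (x + a) powr (- s))"
    by (rule sums_mult)
  moreover have "of_nat (f (4 * n + k)) * (((- s) gchoose m) * complex_of_real x powr (- s - of_nat m) * complex_of_real a ^ m) =
      bterm j k s n m" for m
  proof -
    have "complex_of_real x powr (- s - of_nat m) = inverse (complex_of_real x powr (s + of_nat m))"
      by (simp flip: powr_minus)
    then show ?thesis
      unfolding bterm_def dterm_def cx[symmetric] ca[symmetric] by (simp add: divide_inverse mult_ac)
  qed
  moreover have "complex_of_real (x + a) powr (- s) = 2 powr s / of_nat (8 * n + j) powr s"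
  proof -
    have "of_nat (8 * n + j) = complex_of_real 2 * complex_of_real (x + a)"
      by (simp add: x_def a_def)
    then have "of_nat (8 * n + j) powr s = complex_of_real 2 powr s * complex_of_real (x + a) powr s"
      using a x by (simp only:) (rule powr_times_real; auto)
    moreover have "x + a \<noteq> 0" using a x by linarith
    ultimately show ?thesis by (simp add: powr_minus divide_inverse del: of_real_add)
  qed
  ultimately show ?thesis by (simp add: mult_ac)
qed

text \<open>The majorant is a function of n times a function of m, so absolute summability of the
  double series reduces to two single series.\<close>

lemma norm_bterm_le:
  assumes "n \<ge> 1" "j < 8" "k < 4"
  shows "norm (bterm j k s n m) \<le> rterm k (Re s) n * (\<bar>(- norm s) gchoose m\<bar> * (7 / 8) ^ m)"
proof -
  have x: "real (4 * n + k) \<ge> 4" using assms(1) by simp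
  have "norm (dterm k (s + of_nat m) n) = rterm k (Re s) n / real (4 * n + k) ^ m"
    using assms(1) x by (simp add: norm_dterm rterm_def powr_add powr_realpow)
  also have "\<dots> \<le> rterm k (Re s) n / 4 ^ m"
    using x by (intro divide_left_mono power_mono rterm_nonneg) auto
  finally have "norm (bterm j k s n m) \<le> \<bar>(- norm s) gchoose m\<bar> * (7 / 2) ^ m * (rterm k (Re s) n / 4 ^ m)"
    unfolding bterm_def norm_mult norm_power using assms shift_bound[of j k]
    by (intro mult_mono norm_gbinomial_le power_mono) (auto simp: rterm_nonneg)
  also have "\<dots> = rterm k (Re s) n * (\<bar>(- norm s) gchoose m\<bar> * ((7 / 2) ^ m / 4 ^ m))" by simp
  also have "(7 / 2) ^ m / 4 ^ m = ((7 / 8) ^ m :: real)" by (simp add: power_divide[symmetric])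
  finally show ?thesis .
qed

lemma bterm_summable_UNIV:
  assumes "n \<ge> 1" "j < 8" "k < 4"
  shows "summable (\<lambda>m. norm (bterm j k s n m))"
proof (rule summable_comparison_test)
  show "summable (\<lambda>m. rterm k (Re s) n * (\<bar>(- norm s) gchoose m\<bar> * (7 / 8) ^ m))"
    by (intro summable_mult summable_gbinomial_powers)
qed (use norm_bterm_le[OF assms] in auto)

lemma bterm_infsum:
  assumes "n \<ge> 1" "j < 8" "k < 4"
  shows "infsum (bterm j k s n) UNIV = 2 powr s * (of_nat (f (4 * n + k)) / of_nat (8 * n + j) powr s)"
  by (rule infsumI, rule norm_summable_imp_has_sum[OF bterm_summable_UNIV[OF assms] bterm_sums[OF assms]])

lemma bterm_summable_prod:
  assumes "\<eta> \<ge> 1" "j < 8" "k < 4" "Re s > kappa"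
  shows "(\<lambda>(n, m). bterm j k s n m) summable_on {\<eta>..} \<times> UNIV"
proof -
  define g where "g m = \<bar>(- norm s) gchoose m\<bar> * (7 / 8) ^ m" for m
  have g0: "g m \<ge> 0" for m by (simp add: g_def)
  have g: "g summable_on UNIV"
    using summable_gbinomial_powers[of "norm s"] g0 unfolding g_def
    by (subst summable_on_UNIV_nonneg_real_iff) auto
  have r: "rterm k (Re s) summable_on {\<eta>..}" by (rule rterm_summable[OF assms(4)])
  have n: "norm (rterm k (Re s) n * g m) = rterm k (Re s) n * g m" for n m
    using g0 rterm_nonneg by simp
  have "(\<lambda>p. norm (case p of (n, m) \<Rightarrow> rterm k (Re s) n * g m)) summable_on {\<eta>..} \<times> UNIV"
    unfolding Infinite_Sum.abs_summable_on_Sigma_iff prod.case n infsum_cmult_right'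
    using g r g0 by (auto intro!: summable_on_cmult_right summable_on_cmult_left infsum_nonneg simp: abs_mult rterm_nonneg)
  then have "(\<lambda>p. norm (case p of (n, m) \<Rightarrow> bterm j k s n m)) summable_on {\<eta>..} \<times> UNIV"
  proof (rule Infinite_Sum.abs_summable_on_comparison_test)
    fix p :: "nat \<times> nat" assume "p \<in> {\<eta>..} \<times> UNIV"
    then obtain n m where p: "p = (n, m)" "n \<ge> 1" using assms(1) by force
    show "norm (case p of (n, m) \<Rightarrow> bterm j k s n m) \<le> norm (case p of (n, m) \<Rightarrow> rterm k (Re s) n * g m)"
      using norm_bterm_le[OF p(2) assms(2,3), of s m] rterm_nonneg[of k "Re s" n]
      by (simp add: p g_def abs_mult)
  qed
  then show ?thesis by (rule abs_summable_summable)
qed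

text \<open>Interchanging the absolutely convergent double sum turns the inner sum over n into a
  shifted Dirichlet series. The term m = 0 is \<open>dirichlet\<close> itself, and the others form
  the correction.\<close>

lemma expanded_dirichlet:
  assumes "\<eta> \<ge> 1" "j < 8" "k < 4" "Re s > kappa"
  shows "(\<lambda>n. of_nat (f (4 * n + k)) / of_nat (8 * n + j) powr s) summable_on {\<eta>..}"
    "(\<Sum>\<^sub>\<infinity>n\<in>{\<eta>..}. of_nat (f (4 * n + k)) / of_nat (8 * n + j) powr s) =
      2 powr (- s) * (dirichlet \<eta> k s + (\<Sum>\<^sub>\<infinity>m\<in>{1..}. gpart \<eta> j k s m))"
proof -
  define h where "h n = of_nat (f (4 * n + k)) / of_nat (8 * n + j) powr s" for n
  have two: "2 powr s \<noteq> 0" by simp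
  note S = bterm_summable_prod[OF assms]
  have inner: "infsum (bterm j k s n) UNIV = 2 powr s * h n" if "n \<in> {\<eta>..}" for n
    using that assms unfolding h_def by (intro bterm_infsum) auto
  have "(\<lambda>n. infsum (bterm j k s n) UNIV) summable_on {\<eta>..}"
    using summable_on_Sigma_banach[OF S] by simp
  then have "(\<lambda>n. 2 powr s * h n) summable_on {\<eta>..}"
    by (subst (asm) summable_on_cong[OF inner]) auto
  from summable_on_cmult_right[OF this, of "inverse (2 powr s)"]
  show "h summable_on {\<eta>..}" by (simp add: mult.assoc[symmetric])
  have outer: "(\<Sum>\<^sub>\<infinity>n\<in>{\<eta>..}. bterm j k s n m) = gpart \<eta> j k s m" for m
    unfolding bterm_def gpart_def dirichlet_def by (rule infsum_cmult_right')
  have "2 powr s * infsum h {\<eta>..} = (\<Sum>\<^sub>\<infinity>n\<in>{\<eta>..}. infsum (bterm j k s n) UNIV)"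
    by (subst infsum_cmult_right'[symmetric]) (intro infsum_cong, simp add: inner)
  also have "\<dots> = (\<Sum>\<^sub>\<infinity>m\<in>UNIV. gpart \<eta> j k s m)"
    by (subst infsum_swap_banach[OF S]) (simp add: outer)
  also have "UNIV = {0} \<union> {1::nat..}" by auto
  also have "infsum (gpart \<eta> j k s) ({0} \<union> {1..}) = infsum (gpart \<eta> j k s) {0} + infsum (gpart \<eta> j k s) {1..}"
    using assms kappa_gt_1 by (intro infsum_Un_disjoint gpart_summable) auto
  also have "infsum (gpart \<eta> j k s) {0} = dirichlet \<eta> k s" by (simp add: gpart_def)
  finally have "2 powr (- s) * (2 powr s * infsum h {\<eta>..}) =
    2 powr (- s) * (dirichlet \<eta> k s + infsum (gpart \<eta> j k s) {1..})" by (simp only:)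
  moreover have "2 powr (- s) * (2 powr s * infsum h {\<eta>..}) = infsum h {\<eta>..}"
    by (simp add: powr_minus)
  ultimately show "infsum h {\<eta>..} = 2 powr (- s) * (dirichlet \<eta> k s + (\<Sum>\<^sub>\<infinity>m\<in>{1..}. gpart \<eta> j k s m))"
    by simp
qed

lemma infsum_even_odd:
  fixes g :: "nat \<Rightarrow> complex"
  assumes "(\<lambda>n. g (2 * n)) summable_on {\<eta>..}" "(\<lambda>n. g (2 * n + 1)) summable_on {\<eta>..}"
  shows "infsum g {2 * \<eta>..} = (\<Sum>\<^sub>\<infinity>n\<in>{\<eta>..}. g (2 * n)) + (\<Sum>\<^sub>\<infinity>n\<in>{\<eta>..}. g (2 * n + 1))"
proof -
  have i: "inj_on ((*) 2) {\<eta>..}" "inj_on (\<lambda>n. 2 * n + 1) {\<eta>..}" by (auto simp: inj_on_def)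
  have "{2 * \<eta>..} = (*) 2 ` {\<eta>..} \<union> (\<lambda>n. 2 * n + 1) ` {\<eta>..}"
  proof (intro equalityI subsetI)
    fix n assume "n \<in> {2 * \<eta>..}"
    then show "n \<in> (*) 2 ` {\<eta>..} \<union> (\<lambda>n. 2 * n + 1) ` {\<eta>..}"
      by (cases "even n") (auto elim!: evenE oddE simp: image_iff)
  qed auto
  moreover have "(*) 2 ` {\<eta>..} \<inter> (\<lambda>n. 2 * n + 1) ` {\<eta>..} = {}" by auto presburger
  ultimately have "infsum g {2 * \<eta>..} = infsum g ((*) 2 ` {\<eta>..}) + infsum g ((\<lambda>n. 2 * n + 1) ` {\<eta>..})"
    using assms i by (simp only:) (intro infsum_Un_disjoint; simp add: summable_on_reindex o_def)
  then show ?thesis using i by (simp add: infsum_reindex o_def)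
qed

lemma dirichlet_split:
  assumes "\<eta> \<ge> 1" "Re s > kappa" "\<eta> \<le> \<eta>'"
  shows "dirichlet \<eta> j s = (\<Sum>n\<in>{\<eta>..<\<eta>'}. dterm j s n) + dirichlet \<eta>' j s"
proof -
  have "dterm j s summable_on A" if "A \<subseteq> {1..}" for A
    using dterm_abs_summable[OF assms(2) that] by (rule abs_summable_summable)
  then have "infsum (dterm j s) ({\<eta>..<\<eta>'} \<union> {\<eta>'..}) = infsum (dterm j s) {\<eta>..<\<eta>'} + infsum (dterm j s) {\<eta>'..}"
    using assms by (intro infsum_Un_disjoint) auto
  moreover have "{\<eta>..<\<eta>'} \<union> {\<eta>'..} = {\<eta>..}" using assms(3) by auto
  ultimately show ?thesis by (simp add: dirichlet_def)
qed

lemma has_sum_sum: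
  fixes h :: "'a \<Rightarrow> 'b \<Rightarrow> complex"
  assumes "finite K" "\<And>k. k \<in> K \<Longrightarrow> (h k has_sum S k) A"
  shows "((\<lambda>x. \<Sum>k\<in>K. h k x) has_sum (\<Sum>k\<in>K. S k)) A"
  using assms by (induction K rule: finite_induct) (auto intro!: has_sum_add)

text \<open>The recurrences, valid for n >= \<eta> >= 3, describe the terms from 2 * \<eta> on, with
  rows j and j + 4 for even and odd index. The terms from \<eta> to 2 * \<eta> - 1 are not reached
  and form the finite sum in \<open>G\<close>.\<close>

lemma dirichlet_functional_equation:
  assumes "\<eta> \<ge> 3" "j < 4" "Re s > kappa"
  shows "dirichlet \<eta> j s = 2 powr (- s) * (\<Sum>k<4. (c j k + c (j + 4) k) * dirichlet \<eta> k s) + G \<eta> j s"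
proof -
  have \<eta>: "\<eta> \<ge> 1" using assms by simp
  define h where "h i k n = of_nat (f (4 * n + k)) / of_nat (8 * n + i) powr s" for i k n
  have hs: "h i k summable_on {\<eta>..}" if "i < 8" "k < 4" for i k
    unfolding h_def using expanded_dirichlet(1)[OF \<eta> that assms(3)] .
  have hi: "infsum (h i k) {\<eta>..} = 2 powr (- s) * (dirichlet \<eta> k s + (\<Sum>\<^sub>\<infinity>m\<in>{1..}. gpart \<eta> i k s m))"
    if "i < 8" "k < 4" for i k
    unfolding h_def using expanded_dirichlet(2)[OF \<eta> that assms(3)] .
  have row: "of_nat (f (8 * n + i)) / of_nat (8 * n + i) powr s = (\<Sum>k<4. c i k * h i k n)"
    if "n \<in> {\<eta>..}" "i < 8" for i n
  proof -
    have "n \<ge> 3" using that assms by simp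
    then show ?thesis using f_rec_c[of n i] that(2)
      by (simp only: h_def sum_divide_distrib times_divide_eq_right)
  qed
  have hs: "((\<lambda>n. of_nat (f (8 * n + i)) / of_nat (8 * n + i) powr s) has_sum
    (\<Sum>k<4. c i k * (2 powr (- s) * (dirichlet \<eta> k s + (\<Sum>\<^sub>\<infinity>m\<in>{1..}. gpart \<eta> i k s m))))) {\<eta>..}"
    if i: "i < 8" for i
  proof (subst has_sum_cong[OF row[OF _ i]])
    show "((\<lambda>n. \<Sum>k<4. c i k * h i k n) has_sum
      (\<Sum>k<4. c i k * (2 powr (- s) * (dirichlet \<eta> k s + (\<Sum>\<^sub>\<infinity>m\<in>{1..}. gpart \<eta> i k s m))))) {\<eta>..}"
      using i by (intro has_sum_sum has_sum_cmult_right) (auto simp: has_sum_iff hs hi)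
  qed
  note rs = has_sum_imp_summable[OF hs] and ri = infsumI[OF hs]
  have e: "dterm j s (2 * n) = of_nat (f (8 * n + j)) / of_nat (8 * n + j) powr s"
    "dterm j s (2 * n + 1) = of_nat (f (8 * n + (j + 4))) / of_nat (8 * n + (j + 4)) powr s" for n
  proof -
    have "4 * (2 * n) + j = 8 * n + j" "4 * (2 * n + 1) + j = 8 * n + (j + 4)" by auto
    then show "dterm j s (2 * n) = of_nat (f (8 * n + j)) / of_nat (8 * n + j) powr s"
    "dterm j s (2 * n + 1) = of_nat (f (8 * n + (j + 4))) / of_nat (8 * n + (j + 4)) powr s"
      unfolding dterm_def by (simp_all only:)
  qed
  have "dirichlet (2 * \<eta>) j s = (\<Sum>k<4. c j k * (2 powr (- s) * (dirichlet \<eta> k s + (\<Sum>\<^sub>\<infinity>m\<in>{1..}. gpart \<eta> j k s m)))) +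
     (\<Sum>k<4. c (j + 4) k * (2 powr (- s) * (dirichlet \<eta> k s + (\<Sum>\<^sub>\<infinity>m\<in>{1..}. gpart \<eta> (j + 4) k s m))))"
    unfolding dirichlet_def[of "2 * \<eta>"]
  proof (subst infsum_even_odd)
    show "(\<lambda>n. dterm j s (2 * n)) summable_on {\<eta>..}" "(\<lambda>n. dterm j s (2 * n + 1)) summable_on {\<eta>..}"
      unfolding e using rs[of j] rs[of "j + 4"] assms(2) by auto
  qed (use assms(2) in \<open>simp only: e ri\<close>)
  also have "\<dots> = 2 powr (- s) * (\<Sum>k<4. (c j k + c (j + 4) k) * dirichlet \<eta> k s) +
     2 powr (- s) * (\<Sum>k<4. c j k * (\<Sum>\<^sub>\<infinity>m\<in>{1..}. gpart \<eta> j k s m) + c (j + 4) k * (\<Sum>\<^sub>\<infinity>m\<in>{1..}. gpart \<eta> (j + 4) k s m))"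
    unfolding sum_distrib_left sum.distrib[symmetric]
    by (intro sum.cong refl) (simp add: algebra_simps)
  also have "(\<Sum>k<4. c j k * (\<Sum>\<^sub>\<infinity>m\<in>{1..}. gpart \<eta> j k s m) + c (j + 4) k * (\<Sum>\<^sub>\<infinity>m\<in>{1..}. gpart \<eta> (j + 4) k s m)) =
    (\<Sum>k<4. \<Sum>\<^sub>\<infinity>n\<in>{1..}. gterm \<eta> j k s n)"
    using \<eta> assms kappa_gt_1 by (intro sum.cong refl infsum_gterm[symmetric]) auto
  finally show ?thesis
    using dirichlet_split[of \<eta> s "2 * \<eta>" j] \<eta> assms(3) by (simp add: G_def)
qed

section \<open>Meromorphic continuation\<close>

text \<open>If x = z * (B0 + B1) x + g, pairing with the left eigenvector (0, 1, 1, r) for 1 + r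
  shows that x 1 + x 2 + r * x 3 equals this quotient.\<close>

definition eig :: "complex \<Rightarrow> complex \<Rightarrow> (nat \<Rightarrow> complex) \<Rightarrow> complex" where
  "eig r z g = (g 1 + g 2 + r * g 3) / (1 - (1 + r) * z)"

abbreviation rt3 :: complex where
  "rt3 \<equiv> complex_of_real (sqrt 3)"

lemma rt3_square: "rt3 * rt3 = 3"
  by (simp flip: of_real_mult)

text \<open>Solution of \<open>x = z * (B0 + B1) x + g\<close> by means of the left eigenvectors of \<open>B0 + B1\<close>.\<close>

definition solve :: "complex \<Rightarrow> (nat \<Rightarrow> complex) \<Rightarrow> nat \<Rightarrow> complex" where
  "solve z g j =
    (let p = eig rt3 z g; q = eig (- rt3) z g;
         one = (g 2 - 2 * g 1) / (1 - z); two = (g 0 - 2 * g 1 - 2 * g 3) / (1 - 2 * z);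
         x1 = ((p + q) / 2 - one) / 3; x2 = (p + q + one) / 3; x3 = (p - q) / (2 * rt3)
     in if j = 0 then two + 2 * x1 + 2 * x3 else if j = 1 then x1 else if j = 2 then x2 else x3)"

text \<open>The four denominators of \<open>solve\<close> are nonzero, that is, I - z * (B0 + B1) is
  invertible.\<close>

definition regular :: "complex \<Rightarrow> bool" where
  "regular z \<longleftrightarrow> (1 + rt3) * z \<noteq> 1 \<and> (1 - rt3) * z \<noteq> 1 \<and> z \<noteq> 1 \<and> 2 * z \<noteq> 1"

lemma sum_lessThan_4: "(\<Sum>k<4. g k) = g 0 + g 1 + g 2 + g 3" for g :: "nat \<Rightarrow> complex"
  by (simp add: eval_nat_numeral)

lemma row_sums:
  "(\<Sum>k<4. (c 0 k + c (0 + 4) k) * x k) = 2 * x 0 + 2 * x 2"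
  "(\<Sum>k<4. (c 1 k + c (1 + 4) k) * x k) = x 1 + x 3"
  "(\<Sum>k<4. (c 2 k + c (2 + 4) k) * x k) = x 2 + 2 * x 3"
  "(\<Sum>k<4. (c 3 k + c (3 + 4) k) * x k) = x 1 + x 2 + x 3"
  unfolding sum_lessThan_4 by (simp_all add: c_def del: One_nat_def)

lemma less_4_cases: "j < 4 \<Longrightarrow> j = 0 \<or> j = 1 \<or> j = 2 \<or> j = (3::nat)"
  by linarith

lemma solve_unique:
  assumes "regular z" and x: "\<And>j. j < 4 \<Longrightarrow> x j = z * (\<Sum>k<4. (c j k + c (j + 4) k) * x k) + g j"
    and "j < 4"
  shows "x j = solve z g j"
proof -
  have e: "x 0 = z * (2 * x 0 + 2 * x 2) + g 0" "x 1 = z * (x 1 + x 3) + g 1"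
    "x 2 = z * (x 2 + 2 * x 3) + g 2" "x 3 = z * (x 1 + x 2 + x 3) + g 3"
    using x[of 0] x[of 1] x[of 2] x[of 3] unfolding row_sums by auto
  then have g: "g 0 = x 0 - z * (2 * x 0 + 2 * x 2)" "g 1 = x 1 - z * (x 1 + x 3)"
    "g 2 = x 2 - z * (x 2 + 2 * x 3)" "g 3 = x 3 - z * (x 1 + x 2 + x 3)"
    by (simp_all only: eq_diff_eq add.commute)
  have p: "eig r z g = x 1 + x 2 + r * x 3" if "r * r = 3" "(1 + r) * z \<noteq> 1" for r
  proof -
    have r: "r * (r * y) = 3 * y" for y using that(1) by (simp only: mult.assoc[symmetric])
    have "(x 1 + x 2 + r * x 3) * (1 - (1 + r) * z) = g 1 + g 2 + r * g 3"
      unfolding g by (simp add: algebra_simps r del: One_nat_def)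
    then show ?thesis using that(2) by (simp add: eig_def nonzero_divide_eq_eq)
  qed
  have p1: "eig rt3 z g = x 1 + x 2 + rt3 * x 3" using assms(1) rt3_square by (intro p) (auto simp: regular_def)
  have p2: "eig (- rt3) z g = x 1 + x 2 + (- rt3) * x 3" using assms(1) rt3_square by (intro p) (auto simp: regular_def)
  have one: "(g 2 - 2 * g 1) / (1 - z) = x 2 - 2 * x 1"
  proof -
    have "(x 2 - 2 * x 1) * (1 - z) = g 2 - 2 * g 1" unfolding g by (simp add: algebra_simps del: One_nat_def)
    then show ?thesis using assms(1) by (simp add: regular_def nonzero_divide_eq_eq)
  qed
  have two: "(g 0 - 2 * g 1 - 2 * g 3) / (1 - 2 * z) = x 0 - 2 * x 1 - 2 * x 3"
  proof -
    have "(x 0 - 2 * x 1 - 2 * x 3) * (1 - 2 * z) = g 0 - 2 * g 1 - 2 * g 3"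
      unfolding g by (simp add: algebra_simps del: One_nat_def)
    then show ?thesis using assms(1) by (simp add: regular_def nonzero_divide_eq_eq)
  qed
  show ?thesis
    using less_4_cases[OF assms(3)] unfolding solve_def Let_def p1 p2 one two
    by (elim disjE) (simp_all add: field_simps del: One_nat_def)
qed

text \<open>\<open>solve_unique\<close> identifies the Dirichlet series to the right of
  \<open>kappa\<close>. To the left the equation cannot be read off the series and is checked on the
  formula.\<close>

lemma solve_solves:
  assumes "regular z" "j < 4"
  shows "solve z g j = z * (\<Sum>k<4. (c j k + c (j + 4) k) * solve z g k) + g j"
proof -
  define p q one two where "p = eig rt3 z g" and "q = eig (- rt3) z g" and
    "one = (g 2 - 2 * g 1) / (1 - z)" and "two = (g 0 - 2 * g 1 - 2 * g 3) / (1 - 2 * z)"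
  define x1 x2 x3 where "x1 = ((p + q) / 2 - one) / 3" and "x2 = (p + q + one) / 3" and "x3 = (p - q) / (2 * rt3)"
  have s: "solve z g 0 = two + 2 * x1 + 2 * x3" "solve z g 1 = x1" "solve z g 2 = x2" "solve z g 3 = x3"
    by (simp_all add: solve_def Let_def p_def q_def one_def two_def x1_def x2_def x3_def del: One_nat_def)
  have P: "p * (1 - (1 + rt3) * z) = g 1 + g 2 + rt3 * g 3"
    "q * (1 - (1 - rt3) * z) = g 1 + g 2 - rt3 * g 3"
    "one * (1 - z) = g 2 - 2 * g 1" "two * (1 - 2 * z) = g 0 - 2 * g 1 - 2 * g 3"
    using assms(1) by (simp_all add: p_def q_def one_def two_def eig_def regular_def)
  have pq: "p = x1 + x2 + rt3 * x3" "q = x1 + x2 - rt3 * x3" "one = x2 - 2 * x1"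
    by (simp_all add: x1_def x2_def x3_def field_simps)
  have r: "rt3 * (rt3 * y) = 3 * y" for y using rt3_square by (simp only: mult.assoc[symmetric])
  have S: "(x1 + x2) * (1 - z) - 3 * z * x3 = g 1 + g 2"
  proof -
    have "2 * ((x1 + x2) * (1 - z) - 3 * z * x3) = p * (1 - (1 + rt3) * z) + q * (1 - (1 - rt3) * z)"
      unfolding pq by (simp add: algebra_simps r rt3_square)
    also have "\<dots> = 2 * (g 1 + g 2)" unfolding P by simp
    finally show ?thesis by (rule mult_left_cancel[THEN iffD1, rotated]) simp
  qed
  have e3: "x3 = z * (x1 + x2 + x3) + g 3"
  proof -
    have "2 * rt3 * (x3 * (1 - z) - z * (x1 + x2)) = p * (1 - (1 + rt3) * z) - q * (1 - (1 - rt3) * z)"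
      unfolding pq by (simp add: algebra_simps r rt3_square)
    also have "\<dots> = 2 * rt3 * g 3" unfolding P by simp
    finally have "x3 * (1 - z) - z * (x1 + x2) = g 3" by (rule mult_left_cancel[THEN iffD1, rotated]) simp
    then show ?thesis by (simp add: algebra_simps)
  qed
  have e1': "x1 * (1 - z) - z * x3 = g 1"
  proof -
    have "3 * (x1 * (1 - z) - z * x3) = ((x1 + x2) * (1 - z) - 3 * z * x3) - one * (1 - z)"
      unfolding pq by (simp add: algebra_simps)
    also have "\<dots> = 3 * g 1" unfolding P S by simp
    finally show ?thesis by (rule mult_left_cancel[THEN iffD1, rotated]) simp
  qed
  then have e1: "x1 = z * (x1 + x3) + g 1" by (simp add: algebra_simps)
  have e2: "x2 = z * (x2 + 2 * x3) + g 2"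
  proof -
    have "x2 * (1 - z) - z * (2 * x3) = ((x1 + x2) * (1 - z) - 3 * z * x3) - (x1 * (1 - z) - z * x3)"
      by (simp add: algebra_simps)
    also have "\<dots> = g 2" unfolding S e1' by simp
    finally show ?thesis by (simp add: algebra_simps)
  qed
  have e0: "two + 2 * x1 + 2 * x3 = z * (2 * (two + 2 * x1 + 2 * x3) + 2 * x2) + g 0"
  proof -
    have "g 0 = two * (1 - 2 * z) + 2 * g 1 + 2 * g 3" unfolding P by simp
    moreover have "g 1 = x1 - z * (x1 + x3)" "g 3 = x3 - z * (x1 + x2 + x3)"
      using e1 e3 by (simp_all only: eq_diff_eq add.commute)
    ultimately have "g 0 = two * (1 - 2 * z) + 2 * (x1 - z * (x1 + x3)) + 2 * (x3 - z * (x1 + x2 + x3))"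
      by (simp only:)
    then show ?thesis by (simp add: algebra_simps)
  qed
  show ?thesis
    using less_4_cases[OF assms(2)]
  proof (elim disjE)
    assume "j = 0" then show ?thesis using e0 by (simp only: row_sums s)
  next
    assume "j = 1" then show ?thesis using e1 by (simp only: row_sums s)
  next
    assume "j = 2" then show ?thesis using e2 by (simp only: row_sums s)
  next
    assume "j = 3" then show ?thesis using e3 by (simp only: row_sums s)
  qed
qed

text \<open>The coefficients do not depend on z and g, so analyticity and meromorphy of
  \<open>solve\<close> reduce to those of four quotients, for all j at once.\<close>

lemma solve_linear:
  "\<exists>a b d e. \<forall>z g. solve z g j = a * eig rt3 z g + b * eig (- rt3) z g +
    d * ((g 2 - 2 * g 1) / (1 - z)) + e * ((g 0 - 2 * g 1 - 2 * g 3) / (1 - 2 * z))"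
proof -
  have main: ?thesis if "\<And>p q one two :: complex.
    (let x1 = ((p + q) / 2 - one) / 3; x2 = (p + q + one) / 3; x3 = (p - q) / (2 * rt3)
     in if j = 0 then two + 2 * x1 + 2 * x3 else if j = 1 then x1 else if j = 2 then x2 else x3) =
    a * p + b * q + d * one + e * two" for a b d e
    using that unfolding solve_def Let_def by (intro exI[of _ a] exI[of _ b] exI[of _ d] exI[of _ e] allI)
  consider "j = 0" | "j = 1" | "j = 2" | "j \<noteq> 0" "j \<noteq> 1" "j \<noteq> 2" by blast
  then show ?thesis
  proof cases
    case 1
    show ?thesis by (rule main[of "1 / 3 + 1 / rt3" "1 / 3 - 1 / rt3" "- 2 / 3" 1]) (simp add: 1 Let_def field_simps)
  next
    case 2
    show ?thesis by (rule main[of "1 / 6" "1 / 6" "- 1 / 3" 0]) (simp add: 2 Let_def field_simps)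
  next
    case 3
    show ?thesis by (rule main[of "1 / 3" "1 / 3" "1 / 3" 0]) (simp add: 3 Let_def field_simps)
  next
    case 4
    show ?thesis by (rule main[of "1 / (2 * rt3)" "- 1 / (2 * rt3)" 0 0]) (use 4 in \<open>simp add: Let_def field_simps\<close>)
  qed
qed

section \<open>Location of the singularities and the continued series\<close>

lemma rt3_add_1: "1 + rt3 = exp (of_real (kappa * ln 2))"
proof -
  have "1 + sqrt 3 = exp (kappa * ln 2)" using two_powr_kappa by (simp add: powr_def)
  then have "complex_of_real (1 + sqrt 3) = complex_of_real (exp (kappa * ln 2))" by (simp only:)
  then have "1 + rt3 = complex_of_real (exp (kappa * ln 2))" by simp
  then show ?thesis by (simp only: exp_of_real)
qed

lemma singular_imp_eq:
  assumes "(1 + rt3) * 2 powr (- s) = 1"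
  obtains \<mu> :: int where "s = of_real kappa + 2 * of_real pi * \<i> * of_int \<mu> / of_real (ln 2)"
proof -
  have l2: "Ln 2 = of_real (ln 2)" using Ln_of_real[of 2] by simp
  have "2 powr (- s) = exp (- (s * of_real (ln 2)))" by (simp add: powr_def l2)
  then have "exp (of_real (kappa * ln 2)) * exp (- (s * of_real (ln 2))) = 1"
    using assms unfolding rt3_add_1 by (simp only:)
  moreover have "exp a * exp (- b) = 1 \<Longrightarrow> exp a = exp b" for a b :: complex
    by (simp add: exp_minus field_simps)
  ultimately have "exp (of_real (kappa * ln 2)) = exp (s * of_real (ln 2))" by blast
  then obtain n :: int where n: "s * of_real (ln 2) = of_real (kappa * ln 2) + of_real (real_of_int (2 * n) * pi) * \<i>"
    by (metis exp_eq)
  have "complex_of_real (ln 2) \<noteq> 0" by simp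
  then have "s = of_real kappa + 2 * of_real pi * \<i> * of_int n / of_real (ln 2)"
    using n by (simp add: field_simps)
  then show ?thesis by (rule that)
qed

text \<open>For Re s > 1 the modulus of 2 powr (- s) is below 1/2, so the eigenvalues of modulus at
  most 2 never make a denominator vanish.\<close>

lemma regular_iff:
  assumes "Re s > 1"
  shows "regular (2 powr (- s)) \<longleftrightarrow> (1 + rt3) * 2 powr (- s) \<noteq> 1"
proof -
  have n: "norm (2 powr (- s)) < 1 / 2"
  proof -
    have "norm (2 powr (- s)) = 2 powr (- Re s)" by (subst norm_powr_real_powr) auto
    also have "\<dots> < 2 powr (- 1)" using assms by (subst powr_less_cancel_iff) auto
    finally show ?thesis by (simp add: powr_minus)
  qed
  have *: "a * 2 powr (- s) \<noteq> 1" if "norm a \<le> 2" for a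
  proof
    assume "a * 2 powr (- s) = 1"
    then have "norm a * norm (2 powr (- s)) = 1" by (metis norm_mult norm_one)
    moreover have "norm a * norm (2 powr (- s)) \<le> 2 * norm (2 powr (- s))"
      using that by (intro mult_right_mono) auto
    ultimately show False using n by linarith
  qed
  have "norm (1 - rt3) \<le> 2"
  proof -
    have "1 - rt3 = complex_of_real (1 - sqrt 3)" by simp
    then have "norm (1 - rt3) = \<bar>1 - sqrt 3\<bar>" by (simp only: norm_of_real)
    then show ?thesis using sqrt_3_bounds by simp
  qed
  from *[OF this] *[of 1] *[of 2] show ?thesis by (simp add: regular_def)
qed

lemma regular_right:
  assumes "Re s > kappa"
  shows "regular (2 powr (- s))"
proof -
  have "(1 + rt3) * 2 powr (- s) \<noteq> 1"
  proof
    assume "(1 + rt3) * 2 powr (- s) = 1"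
    then obtain \<mu> :: int where "s = of_real kappa + 2 * of_real pi * \<i> * of_int \<mu> / of_real (ln 2)"
      by (rule singular_imp_eq)
    then have "Re s = kappa" by (simp add: Re_divide_of_real)
    then show False using assms by simp
  qed
  then show ?thesis using assms kappa_gt_1 by (simp add: regular_iff)
qed

text \<open>Regularity is an open condition, and distinct singular points are at least 2 * pi / ln 2
  > 1 apart.\<close>

lemma eventually_regular:
  assumes "Re s > 1"
  shows "eventually (\<lambda>w. regular (2 powr (- w))) (at s)"
proof (cases "regular (2 powr (- s))")
  case True
  have "((\<lambda>w. (1 + rt3) * 2 powr (- w)) \<longlongrightarrow> (1 + rt3) * 2 powr (- s)) (at s)"
    by (intro tendsto_intros) auto
  then have "eventually (\<lambda>w. (1 + rt3) * 2 powr (- w) \<noteq> 1) (at s)"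
    using True assms regular_iff tendsto_imp_eventually_ne by blast
  moreover have "eventually (\<lambda>w. Re w > 1) (at s)"
    using assms by (intro order_tendstoD(1)[OF tendsto_Re[OF tendsto_ident_at]])
  ultimately show ?thesis by eventually_elim (simp add: regular_iff)
next
  case False
  then obtain \<mu> :: int where m: "s = of_real kappa + 2 * of_real pi * \<i> * of_int \<mu> / of_real (ln 2)"
    using assms regular_iff singular_imp_eq by blast
  have "eventually (\<lambda>w. dist w s < 1 \<and> w \<noteq> s) (at s)"
    unfolding eventually_at by (intro exI[of _ 1]) auto
  moreover have "eventually (\<lambda>w. Re w > 1) (at s)"
    using assms by (intro order_tendstoD(1)[OF tendsto_Re[OF tendsto_ident_at]])
  ultimately show ?thesis
  proof eventually_elim
    case (elim w)
    show ?case
    proof (rule ccontr)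
      assume "\<not> regular (2 powr (- w))"
      then obtain \<nu> :: int where n: "w = of_real kappa + 2 * of_real pi * \<i> * of_int \<nu> / of_real (ln 2)"
        using elim regular_iff singular_imp_eq by blast
      have "w - s = of_real (2 * pi * of_int (\<nu> - \<mu>) / ln 2) * \<i>"
        unfolding m n by (simp add: field_simps)
      then have "dist w s = \<bar>2 * pi * of_int (\<nu> - \<mu>) / ln 2\<bar>"
        by (simp only: dist_norm norm_mult norm_of_real norm_ii mult_1_right)
      then have d: "dist w s = 2 * pi * \<bar>of_int (\<nu> - \<mu>)\<bar> / ln 2"
        by (simp add: abs_mult)
      have "\<nu> \<noteq> \<mu>" using elim m n by auto
      then have "1 \<le> \<bar>\<nu> - \<mu>\<bar>" by simp
      then have "(1::real) \<le> \<bar>of_int (\<nu> - \<mu>)\<bar>" by linarith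
      then have "2 * pi * 1 \<le> 2 * pi * \<bar>of_int (\<nu> - \<mu>)\<bar>" by (intro mult_left_mono) auto
      moreover have "ln 2 \<le> (1::real)" using ln_le_minus_one[of 2] by simp
      moreover have "2 * pi \<ge> 1" using pi_gt3 by simp
      ultimately have "1 * ln 2 \<le> 2 * pi * \<bar>of_int (\<nu> - \<mu>)\<bar>" by linarith
      then have "1 \<le> dist w s" unfolding d by (simp add: pos_le_divide_eq)
      then show False using elim by simp
    qed
  qed
qed

text \<open>Where 2 powr (- s) is not regular, \<open>solve\<close> divides by 0 and the value is a
  mere default; it is corrected later by \<open>remove_sings\<close>.\<close>

definition continuation :: "nat \<Rightarrow> nat \<Rightarrow> complex \<Rightarrow> complex" where
  "continuation \<eta> j s =
    (\<Sum>n\<in>{\<eta>..<max \<eta> 3}. dterm j s n) + solve (2 powr (- s)) (\<lambda>i. G (max \<eta> 3) i s) j"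

lemma entire_analytic_on: "g holomorphic_on UNIV \<Longrightarrow> g analytic_on A"
  by (meson analytic_on_holomorphic open_UNIV subset_UNIV)

lemma powr_minus_entire: "(\<lambda>s. 2 powr (- s) :: complex) holomorphic_on UNIV"
  by (intro holomorphic_intros)

lemma sum_dterm_entire: "\<eta> \<ge> 1 \<Longrightarrow> (\<lambda>s. \<Sum>n\<in>{\<eta>..<m}. dterm j s n) holomorphic_on UNIV"
  by (intro holomorphic_on_sum dterm_holomorphic) simp

lemma continuation_analytic:
  assumes "\<eta> \<ge> 1" "Re s > 1" "regular (2 powr (- s))"
  shows "continuation \<eta> j analytic_on {s}"
proof -
  have Ga: "G (max \<eta> 3) i analytic_on {s}" if "i < 4" for i
    by (rule analytic_on_subset[OF G_analytic]) (use assms that in auto)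
  have pa: "(\<lambda>s. 2 powr (- s)) analytic_on {s}"
    by (rule entire_analytic_on[OF powr_minus_entire])
  obtain a b d e where sol: "\<And>z g. solve z g j = a * eig rt3 z g + b * eig (- rt3) z g +
    d * ((g 2 - 2 * g 1) / (1 - z)) + e * ((g 0 - 2 * g 1 - 2 * g 3) / (1 - 2 * z))"
    using solve_linear[of j] by blast
  have "(\<lambda>s. solve (2 powr (- s)) (\<lambda>i. G (max \<eta> 3) i s) j) analytic_on {s}"
    unfolding sol eig_def
    by (intro analytic_on_divide analytic_on_add analytic_on_diff analytic_on_mult analytic_on_const Ga pa)
      (use assms(3) in \<open>auto simp: regular_def\<close>)
  moreover have "(\<lambda>s. \<Sum>n\<in>{\<eta>..<max \<eta> 3}. dterm j s n) analytic_on {s}"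
    by (rule entire_analytic_on[OF sum_dterm_entire[OF assms(1)]])
  ultimately show ?thesis
    unfolding continuation_def[abs_def] by (intro analytic_on_add)
qed

lemma continuation_meromorphic:
  assumes "\<eta> \<ge> 1"
  shows "continuation \<eta> j meromorphic_on {s. Re s > 1}"
proof -
  have Ga: "G (max \<eta> 3) i meromorphic_on {s. Re s > 1}" if "i < 4" for i
    by (rule analytic_on_imp_meromorphic_on[OF G_analytic]) (use assms that in auto)
  have pa: "(\<lambda>s. 2 powr (- s)) meromorphic_on {s. Re s > 1}"
    by (rule analytic_on_imp_meromorphic_on[OF entire_analytic_on[OF powr_minus_entire]])
  obtain a b d e where sol: "\<And>z g. solve z g j = a * eig rt3 z g + b * eig (- rt3) z g +
    d * ((g 2 - 2 * g 1) / (1 - z)) + e * ((g 0 - 2 * g 1 - 2 * g 3) / (1 - 2 * z))"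
    using solve_linear[of j] by blast
  have "(\<lambda>s. solve (2 powr (- s)) (\<lambda>i. G (max \<eta> 3) i s) j) meromorphic_on {s. Re s > 1}"
    unfolding sol eig_def
    by (intro meromorphic_on_divide meromorphic_on_add meromorphic_on_diff meromorphic_on_mult
        meromorphic_on_const Ga pa) auto
  moreover have "(\<lambda>s. \<Sum>n\<in>{\<eta>..<max \<eta> 3}. dterm j s n) meromorphic_on {s. Re s > 1}"
    by (rule analytic_on_imp_meromorphic_on[OF entire_analytic_on[OF sum_dterm_entire[OF assms(1)]]])
  ultimately show ?thesis
    unfolding continuation_def[abs_def] by (intro meromorphic_on_add)
qed

lemma continuation_eq_dirichlet:
  assumes "\<eta> \<ge> 1" "j < 4" "Re s > kappa"
  shows "continuation \<eta> j s = dirichlet \<eta> j s"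
proof -
  have "dirichlet (max \<eta> 3) j s = solve (2 powr (- s)) (\<lambda>i. G (max \<eta> 3) i s) j"
    by (rule solve_unique[OF regular_right[OF assms(3)] dirichlet_functional_equation assms(2)])
      (use assms in auto)
  then show ?thesis
    using dirichlet_split[of \<eta> s "max \<eta> 3" j] assms by (simp add: continuation_def)
qed

lemma continuation_solves:
  assumes "\<eta> \<ge> 3" "j < 4" "regular (2 powr (- s))"
  shows "continuation \<eta> j s = 2 powr (- s) * (\<Sum>k<4. (c j k + c (j + 4) k) * continuation \<eta> k s) + G \<eta> j s"
proof -
  have "max \<eta> 3 = \<eta>" using assms(1) by simp
  then have "continuation \<eta> i s = solve (2 powr (- s)) (\<lambda>i. G \<eta> i s) i" for i
    by (simp add: continuation_def)
  then show ?thesis using solve_solves[OF assms(3,2), of "\<lambda>i. G \<eta> i s"] by (simp only:)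
qed

lemma matrix_row:
  assumes "i < 4"
  shows "((1\<^sub>m 4 - z \<cdot>\<^sub>m (B0 + B1)) *\<^sub>v Matrix.vec 4 x) $ i = x i - z * (\<Sum>k<4. (c i k + c (i + 4) k) * x k)"
proof -
  have "((1\<^sub>m 4 - z \<cdot>\<^sub>m (B0 + B1)) *\<^sub>v Matrix.vec 4 x) $ i =
     (\<Sum>k<4. ((if i = k then 1 else 0) - z * (c i k + c (i + 4) k)) * x k)"
    using assms by (simp add: B0_def B1_def scalar_prod_def lessThan_atLeast0)
  also have "\<dots> = (\<Sum>k<4. (if i = k then x k else 0)) - z * (\<Sum>k<4. (c i k + c (i + 4) k) * x k)"
    unfolding sum_distrib_left sum_subtractf[symmetric]
    by (intro sum.cong refl) (simp add: algebra_simps)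
  also have "(\<Sum>k<4. (if i = k then x k else 0)) = x i" using assms by simp
  finally show ?thesis .
qed

text \<open>A nicely meromorphic function has the value 0 at its poles, so the functional equation
  is asked only where no component has a pole.\<close>

theorem theorem7p9:
  shows
    "(\<exists>\<Phi> :: real \<Rightarrow> real.
        (\<forall>x. \<Phi> (x + 1) = \<Phi> x) \<and>
        continuous_on UNIV \<Phi> \<and>
        (\<forall>\<alpha>. 0 < \<alpha> \<and> \<alpha> < kappa - 1 \<longrightarrow>
           (\<exists>C. \<forall>x y. \<bar>\<Phi> x - \<Phi> y\<bar> \<le> C * \<bar>x - y\<bar> powr \<alpha>)) \<and>
        (\<lambda>N :: nat. real (F N) - real N powr kappa * \<Phi> (frac (log 2 (real N))))
          \<in> O[at_top](\<lambda>N. real N * ln (real N))) \<and>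
     (\<forall>\<eta> :: nat. \<eta> \<ge> 1 \<longrightarrow>
        (\<forall>j<4. \<forall>s. Re s > kappa \<longrightarrow> dterm j s summable_on {\<eta>..}) \<and>
        (\<forall>j<4. \<forall>k<4. \<forall>s. Re s > 1 \<longrightarrow> gterm \<eta> j k s summable_on {1..}) \<and>
        (\<forall>j<4. G \<eta> j analytic_on {s. Re s > 1}) \<and>
        (\<exists>FF :: nat \<Rightarrow> complex \<Rightarrow> complex.
           (\<forall>j<4. FF j nicely_meromorphic_on {s. Re s > 1}) \<and>
           (\<forall>j<4. \<forall>s. Re s > kappa \<longrightarrow> FF j s = dirichlet \<eta> j s) \<and>
           (\<eta> \<ge> 3 \<longrightarrow>
             (\<forall>s. Re s > 1 \<and> (\<forall>j<4. \<not> is_pole (FF j) s) \<longrightarrow>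
               (1\<^sub>m 4 - (2 powr (- s)) \<cdot>\<^sub>m (B0 + B1)) *\<^sub>v Matrix.vec 4 (\<lambda>j. FF j s)
                 = Matrix.vec 4 (\<lambda>j. G \<eta> j s))) \<and>
           (\<forall>j<4. \<forall>s. Re s > 1 \<and> is_pole (FF j) s \<longrightarrow>
              (\<exists>\<mu> :: int. s = of_real (log 2 (sqrt 3 + 1))
                               + 2 * of_real pi * \<i> * of_int \<mu> / of_real (ln 2)))))"
proof (intro conjI F_asymptotics allI impI)
  fix \<eta> j :: nat and s :: complex
  assume \<eta>: "\<eta> \<ge> 1"
  show "dterm j s summable_on {\<eta>..}" if "Re s > kappa"
    by (rule abs_summable_summable, rule dterm_abs_summable[OF that]) (use \<eta> in auto)
  show "gterm \<eta> j k s summable_on {1..}" if "j < 4" "k < 4" "Re s > 1" for k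
    using \<eta> that by (intro gterm_summable) auto
  show "G \<eta> j analytic_on {s. Re s > 1}" if "j < 4"
    by (rule G_analytic[OF \<eta> that])
next
  fix \<eta> :: nat
  assume \<eta>: "\<eta> \<ge> 1"
  \<comment> \<open>\<open>remove_sings\<close> fills in limits at removable singularities and puts
    0 at poles. A solution of (1 + sqrt 3) * 2 powr (- s) = 1 need not be a pole of every
    component.\<close>
  define FF where "FF j = remove_sings (continuation \<eta> j)" for j
  have nice: "FF j nicely_meromorphic_on {s. Re s > 1}" for j
    unfolding FF_def by (intro remove_sings_nicely_meromorphic continuation_meromorphic \<eta>)
  have FF_reg: "FF j s = continuation \<eta> j s" if "Re s > 1" "regular (2 powr (- s))" for j s
    unfolding FF_def by (rule remove_sings_at_analytic[OF continuation_analytic[OF \<eta> that]])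
  have right: "FF j s = dirichlet \<eta> j s" if "j < 4" "Re s > kappa" for j s
    using FF_reg[of s j] regular_right[OF that(2)] continuation_eq_dirichlet[OF \<eta> that] that kappa_gt_1 by simp
  have eq: "(1\<^sub>m 4 - (2 powr (- s)) \<cdot>\<^sub>m (B0 + B1)) *\<^sub>v Matrix.vec 4 (\<lambda>j. FF j s) = Matrix.vec 4 (\<lambda>j. G \<eta> j s)"
    if \<eta>3: "\<eta> \<ge> 3" and s: "Re s > 1" and np: "\<And>j. j < 4 \<Longrightarrow> \<not> is_pole (FF j) s" for s
  proof (rule eq_vecI)
    fix i assume "i < dim_vec (Matrix.vec 4 (\<lambda>j. G \<eta> j s))"
    then have i: "i < 4" by simp
    have FFc: "isCont (FF j) s" if "j < 4" for j
      using nicely_meromorphic_on_imp_analytic_at[OF nice _ np[OF that]] s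
      by (auto intro: analytic_at_imp_isCont)
    have Gc: "isCont (G \<eta> i) s"
      by (rule analytic_at_imp_isCont, rule analytic_on_subset[OF G_analytic[OF \<eta> i]]) (use s in auto)
    \<comment> \<open>The equation may be asked at a point that is not regular but no pole either.
      There it follows by continuity: H is continuous at s and vanishes at all nearby points, which
      are regular.\<close>
    define H where "H w = FF i w - 2 powr (- w) * (\<Sum>k<4. (c i k + c (i + 4) k) * FF k w) - G \<eta> i w" for w
    have "isCont H s"
      unfolding H_def using i FFc Gc by (intro continuous_intros) auto
    then have "(H \<longlongrightarrow> H s) (at s)" by (simp add: isCont_def)
    moreover have "eventually (\<lambda>w. H w = 0) (at s)"
    proof -
      have "eventually (\<lambda>w. Re w > 1) (at s)"
        using s by (intro order_tendstoD(1)[OF tendsto_Re[OF tendsto_ident_at]])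
      with eventually_regular[OF s] show ?thesis
      proof eventually_elim
        case (elim w)
        then show ?case
          unfolding H_def FF_reg[OF elim(2,1)] using continuation_solves[OF \<eta>3 i elim(1)] by simp
      qed
    qed
    then have "(H \<longlongrightarrow> 0) (at s)" by (rule tendsto_eventually)
    ultimately have "H s = 0" by (rule tendsto_unique[rotated]) simp
    then show "((1\<^sub>m 4 - (2 powr (- s)) \<cdot>\<^sub>m (B0 + B1)) *\<^sub>v Matrix.vec 4 (\<lambda>j. FF j s)) $ i = Matrix.vec 4 (\<lambda>j. G \<eta> j s) $ i"
      unfolding matrix_row[OF i] using i by (simp add: H_def)
  qed (simp add: B0_def B1_def)
  have poles: "\<exists>\<mu> :: int. s = of_real (log 2 (sqrt 3 + 1)) + 2 * of_real pi * \<i> * of_int \<mu> / of_real (ln 2)"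
    if "Re s > 1" "is_pole (FF j) s" for j s
  proof -
    have "\<not> regular (2 powr (- s))"
    proof
      assume "regular (2 powr (- s))"
      then have an: "continuation \<eta> j analytic_on {s}" by (rule continuation_analytic[OF \<eta> that(1)])
      then have "is_pole (continuation \<eta> j) s"
        using that(2) unfolding FF_def
        by (subst (asm) is_pole_remove_sings_iff) (auto intro: isolated_singularity_at_analytic)
      then show False using analytic_at_imp_no_pole[OF an] by simp
    qed
    then have "(1 + rt3) * 2 powr (- s) = 1" using that(1) by (simp add: regular_iff)
    then obtain \<mu> :: int where "s = of_real kappa + 2 * of_real pi * \<i> * of_int \<mu> / of_real (ln 2)"
      by (rule singular_imp_eq)
    moreover have "kappa = log 2 (sqrt 3 + 1)" by (simp only: kappa_def add.commute)
    ultimately show ?thesis by (intro exI[of _ \<mu>]) (simp only:)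
  qed
  show "\<exists>FF :: nat \<Rightarrow> complex \<Rightarrow> complex.
           (\<forall>j<4. FF j nicely_meromorphic_on {s. Re s > 1}) \<and>
           (\<forall>j<4. \<forall>s. Re s > kappa \<longrightarrow> FF j s = dirichlet \<eta> j s) \<and>
           (\<eta> \<ge> 3 \<longrightarrow>
             (\<forall>s. Re s > 1 \<and> (\<forall>j<4. \<not> is_pole (FF j) s) \<longrightarrow>
               (1\<^sub>m 4 - (2 powr (- s)) \<cdot>\<^sub>m (B0 + B1)) *\<^sub>v Matrix.vec 4 (\<lambda>j. FF j s)
                 = Matrix.vec 4 (\<lambda>j. G \<eta> j s))) \<and>
           (\<forall>j<4. \<forall>s. Re s > 1 \<and> is_pole (FF j) s \<longrightarrow>
              (\<exists>\<mu> :: int. s = of_real (log 2 (sqrt 3 + 1))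
                               + 2 * of_real pi * \<i> * of_int \<mu> / of_real (ln 2)))"
  proof (rule exI[of _ FF], intro conjI allI impI)
    fix s assume "\<eta> \<ge> 3" "Re s > 1 \<and> (\<forall>j<4. \<not> is_pole (FF j) s)"
    then show "(1\<^sub>m 4 - (2 powr (- s)) \<cdot>\<^sub>m (B0 + B1)) *\<^sub>v Matrix.vec 4 (\<lambda>j. FF j s)
                 = Matrix.vec 4 (\<lambda>j. G \<eta> j s)"
      by (intro eq) auto
  next
    fix j :: nat and s assume "Re s > 1 \<and> is_pole (FF j) s"
    then show "\<exists>\<mu> :: int. s = of_real (log 2 (sqrt 3 + 1))
                               + 2 * of_real pi * \<i> * of_int \<mu> / of_real (ln 2)"
      by (intro poles) auto
  qed (rule nice, rule right)
qed

end
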